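(* Let $K$ be a field with $\operatorname{char} K \neq 2,3$, let $E$ be an elliptic curve defined over $K$, and let $P \in E(K)$ be a non-torsion point. Suppose that $P$ is magnified by tripling a point, i.e. there exist a finite extension $L/K$ with $[L:K] < 9$ and a point $R \in E(L)$ with $3R = P$. Then either $P$ is $K$-magnified (i.e. there exist an elliptic curve $E'$ defined over $K$, an isogeny $\phi: E' \to E$ defined over $K$ with $\deg\phi>1$, and a point $Q \in E'(K)$ with $\phi(Q) = P$), or $E$ has a non-trivial $K$-rational $3$-torsion point.
   Context: Definition (paper's): for a field $K$, an elliptic curve $E/K$, a point $P\in E(K)$ and an isogeny $\phi:E'\to E$, $P$ is called magnified (by $\phi$) if $E'$, $\phi$ and some point of $\phi^{-1}(P)$ are all defined over a finite extension $L/K$ with $[L:K]<\deg\phi$; it is called $K$-magnified if this holds with $L=K$. "Magnified by tripling a point" means magnified with $\phi$ the multiplication-by-$3$ map $E\to E$ (of degree $9$). *)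

theory Defs
  imports
    "HOL-Computational_Algebra.Polynomial_Factorial"
    "HOL-Algebra.Generated_Fields"
    "HOL-Algebra.Embedded_Algebras"
begin

section \<open>Elliptic curves in Weierstrass form\<close>

text \<open>The curve \<open>y\<^sup>2 + a\<^sub>1 x y + a\<^sub>3 y = x\<^sup>3 + a\<^sub>2 x\<^sup>2 + a\<^sub>4 x + a\<^sub>6\<close>. Base change along a field
  embedding \<open>\<iota>\<close> is \<open>map_weierstrass \<iota>\<close> on curves and \<open>map_ec_point \<iota>\<close> on points.\<close>

datatype 'a weierstrass =
  Weierstrass (wa1: 'a) (wa2: 'a) (wa3: 'a) (wa4: 'a) (wa6: 'a)

definition wdisc :: "'a::field weierstrass \<Rightarrow> 'a" where
  "wdisc E =
     (let b2 = (wa1 E)\<^sup>2 + 4 * wa2 E;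
          b4 = 2 * wa4 E + wa1 E * wa3 E;
          b6 = (wa3 E)\<^sup>2 + 4 * wa6 E;
          b8 = (wa1 E)\<^sup>2 * wa6 E + 4 * wa2 E * wa6 E - wa1 E * wa3 E * wa4 E
               + wa2 E * (wa3 E)\<^sup>2 - (wa4 E)\<^sup>2
      in - b2\<^sup>2 * b8 - 8 * b4 ^ 3 - 27 * b6\<^sup>2 + 9 * b2 * b4 * b6)"

definition elliptic_curve :: "'a::field weierstrass \<Rightarrow> bool" where
  "elliptic_curve E \<longleftrightarrow> wdisc E \<noteq> 0"

datatype 'a ec_point = Infinity | Affine 'a 'a

fun proj_coords :: "'a::field ec_point \<Rightarrow> 'a \<times> 'a \<times> 'a" where
  "proj_coords Infinity = (0, 1, 0)"
| "proj_coords (Affine x y) = (x, y, 1)"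

fun on_curve :: "'a::field weierstrass \<Rightarrow> 'a ec_point \<Rightarrow> bool" where
  "on_curve E Infinity \<longleftrightarrow> True"
| "on_curve E (Affine x y) \<longleftrightarrow>
     y\<^sup>2 + wa1 E * x * y + wa3 E * y = x ^ 3 + wa2 E * x\<^sup>2 + wa4 E * x + wa6 E"

definition points :: "'a::field weierstrass \<Rightarrow> 'a ec_point set" where
  "points E = {P. on_curve E P}"

fun ec_add :: "'a::field weierstrass \<Rightarrow> 'a ec_point \<Rightarrow> 'a ec_point \<Rightarrow> 'a ec_point" where
  "ec_add E Infinity Q = Q"
| "ec_add E P Infinity = P"
| "ec_add E (Affine x1 y1) (Affine x2 y2) =
     (if x1 = x2 \<and> y1 + y2 + wa1 E * x2 + wa3 E = 0 then Infinity
      else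
        let l = (if x1 \<noteq> x2 then (y2 - y1) / (x2 - x1)
                 else (3 * x1\<^sup>2 + 2 * wa2 E * x1 + wa4 E - wa1 E * y1)
                      / (2 * y1 + wa1 E * x1 + wa3 E));
            x3 = l\<^sup>2 + wa1 E * l - wa2 E - x1 - x2;
            y3 = - (l + wa1 E) * x3 - (y1 - l * x1) - wa3 E
        in Affine x3 y3)"

fun ec_mult :: "'a::field weierstrass \<Rightarrow> nat \<Rightarrow> 'a ec_point \<Rightarrow> 'a ec_point" where
  "ec_mult E 0 P = Infinity"
| "ec_mult E (Suc n) P = ec_add E P (ec_mult E n P)"

definition torsion_point :: "'a::field weierstrass \<Rightarrow> 'a ec_point \<Rightarrow> bool" where
  "torsion_point E P \<longleftrightarrow> (\<exists>n>0. ec_mult E n P = Infinity)"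


section \<open>Field extensions\<close>

definition field_embedding :: "('k::field \<Rightarrow> 'l::field) \<Rightarrow> bool" where
  "field_embedding \<iota> \<longleftrightarrow>
     \<iota> 1 = 1 \<and> (\<forall>a b. \<iota> (a + b) = \<iota> a + \<iota> b) \<and> (\<forall>a b. \<iota> (a * b) = \<iota> a * \<iota> b)"

definition finite_extension :: "('k::field \<Rightarrow> 'l::field) \<Rightarrow> bool" where
  "finite_extension \<iota> \<longleftrightarrow> field_embedding \<iota> \<and>
     (\<exists>B. finite B \<and> module.span (\<lambda>c z. \<iota> c * z) B = UNIV)"

definition extension_degree :: "('k::field \<Rightarrow> 'l::field) \<Rightarrow> nat" where
  "extension_degree \<iota> = vector_space.dim (\<lambda>c z. \<iota> c * z) UNIV"


section \<open>The function field of a Weierstrass curve\<close>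

text \<open>\<open>K(E) = K(x)[y] / (y\<^sup>2 + (a\<^sub>1 x + a\<^sub>3) y - (x\<^sup>3 + a\<^sub>2 x\<^sup>2 + a\<^sub>4 x + a\<^sub>6))\<close>, with the pair
  \<open>(u, v)\<close> standing for \<open>u + v y\<close>. Likewise a pair \<open>(A, B)\<close> of polynomials stands for the
  element \<open>A(x) + B(x) y\<close> of the affine coordinate ring \<open>K[E]\<close>.\<close>

type_synonym 'k ffun = "'k poly fract \<times> 'k poly fract"
type_synonym 'k cfun = "'k poly \<times> 'k poly"

definition function_field :: "'k::field weierstrass \<Rightarrow> 'k ffun ring" where
  "function_field E =
     (let f = to_fract [:wa6 E, wa4 E, wa2 E, 1:]; h = to_fract [:wa3 E, wa1 E:] in
      \<lparr> carrier = UNIV,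
        mult = (\<lambda>(u1, v1) (u2, v2).
                  (u1 * u2 + v1 * v2 * f, u1 * v2 + u2 * v1 - v1 * v2 * h)),
        one = (1, 0),
        zero = (0, 0),
        add = (\<lambda>(u1, v1) (u2, v2). (u1 + u2, v1 + v2)) \<rparr>)"

lemma weierstrass_no_poly_root:
  fixes p q :: "'k::field poly"
  assumes q: "q \<noteq> 0" and d: "degree h \<le> 1" "degree f = 3"
  shows "p * p + h * p * q \<noteq> f * q * q"
proof
  assume eq: "p * p + h * p * q = f * q * q"
  have f0: "f \<noteq> 0" using d by auto
  have R: "degree (f * q * q) = 3 + 2 * degree q" using q f0 d by (simp add: degree_mult_eq)
  have p0: "p \<noteq> 0" using eq q f0 by auto
  have L1: "degree (p * p) = 2 * degree p" using p0 by (simp add: degree_mult_eq)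
  have L2: "degree (h * p * q) \<le> 1 + degree p + degree q"
    by (rule order_trans[OF degree_mult_le]) (use degree_mult_le[of h p] d in linarith)
  show False
  proof (cases "degree p \<ge> degree q + 2")
    case True
    have "degree (h * p * q) < degree (p * p)" using L1 L2 True by linarith
    hence "degree (p * p + h * p * q) = 2 * degree p" by (simp add: degree_add_eq_left L1)
    hence "2 * degree p = 3 + 2 * degree q" using eq R by simp
    thus False by presburger
  next
    case False
    have "degree (p * p + h * p * q) \<le> 2 + 2 * degree q"
      by (rule degree_add_le) (use L1 L2 False in auto)
    thus False using eq R by simp
  qed
qed

lemma weierstrass_no_root:
  fixes t :: "'k::field poly fract"
  assumes d: "degree h \<le> 1" "degree f = 3"
  shows "t * t + to_fract h * t \<noteq> to_fract f"
proof (cases t)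
  case (Fract p q)
  show ?thesis
  proof
    assume "t * t + to_fract h * t = to_fract f"
    hence "Fract ((p * p) * q + h * p * (q * q)) (q*q*q) = Fract f 1"
      using Fract by (simp add: to_fract_def)
    hence "(p * p) * q + h * p * (q * q) = f * (q*q*q)" using Fract by (simp add: eq_fract)
    hence "q * (p * p + h * p * q) = q * (f * q * q)" by (simp add: algebra_simps)
    hence "p * p + h * p * q = f * q * q" using Fract by (metis mult_left_cancel)
    with weierstrass_no_poly_root[OF _ d, of q p] Fract show False by auto
  qed
qed

lemma function_field_field: "field (function_field E)"
proof -
  define f where "f = to_fract [:wa6 E, wa4 E, wa2 E, 1:]"
  define h where "h = to_fract [:wa3 E, wa1 E:]"
  note D = function_field_def[of E, unfolded Let_def, folded f_def h_def]
  have N: "u * u - u * v * h - v * v * f \<noteq> 0" if "(u, v) \<noteq> (0, 0)" for u v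
  proof (cases "v = 0")
    case True thus ?thesis using that by auto
  next
    case False
    have "(-(u/v)) * (-(u/v)) + h * (-(u/v)) \<noteq> f"
      unfolding f_def h_def by (rule weierstrass_no_root) auto
    thus ?thesis using False by (auto simp: field_simps)
  qed
  interpret cring "function_field E"
  proof (rule cringI)
    show "abelian_group (function_field E)"
    proof (rule abelian_groupI)
      fix x assume "x \<in> carrier (function_field E)"
      show "\<exists>y\<in>carrier (function_field E). y \<oplus>\<^bsub>function_field E\<^esub> x = \<zero>\<^bsub>function_field E\<^esub>"
        by (rule bexI[of _ "(- fst x, - snd x)"]) (auto simp: D split: prod.splits)
    qed (auto simp: D algebra_simps split: prod.splits)
    show "comm_monoid (function_field E)"
      by (rule comm_monoidI) (auto simp: D algebra_simps split: prod.splits)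
  qed (auto simp: D algebra_simps split: prod.splits)
  show ?thesis
  proof (rule cring_fieldI2)
    show "\<zero>\<^bsub>function_field E\<^esub> \<noteq> \<one>\<^bsub>function_field E\<^esub>" by (simp add: D)
    fix a assume "a \<in> carrier (function_field E)" and a0: "a \<noteq> \<zero>\<^bsub>function_field E\<^esub>"
    obtain u v where a: "a = (u, v)" by (cases a)
    define n where "n = u * u - u * v * h - v * v * f"
    have n0: "n \<noteq> 0" using N[of u v] a a0 by (simp add: n_def D)
    have "u * ((u - v * h) / n) + v * (- v / n) * f = n / n"
      unfolding n_def diff_divide_distrib by (simp add: algebra_simps diff_divide_distrib)
    hence 1: "u * ((u - v * h) / n) + v * (- v / n) * f = 1" using n0 by simp
    have 2: "u * (- v / n) + (u - v * h) / n * v - v * (- v / n) * h = 0"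
      by (simp add: algebra_simps diff_divide_distrib)
    have "a \<otimes>\<^bsub>function_field E\<^esub> ((u - v * h) / n, - v / n) = \<one>\<^bsub>function_field E\<^esub>"
      unfolding D a by (simp only: 1 2 monoid.simps prod.case)
    moreover have "((u - v * h) / n, - v / n) \<in> carrier (function_field E)" by (simp add: D)
    ultimately show "\<exists>b\<in>carrier (function_field E). a \<otimes>\<^bsub>function_field E\<^esub> b = \<one>\<^bsub>function_field E\<^esub>"
      by blast
  qed
qed

definition ff_const :: "'k::field \<Rightarrow> 'k ffun" where
  "ff_const c = (to_fract [:c:], 0)"

definition ff_of_cfun :: "'k::field cfun \<Rightarrow> 'k ffun" where
  "ff_of_cfun g = (to_fract (fst g), to_fract (snd g))"

definition cfun_eval :: "'k::field cfun \<Rightarrow> 'k \<Rightarrow> 'k \<Rightarrow> 'k" where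
  "cfun_eval g x y = poly (fst g) x + poly (snd g) x * y"

text \<open>Since \<open>x\<close> and \<open>y\<close> have poles of order 2 and 3 at the point at infinity, the orders of the
  monomials \<open>x\<^sup>i\<close> and \<open>x\<^sup>i y\<close> are pairwise distinct, so the pole order of an element of \<open>K[E]\<close>
  is the largest one that occurs. It is never 1, so \<open>cfun_coeff\<close> is
  only relevant for \<open>n\<close> even or \<open>n \<ge> 3\<close>.\<close>

definition cfun_pole :: "'k::field cfun \<Rightarrow> nat" where
  "cfun_pole g =
     (if snd g = 0 then 2 * degree (fst g) else max (2 * degree (fst g)) (2 * degree (snd g) + 3))"

definition cfun_coeff :: "'k::field cfun \<Rightarrow> nat \<Rightarrow> 'k" where
  "cfun_coeff g n =
     (if even n then poly.coeff (fst g) (n div 2) else poly.coeff (snd g) ((n - 3) div 2))"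

text \<open>\<open>has_value E F P c\<close>: the rational function \<open>F\<close> lies in the local ring of \<open>E\<close> at \<open>P\<close> and
  has the value \<open>c\<close> there, that is, \<open>F = g / h\<close> with \<open>g, h \<in> K[E]\<close> such that \<open>h\<close> does not vanish
  at \<open>P\<close> (at infinity: such that the pole of \<open>h\<close> is at least that of \<open>g\<close>).\<close>

definition has_value :: "'k::field weierstrass \<Rightarrow> 'k ffun \<Rightarrow> 'k ec_point \<Rightarrow> 'k \<Rightarrow> bool" where
  "has_value E F P c \<longleftrightarrow>
     (\<exists>g h. F \<otimes>\<^bsub>function_field E\<^esub> ff_of_cfun h = ff_of_cfun g \<and>
        (case P of
           Affine x y \<Rightarrow> cfun_eval h x y \<noteq> 0 \<and> c = cfun_eval g x y / cfun_eval h x y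
         | Infinity \<Rightarrow> h \<noteq> (0, 0) \<and> cfun_pole g \<le> cfun_pole h \<and>
             c = cfun_coeff g (cfun_pole h) / cfun_coeff h (cfun_pole h)))"


section \<open>Isogenies\<close>

text \<open>A rational map from \<open>E'\<close> to \<open>E\<close> over \<open>K\<close> whose image is not the point at infinity is
  \<open>[X : Y : 1]\<close> for some \<open>X, Y \<in> K(E')\<close> satisfying the equation of \<open>E\<close>, and it is
  represented by the pair \<open>(X, Y)\<close>. As \<open>E'\<close> is a smooth curve, it is a morphism; its value at \<open>P\<close>
  is found after multiplying the homogeneous coordinates by a suitable \<open>G \<in> K(E')\<close>.\<close>

definition rational_map ::
    "'k::field weierstrass \<Rightarrow> 'k weierstrass \<Rightarrow> 'k ffun \<times> 'k ffun \<Rightarrow> bool" where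
  "rational_map E' E \<phi> \<longleftrightarrow>
     (let R = function_field E'; X = fst \<phi>; Y = snd \<phi> in
        (Y \<otimes>\<^bsub>R\<^esub> Y) \<oplus>\<^bsub>R\<^esub> (ff_const (wa1 E) \<otimes>\<^bsub>R\<^esub> X \<otimes>\<^bsub>R\<^esub> Y) \<oplus>\<^bsub>R\<^esub> (ff_const (wa3 E) \<otimes>\<^bsub>R\<^esub> Y)
      = (X \<otimes>\<^bsub>R\<^esub> X \<otimes>\<^bsub>R\<^esub> X) \<oplus>\<^bsub>R\<^esub> (ff_const (wa2 E) \<otimes>\<^bsub>R\<^esub> X \<otimes>\<^bsub>R\<^esub> X)
        \<oplus>\<^bsub>R\<^esub> (ff_const (wa4 E) \<otimes>\<^bsub>R\<^esub> X) \<oplus>\<^bsub>R\<^esub> ff_const (wa6 E))"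

definition maps_to ::
    "'k::field weierstrass \<Rightarrow> 'k ffun \<times> 'k ffun \<Rightarrow> 'k ec_point \<Rightarrow> 'k ec_point \<Rightarrow> bool" where
  "maps_to E' \<phi> P Q \<longleftrightarrow>
     (\<exists>G. case proj_coords Q of (q0, q1, q2) \<Rightarrow>
        has_value E' (G \<otimes>\<^bsub>function_field E'\<^esub> fst \<phi>) P q0 \<and>
        has_value E' (G \<otimes>\<^bsub>function_field E'\<^esub> snd \<phi>) P q1 \<and>
        has_value E' G P q2)"

text \<open>Mapping the point at infinity to the point at infinity forces \<open>(X, Y)\<close> to be
  non-constant; the zero isogeny, of degree 0, has no representation of this form.\<close>

definition isogeny ::
    "'k::field weierstrass \<Rightarrow> 'k weierstrass \<Rightarrow> 'k ffun \<times> 'k ffun \<Rightarrow> bool" where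
  "isogeny E' E \<phi> \<longleftrightarrow> elliptic_curve E' \<and> elliptic_curve E \<and>
     rational_map E' E \<phi> \<and> maps_to E' \<phi> Infinity Infinity"

text \<open>The degree \<open>[K(E') : \<phi>\<^sup>* K(E)]\<close>, where \<open>\<phi>\<^sup>* K(E) = K(X, Y)\<close>.\<close>

definition pullback_field ::
    "'k::field weierstrass \<Rightarrow> 'k ffun \<times> 'k ffun \<Rightarrow> 'k ffun set" where
  "pullback_field E' \<phi> =
     generate_field (function_field E') (range ff_const \<union> {fst \<phi>, snd \<phi>})"

definition isogeny_degree :: "'k::field weierstrass \<Rightarrow> 'k ffun \<times> 'k ffun \<Rightarrow> nat" where
  "isogeny_degree E' \<phi> =
     ring.dim (function_field E') (pullback_field E' \<phi>) (carrier (function_field E'))"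

definition K_magnified :: "'k::field weierstrass \<Rightarrow> 'k ec_point \<Rightarrow> bool" where
  "K_magnified E P \<longleftrightarrow>
     (\<exists>E' \<phi> Q. elliptic_curve E' \<and> isogeny E' E \<phi> \<and> isogeny_degree E' \<phi> > 1 \<and>
        Q \<in> points E' \<and> maps_to E' \<phi> Q P)"

end

theory Submission
  imports Defs "HOL-Algebra.Algebraic_Closure_Type"
begin

text \<open>After completing the square, \<open>E\<close> is \<open>y\<^sup>2 = f(x)\<close>, and the abscissae of the nine points \<open>R\<close>
  with \<open>3 R = P\<close> are the roots of a polynomial of degree 9 over \<open>K\<close>, which has a factor \<open>h\<close> of degree
  at most 4 as soon as one root has degree less than 9. The ordinates of these points are \<open>r(x)\<close> for
  a polynomial \<open>r\<close> over \<open>K\<close>, so the sum \<open>S\<close> of the points over the roots of \<open>h\<close> is \<open>K\<close>-rational and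
  \<open>3 S = (deg h) P\<close>. If \<open>deg h\<close> is prime to 3, then some combination of \<open>S\<close> and \<open>P\<close> is a
  rational third of \<open>P\<close>. If \<open>deg h = 3\<close>, then \<open>S - P\<close> is a rational 3-torsion point; when it
  vanishes, the three points form a coset of a rational subgroup of order 3, which is a rational point of
  the quotient curve and is mapped to \<open>P\<close> by the dual isogeny.

  Associativity of the group law and the rationality of \<open>S\<close> both rest on one observation: if \<open>r\<^sup>2 - f\<close> splits
  as \<open>c\<^sup>2 q q'\<close>, then the remainders \<open>p\<close>, \<open>p'\<close> of \<open>r\<close> modulo \<open>q\<close>, \<open>q'\<close> satisfy
  \<open>p\<^sup>2 - f = - c q (p + p')\<close>, and symmetrically.\<close>

text \<open>Galois theory does not enter. The curve \<open>y = r(x)\<close> meets \<open>E\<close>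
  over the roots of \<open>h\<close> and over those of the complementary factor of
  \<open>r\<^sup>2 - f\<close>, which again has coefficients in \<open>K\<close>. For
  \<open>h\<close> of degree 2 to 4 this complement has degree at most 2, and a quadratic one is
  traded for a line with one further point; so \<open>S\<close> or its negative is zero or lies over
  a rational abscissa. Multiplicities are kept by \<open>h dvd r\<^sup>2 - f\<close>. The polynomial
  \<open>r\<close> exists because \<open>3 (x, y)\<close> has ordinate
  \<open>y omega(x) / psi(x)\<^sup>3\<close>, whose value here is nonzero as \<open>P\<close> does
  not have order 2: so \<open>omega\<close> is invertible modulo \<open>h\<close>. For degrees 1, 2,
  4 the rational third is \<open>S\<close>, \<open>P - S\<close>, \<open>S - P\<close>. In the coset
  case the subgroup must be shown rational: its abscissa is isolated as a common root of rational
  polynomials, one of them quadratic. Moving it to 0 turns the cubic into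
  \<open>u\<^sup>3 + w (3 n u + 1)\<^sup>2\<close>, whose quotient and dual isogeny are explicit, so
  polynomial identities suffice. Of the degree of an isogeny only \<open>> 1\<close> is needed:
  \<open>x\<close> lies outside the pulled back field.\<close>

hide_const (open) module.smult up_ring.coeff up_ring.monom Polynomials.degree Polynomials.lead_coeff

section \<open>The group law\<close>

fun ec_neg :: "'a::field ec_point \<Rightarrow> 'a ec_point" where
  "ec_neg Infinity = Infinity"
| "ec_neg (Affine x y) = Affine x (- y)"

lemma ec_neg_neg [simp]: "ec_neg (ec_neg P) = P"
  by (cases P) auto

text \<open>Only roots in the field itself are tested for being simple, which is what tangents at
  points of ordinate 0 require. The condition follows from a nonzero discriminant but does not pass
  to larger fields by itself, so base change goes through the discriminant.\<close>

locale cubic_curve =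
  fixes a2 a4 a6 :: "'f::field"
  assumes two: "(2::'f) \<noteq> 0"
    and nonsingular: "\<And>x. x ^ 3 + a2 * x\<^sup>2 + a4 * x + a6 = 0 \<Longrightarrow> 3 * x\<^sup>2 + 2 * a2 * x + a4 \<noteq> 0"
begin

abbreviation E :: "'f weierstrass" where "E \<equiv> Weierstrass 0 a2 0 a4 a6"

definition f :: "'f poly" where "f = [:a6, a4, a2, 1:]"

lemma on_curve_neg [simp]: "on_curve E (ec_neg P) \<longleftrightarrow> on_curve E P"
  by (cases P) auto

text \<open>The line \<open>y = l x + m\<close> meets the curve in the three points, counted with multiplicity.\<close>

definition on_line :: "'f \<Rightarrow> 'f \<Rightarrow> 'f \<Rightarrow> 'f \<Rightarrow> 'f \<Rightarrow> 'f \<Rightarrow> 'f \<Rightarrow> 'f \<Rightarrow> bool" where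
  "on_line l m x1 y1 x2 y2 x3 y3 \<longleftrightarrow> y1 = l * x1 + m \<and> y2 = l * x2 + m \<and> y3 = l * x3 + m \<and>
     l\<^sup>2 - a2 = x1 + x2 + x3 \<and> a4 - 2 * l * m = x1 * x2 + x1 * x3 + x2 * x3 \<and>
     m\<^sup>2 - a6 = x1 * x2 * x3"

definition collinear :: "'f ec_point \<Rightarrow> 'f ec_point \<Rightarrow> 'f ec_point \<Rightarrow> bool" where
  "collinear P Q R \<longleftrightarrow> (\<exists>l m x1 y1 x2 y2 x3 y3. P = Affine x1 y1 \<and> Q = Affine x2 y2 \<and>
     R = Affine x3 y3 \<and> on_line l m x1 y1 x2 y2 x3 y3)"

lemma collinear_iff [simp]:
  "collinear (Affine x1 y1) (Affine x2 y2) (Affine x3 y3) \<longleftrightarrow>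
     (\<exists>l m. on_line l m x1 y1 x2 y2 x3 y3)"
  by (auto simp: collinear_def)

lemma collinear_rot: "collinear P Q R \<Longrightarrow> collinear Q R P"
  unfolding collinear_def on_line_def by (force simp: algebra_simps)

lemma collinear_swap: "collinear P Q R \<Longrightarrow> collinear Q P R"
  unfolding collinear_def on_line_def by (force simp: algebra_simps)

lemma on_line_on_curve:
  assumes "on_line l m x1 y1 x2 y2 x3 y3" shows "y1\<^sup>2 = x1 ^ 3 + a2 * x1\<^sup>2 + a4 * x1 + a6"
proof -
  have a: "a2 = l\<^sup>2 - x1 - x2 - x3" "a4 = 2 * l * m + x1 * x2 + x1 * x3 + x2 * x3"
    "a6 = m\<^sup>2 - x1 * x2 * x3" and y: "y1 = l * x1 + m"
    using assms by (auto simp: on_line_def algebra_simps)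
  show ?thesis unfolding a y by Groebner_Basis.algebra
qed

lemma collinear_on_curve:
  assumes "collinear P Q R" shows "on_curve E P" "on_curve E Q" "on_curve E R"
proof -
  have *: "on_curve E P" if "collinear P Q R" for P Q R
    using that on_line_on_curve unfolding collinear_def by auto
  show "on_curve E P" "on_curve E Q" "on_curve E R"
    using *[OF assms] *[OF collinear_rot[OF assms]]
      *[OF collinear_rot[OF collinear_rot[OF assms]]] by auto
qed

lemma collinear_neg: "collinear P Q R \<Longrightarrow> collinear (ec_neg P) (ec_neg Q) (ec_neg R)"
proof -
  assume "collinear P Q R"
  then obtain l m x1 y1 x2 y2 x3 y3 where "P = Affine x1 y1" "Q = Affine x2 y2" "R = Affine x3 y3"
    "on_line l m x1 y1 x2 y2 x3 y3" by (auto simp: collinear_def)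
  moreover from this have "on_line (-l) (-m) x1 (-y1) x2 (-y2) x3 (-y3)"
    by (auto simp: on_line_def)
  ultimately show ?thesis by auto
qed

lemma collinear_add:
  assumes "collinear P Q R" shows "ec_add E P Q = ec_neg R"
proof -
  from assms obtain l m x1 y1 x2 y2 x3 y3 where P: "P = Affine x1 y1" and Q: "Q = Affine x2 y2"
    and R: "R = Affine x3 y3" and L: "on_line l m x1 y1 x2 y2 x3 y3" by (auto simp: collinear_def)
  have L': "y1 = l * x1 + m" "y2 = l * x2 + m" "y3 = l * x3 + m" "l\<^sup>2 - a2 = x1 + x2 + x3"
    "a4 - 2 * l * m = x1 * x2 + x1 * x3 + x2 * x3" "m\<^sup>2 - a6 = x1 * x2 * x3"
    using L by (auto simp: on_line_def)
  have x3: "x3 = l\<^sup>2 - a2 - x1 - x2" using L'(4) by (simp add: algebra_simps)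
  have y3: "- y3 = - l * x3 - (y1 - l * x1)" using L'(1,3) by (simp add: algebra_simps)
  have a2: "a2 = l\<^sup>2 - x1 - x2 - x3" using L'(4) by (simp add: algebra_simps)
  have a4: "a4 = 2 * l * m + x1 * x2 + x1 * x3 + x2 * x3" using L'(5) by (simp add: algebra_simps)
  show ?thesis
  proof (cases "x1 = x2")
    case False
    have "(y2 - y1) / (x2 - x1) = l" using L'(1,2) False by (simp add: divide_simps right_diff_distrib)
    thus ?thesis using False x3 y3 by (simp add: P Q R Let_def)
  next
    case True
    have y12: "y1 = y2" using L' True by simp
    \<comment> \<open>A non-vertical line with double contact at a point of ordinate 0 would make
      its abscissa a double root of the cubic.\<close>
    have y10: "y1 \<noteq> 0"
    proof
      assume "y1 = 0"
      moreover have "x1 ^ 3 + a2 * x1\<^sup>2 + a4 * x1 + a6 = y1\<^sup>2" using on_line_on_curve[OF L] by simp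
      moreover have "3 * x1\<^sup>2 + 2 * a2 * x1 + a4 = 2 * l * y1"
        unfolding a2 a4 L'(1) True by Groebner_Basis.algebra
      ultimately show False using nonsingular[of x1] by simp
    qed
    have 2: "2 * y1 \<noteq> 0" using two y10 by simp
    have "(3 * x1\<^sup>2 + 2 * a2 * x1 + a4) = l * (2 * y1)"
      unfolding a2 a4 L'(1) True by Groebner_Basis.algebra
    hence "(3 * x1\<^sup>2 + 2 * a2 * x1 + a4) / (2 * y1) = l" using 2 by simp
    moreover have "y1 + y2 \<noteq> 0" using 2 y12 by (metis mult_2)
    ultimately show ?thesis using True y12 x3 y3 by (simp add: P Q R Let_def)
  qed
qed

lemma collinear_exists:
  assumes "on_curve E P" "on_curve E Q" "P \<noteq> Infinity" "Q \<noteq> Infinity" "Q \<noteq> ec_neg P"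
  shows "\<exists>R. collinear P Q R"
proof -
  obtain x1 y1 x2 y2 where P: "P = Affine x1 y1" and Q: "Q = Affine x2 y2"
    using assms(3,4) by (cases P; cases Q) auto
  have c: "y1\<^sup>2 = x1 ^ 3 + a2 * x1\<^sup>2 + a4 * x1 + a6" "y2\<^sup>2 = x2 ^ 3 + a2 * x2\<^sup>2 + a4 * x2 + a6"
    using assms(1,2) P Q by auto
  show ?thesis
  proof (cases "x1 = x2")
    case False
    define l where "l = (y2 - y1) / (x2 - x1)"
    have l: "l * (x2 - x1) = y2 - y1" using False by (simp add: l_def)
    define m where "m = y1 - l * x1"
    define x3 where "x3 = l\<^sup>2 - a2 - x1 - x2"
    have y2: "y2 = y1 + l * (x2 - x1)" using l by simp
    \<comment> \<open>The difference of the two curve equations yields \<open>a4\<close> times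
      \<open>x2 - x1\<close>, so the second Vieta relation is proved with this nonzero factor;
      \<open>x3\<close> was chosen to satisfy the first one.\<close>
    have "(x2 - x1) * a4 = y2\<^sup>2 - y1\<^sup>2 - (x2 ^ 3 - x1 ^ 3) - a2 * (x2\<^sup>2 - x1\<^sup>2)"
      unfolding c by (simp add: algebra_simps)
    moreover have "(x2 - x1) * (a4 - 2 * l * m) = (x2 - x1) * a4 - (x2 - x1) * 2 * l * m"
      by (simp add: algebra_simps)
    ultimately have "(x2 - x1) * (a4 - 2 * l * m) =
        (y1 + l * (x2 - x1))\<^sup>2 - y1\<^sup>2 - (x2 ^ 3 - x1 ^ 3) - a2 * (x2\<^sup>2 - x1\<^sup>2) - (x2 - x1) * 2 * l * m"
      unfolding y2 by simp
    also have "\<dots> = (x2 - x1) * (x1 * x2 + x1 * x3 + x2 * x3)"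
      unfolding x3_def m_def by Groebner_Basis.algebra
    finally have 1: "a4 - 2 * l * m = x1 * x2 + x1 * x3 + x2 * x3" using False by simp
    have a4: "a4 = x1 * x2 + x1 * x3 + x2 * x3 + 2 * l * m" using 1 by (simp add: algebra_simps)
    have a6: "a6 = y1\<^sup>2 - x1 ^ 3 - a2 * x1\<^sup>2 - a4 * x1" unfolding c by simp
    have 2: "m\<^sup>2 - a6 = x1 * x2 * x3" unfolding a6 a4 unfolding x3_def m_def by Groebner_Basis.algebra
    have "on_line l m x1 y1 x2 y2 x3 (l * x3 + m)"
      unfolding on_line_def using 1 2 l by (auto simp: x3_def m_def algebra_simps)
    thus ?thesis unfolding P Q using collinear_iff by blast
  next
    case True
    have "(y1 - y2) * (y1 + y2) = 0" using c True by (simp add: power2_eq_square algebra_simps)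
    moreover have "y1 + y2 \<noteq> 0" using assms(5) True P Q by (auto simp: add_eq_0_iff)
    ultimately have y: "y2 = y1" by simp
    with \<open>y1 + y2 \<noteq> 0\<close> have y0: "2 * y1 \<noteq> 0" by (metis mult_2)
    define l where "l = (3 * x1\<^sup>2 + 2 * a2 * x1 + a4) / (2 * y1)"
    have l: "l * (2 * y1) = 3 * x1\<^sup>2 + 2 * a2 * x1 + a4" using y0 by (simp add: l_def)
    define m where "m = y1 - l * x1"
    define x3 where "x3 = l\<^sup>2 - a2 - x1 - x2"
    have "a4 - 2 * l * m = l * (2 * y1) - 3 * x1\<^sup>2 - 2 * a2 * x1 - 2 * l * m" unfolding l by simp
    also have "\<dots> = x1 * x2 + x1 * x3 + x2 * x3"
      unfolding x3_def m_def True[symmetric] by Groebner_Basis.algebra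
    finally have 1: "a4 - 2 * l * m = x1 * x2 + x1 * x3 + x2 * x3" .
    have a4: "a4 = x1 * x2 + x1 * x3 + x2 * x3 + 2 * l * m" using 1 by (simp add: algebra_simps)
    have a6: "a6 = y1\<^sup>2 - x1 ^ 3 - a2 * x1\<^sup>2 - a4 * x1" unfolding c by simp
    have 2: "m\<^sup>2 - a6 = x1 * x2 * x3"
      unfolding a6 a4 unfolding x3_def m_def True[symmetric] by Groebner_Basis.algebra
    have "on_line l m x1 y1 x2 y2 x3 (l * x3 + m)"
      unfolding on_line_def using 1 2 l True y by (auto simp: x3_def m_def algebra_simps)
    thus ?thesis unfolding P Q using collinear_iff by blast
  qed
qed

lemma add_Infinity_right [simp]: "ec_add E P Infinity = P"
  by (cases P) auto

lemma add_neg [simp]: "ec_add E P (ec_neg P) = Infinity"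
  by (cases P) auto

lemma add_cases:
  assumes "on_curve E P" "on_curve E Q"
  obtains (left) "P = Infinity" | (right) "Q = Infinity" | (neg) "Q = ec_neg P"
    | (line) R where "P \<noteq> Infinity" "Q \<noteq> Infinity" "Q \<noteq> ec_neg P" "collinear P Q R"
  using collinear_exists[OF assms] by blast

lemma on_curve_add:
  assumes "on_curve E P" "on_curve E Q" shows "on_curve E (ec_add E P Q)"
  using assms by (rule add_cases) (use assms collinear_add collinear_on_curve in \<open>auto\<close>)

lemma add_commute:
  assumes "on_curve E P" "on_curve E Q" shows "ec_add E P Q = ec_add E Q P"
  using assms
proof (rule add_cases)
  assume "Q = ec_neg P"
  thus ?thesis using add_neg[of P] add_neg[of Q] by simp
qed (auto simp: collinear_add dest: collinear_swap)

lemma neg_add: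
  assumes "on_curve E P" "on_curve E Q" shows "ec_neg (ec_add E P Q) = ec_add E (ec_neg P) (ec_neg Q)"
  using assms
proof (rule add_cases)
  assume "Q = ec_neg P"
  thus ?thesis using add_neg[of P] add_neg[of "ec_neg P"] by simp
next
  fix R assume "collinear P Q R"
  thus ?thesis using collinear_add[OF collinear_neg[of P Q R]] by (simp add: collinear_add)
qed auto

text \<open>Rotating the collinear triple of \<open>P\<close>, \<open>Q\<close> and the third point
  of their line settles the main case. It serves as the cancellation law before associativity is
  available.\<close>

lemma neg_add_cancel:
  assumes "on_curve E P" "on_curve E Q" shows "ec_add E (ec_neg (ec_add E P Q)) P = ec_neg Q"
  using assms
proof (rule add_cases)
  assume Q: "Q = Infinity"
  show ?thesis using add_neg[of "ec_neg P"] by (simp add: Q)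
next
  fix R assume c: "collinear P Q R"
  show ?thesis using collinear_add[OF c] collinear_add[OF collinear_rot[OF collinear_rot[OF c]]] by simp
qed auto

section \<open>Associativity by means of parabolas\<close>

lemma split_interpolation:
  fixes f p p' q q' r :: "'f poly"
  assumes "r = p + smult c q" "r = p' + smult c q'" "r\<^sup>2 - f = smult (c\<^sup>2) (q * q')"
  shows "p\<^sup>2 - f = - (q * smult c (p + p'))"
proof -
  have "r = p + [:c:] * q" "r = p' + [:c:] * q'" "r\<^sup>2 - f = [:c:]\<^sup>2 * (q * q')"
    using assms by (auto simp: power2_eq_square)
  \<comment> \<open>Expand \<open>(r - c q)\<^sup>2 - f\<close> and use
    \<open>c q + c q' = 2 r - p - p'\<close>.\<close>
  hence "p\<^sup>2 - f = - (q * ([:c:] * (p + p')))" by Groebner_Basis.algebra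
  thus ?thesis by simp
qed

text \<open>The Vieta relations of a line are the coefficients of one polynomial identity. In this
  form a line is an interpolating curve of degree 1, as \<open>split_interpolation\<close> produces
  it.\<close>

lemma on_line_poly_iff:
  "on_line l m x1 y1 x2 y2 x3 y3 \<longleftrightarrow> y1 = poly [:m, l:] x1 \<and> y2 = poly [:m, l:] x2 \<and> y3 = poly [:m, l:] x3 \<and>
     [:m, l:]\<^sup>2 - f = - ([:-x1, 1:] * [:-x2, 1:] * [:-x3, 1:])"
  unfolding on_line_def f_def by (simp add: power2_eq_square) (auto simp: algebra_simps)

text \<open>The lines through the first two and the last two points are the remainders of the
  parabola modulo the two quadratics. By \<open>split_interpolation\<close> each meets the curve
  once more over the zero \<open>t\<close> of their sum, where their values are opposite; hence the
  two partial sums cancel.\<close>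

lemma parabola_zero_sum:
  assumes r: "[:a, b, c:]\<^sup>2 - f = smult (c\<^sup>2) ([:-x1, 1:] * [:-x2, 1:] * [:-x3, 1:] * [:-x4, 1:])"
    and c: "c \<noteq> 0"
    and y: "y1 = poly [:a, b, c:] x1" "y2 = poly [:a, b, c:] x2"
      "y3 = poly [:a, b, c:] x3" "y4 = poly [:a, b, c:] x4"
  obtains t s where "collinear (Affine x1 y1) (Affine x2 y2) (Affine t s)"
    "collinear (Affine x3 y3) (Affine x4 y4) (Affine t (- s))"
proof -
  \<comment> \<open>The coefficient of \<open>x\<^sup>3\<close>; it makes \<open>c\<close> times the
    sum of the two lines a monic linear polynomial, with zero \<open>t\<close>.\<close>
  have "2 * b * c - 1 = - (c\<^sup>2 * (x1 + x2 + x3 + x4))"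
    using r by (simp add: f_def power2_eq_square algebra_simps)
  define t where "t = - c * (2 * a - c * (x1 * x2 + x3 * x4))"
  define l m where "l = b + c * (x1 + x2)" and "m = a - c * (x1 * x2)"
  define l' m' where "l' = b + c * (x3 + x4)" and "m' = a - c * (x3 * x4)"
  define q q' where "q = [:-x1, 1:] * [:-x2, 1:]" and "q' = [:-x3, 1:] * [:-x4, 1:]"
  have ll: "c * (l + l') = 1" using \<open>2 * b * c - 1 = _\<close> unfolding l_def l'_def by Groebner_Basis.algebra
  have mm: "c * (m + m') = - t" unfolding m_def m'_def t_def by Groebner_Basis.algebra
  have pp: "smult c ([:m, l:] + [:m', l':]) = [:-t, 1:]" using ll mm by simp
  have 1: "[:a, b, c:] = [:m, l:] + smult c q" "[:a, b, c:] = [:m', l':] + smult c q'"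
    by (simp_all add: q_def q'_def m_def l_def m'_def l'_def algebra_simps)
  have 2: "[:a, b, c:]\<^sup>2 - f = smult (c\<^sup>2) (q * q')"
    unfolding r q_def q'_def by (simp only: mult.assoc)
  have "[:m, l:]\<^sup>2 - f = - (q * [:-t, 1:])"
    using split_interpolation[OF 1 2] pp by simp
  moreover have "[:m', l':]\<^sup>2 - f = - (q' * [:-t, 1:])"
    using split_interpolation[OF 1(2,1)] 2 pp by (simp add: mult.commute add.commute)
  moreover have "poly [:m, l:] x1 = y1" "poly [:m, l:] x2 = y2" "poly [:m', l':] x3 = y3" "poly [:m', l':] x4 = y4"
    unfolding y m_def l_def m'_def l'_def by (simp_all add: algebra_simps)
  moreover have "poly [:m', l':] t = - poly [:m, l:] t"
  proof -
    have "poly (smult c ([:m, l:] + [:m', l':])) t = 0" unfolding pp by simp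
    hence "poly ([:m, l:] + [:m', l':]) t = 0" using c by (simp only: poly_smult mult_eq_0_iff) blast
    thus ?thesis by (simp only: poly_add add_eq_0_iff)
  qed
  ultimately have "on_line l m x1 y1 x2 y2 t (poly [:m, l:] t)"
      "on_line l' m' x3 y3 x4 y4 t (- poly [:m, l:] t)"
    unfolding on_line_poly_iff q_def q'_def by (metis, metis)
  thus ?thesis using that collinear_iff by blast
qed

text \<open>Every curve \<open>p + c q\<close> agrees with the line \<open>p\<close> at the first
  two points, counted with multiplicity, and \<open>c\<close> is left to catch the third. For
  \<open>c = 0\<close> the third point is already on the line, which is the first
  alternative.\<close>

lemma parabola_exists:
  assumes col: "collinear (Affine x1 y1) (Affine x2 y2) S"
    and P3: "on_curve E (Affine x3 y3)"
    and n1: "Affine x3 y3 \<noteq> ec_neg (Affine x1 y1)" and n2: "Affine x3 y3 \<noteq> ec_neg (Affine x2 y2)"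
  shows "collinear (Affine x1 y1) (Affine x2 y2) (Affine x3 y3) \<or>
    (\<exists>a b c x4. c \<noteq> 0 \<and>
      [:a, b, c:]\<^sup>2 - f = smult (c\<^sup>2) ([:-x1, 1:] * [:-x2, 1:] * [:-x3, 1:] * [:-x4, 1:]) \<and>
      y1 = poly [:a, b, c:] x1 \<and> y2 = poly [:a, b, c:] x2 \<and> y3 = poly [:a, b, c:] x3)"
proof -
  obtain l m xa ya where S: "S = Affine xa ya" and L: "on_line l m x1 y1 x2 y2 xa ya"
    using col by (auto simp: collinear_def)
  define p where "p = [:m, l:]"
  define q where "q = [:-x1, 1:] * [:-x2, 1:]"
  have pf: "p\<^sup>2 - f = - (q * [:-xa, 1:])" and y: "y1 = poly p x1" "y2 = poly p x2" "ya = poly p xa"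
    using L unfolding on_line_poly_iff p_def q_def by auto
  have c3: "y3\<^sup>2 = poly f x3" using P3 by (simp add: f_def algebra_simps power3_eq_cube power2_eq_square)
  \<comment> \<open>If \<open>x3\<close> is one of \<open>x1\<close>, \<open>x2\<close>, then
    \<open>q\<close> vanishes there and the curve passes through the third point for every
    \<open>c\<close>; the value then comes from \<open>2 c y3 = x3 - xa\<close>, which makes
    \<open>x3\<close> a zero of the cofactor \<open>g\<close>.\<close>
  define c where "c = (if x3 = x1 \<or> x3 = x2 then (x3 - xa) / (2 * y3) else (y3 - poly p x3) / poly q x3)"
  define g where "g = smult (2 * c) p + smult (c\<^sup>2) q - [:-xa, 1:]"
  define r where "r = p + smult c q"
  have q3: "poly q x3 = 0 \<longleftrightarrow> x3 = x1 \<or> x3 = x2" unfolding q_def poly_mult mult_eq_0_iff by simp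
  have q0: "poly q x1 = 0" "poly q x2 = 0" unfolding q_def poly_mult by simp_all
  have rf: "r\<^sup>2 - f = q * g"
  proof -
    have "r = p + [:c:] * q" "g = [:2:] * [:c:] * p + [:c:]\<^sup>2 * q - [:-xa, 1:]"
      by (auto simp: r_def g_def power2_eq_square mult.commute)
    moreover have "[:2:] = (2 :: 'f poly)" by (simp add: numeral_poly)
    ultimately show ?thesis using pf by Groebner_Basis.algebra
  qed
  have r3: "poly r x3 = y3 \<and> poly g x3 = 0"
  proof (cases "x3 = x1 \<or> x3 = x2")
    case True
    obtain x y' where x: "x = x3" "poly p x = y'" "(x = x1 \<and> y' = y1) \<or> (x = x2 \<and> y' = y2)"
      using True y by auto
    have "y'\<^sup>2 = y3\<^sup>2" using x on_line_on_curve[OF L] collinear_on_curve(2)[OF col] P3 by auto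
    hence "(y' - y3) * (y' + y3) = 0" by (simp add: power2_eq_square algebra_simps)
    moreover have "y' + y3 \<noteq> 0" using x n1 n2 by (auto simp: add_eq_0_iff)
    ultimately have y': "y' = y3" "2 * y3 \<noteq> 0" by (auto simp: mult_2[symmetric])
    have "c * (2 * y3) = x3 - xa" using y' True by (auto simp: c_def)
    thus ?thesis using x y' True q3 by (auto simp: r_def g_def algebra_simps)
  next
    case False
    hence q3': "poly q x3 \<noteq> 0" using q3 by auto
    have "poly r x3 = y3" using q3' False by (simp add: r_def c_def)
    moreover have "poly (r\<^sup>2 - f) x3 = poly q x3 * poly g x3" unfolding rf by simp
    ultimately show ?thesis using q3' c3 by simp
  qed
  show ?thesis
  proof (cases "c = 0")
    case True
    have "x3 = xa" using r3 True by (simp add: g_def)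
    moreover have "y3 = ya" using r3 True y \<open>x3 = xa\<close> by (simp add: r_def)
    ultimately show ?thesis using L by auto
  next
    case False
    define g0 g1 where "g0 = 2 * c * m + c\<^sup>2 * (x1 * x2) + xa" and "g1 = 2 * c * l - c\<^sup>2 * (x1 + x2) - 1"
    have g: "g = [:g0, g1, c\<^sup>2:]" by (simp add: g_def g0_def g1_def p_def q_def algebra_simps)
    \<comment> \<open>The fourth abscissa is the other zero of the quadratic \<open>g\<close>, by
      the sum of its roots.\<close>
    define x4 where "x4 = - g1 / c\<^sup>2 - x3"
    have g1: "g1 = - (c\<^sup>2 * (x3 + x4))" using False by (simp add: x4_def field_simps)
    have "g0 + g1 * x3 + c\<^sup>2 * x3\<^sup>2 = 0" using r3 g by (simp add: power2_eq_square algebra_simps)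
    hence g0: "g0 = c\<^sup>2 * (x3 * x4)" unfolding g1 by (simp add: algebra_simps power2_eq_square)
    have g': "g = smult (c\<^sup>2) ([:-x3, 1:] * [:-x4, 1:])" unfolding g g0 g1 by (simp add: algebra_simps)
    have r: "r = [:m + c * (x1 * x2), l - c * (x1 + x2), c:]"
      by (simp add: r_def p_def q_def algebra_simps)
    have yr: "y1 = poly r x1" "y2 = poly r x2" "y3 = poly r x3"
      using y r3 by (auto simp: r_def algebra_simps q0)
    have "r\<^sup>2 - f = smult (c\<^sup>2) ([:-x1, 1:] * [:-x2, 1:] * [:-x3, 1:] * [:-x4, 1:])"
      unfolding rf g' q_def by (simp only: mult_smult_right mult.assoc)
    thus ?thesis using False yr unfolding r by blast
  qed
qed

lemma add_assoc:
  assumes P: "on_curve E P" and Q: "on_curve E Q" and R: "on_curve E R"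
  shows "ec_add E (ec_add E P Q) R = ec_add E P (ec_add E Q R)"
proof -
  \<comment> \<open>The positions in which two of the points are opposite reduce to this
    cancellation law; only the generic position needs the parabola.\<close>
  have cancel: "ec_add E A (ec_add E (ec_neg A) B) = B" if "on_curve E A" "on_curve E B" for A B
    using neg_add_cancel[of "ec_neg A" B] that
    by (metis add_commute ec_neg_neg neg_add on_curve_add on_curve_neg)
  consider "P = Infinity" | "Q = Infinity" | "R = Infinity" | "Q = ec_neg P" | "R = ec_neg P" | "R = ec_neg Q"
    | S where "P \<noteq> Infinity" "Q \<noteq> Infinity" "R \<noteq> Infinity" "R \<noteq> ec_neg P" "R \<noteq> ec_neg Q" "Q \<noteq> ec_neg P" "collinear P Q S"
    using P Q by (metis add_cases)
  thus ?thesis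
  proof cases
    case 4 thus ?thesis using cancel[OF P R] by simp
  next
    case 5
    have "ec_add E (ec_add E P Q) (ec_neg P) = Q"
      using cancel[of "ec_neg P" Q] P Q by (metis add_commute on_curve_add on_curve_neg ec_neg_neg)
    moreover have "ec_add E P (ec_add E Q (ec_neg P)) = Q"
      using cancel[OF P Q] P Q by (metis add_commute on_curve_neg)
    ultimately show ?thesis using 5 by simp
  next
    case 6
    have "ec_add E (ec_add E P Q) (ec_neg Q) = P"
      using cancel[of "ec_neg Q" P] P Q by (metis add_commute on_curve_add on_curve_neg ec_neg_neg)
    thus ?thesis using 6 by simp
  next
    case (7 S)
    obtain x1 y1 x2 y2 x3 y3 where A: "P = Affine x1 y1" "Q = Affine x2 y2" "R = Affine x3 y3"
      using 7 by (cases P; cases Q; cases R) auto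
    from parabola_exists[of x1 y1 x2 y2 S x3 y3]
    consider "collinear P Q R" | a b c x4 where "c \<noteq> 0"
      "[:a, b, c:]\<^sup>2 - f = smult (c\<^sup>2) ([:-x1, 1:] * [:-x2, 1:] * [:-x3, 1:] * [:-x4, 1:])"
      "y1 = poly [:a, b, c:] x1" "y2 = poly [:a, b, c:] x2" "y3 = poly [:a, b, c:] x3"
      using 7 R unfolding A by blast
    thus ?thesis
    proof cases
      case 1
      have "ec_add E P Q = ec_neg R" "ec_add E Q R = ec_neg P"
        using collinear_add[OF 1] collinear_add[OF collinear_rot[OF 1]] by auto
      thus ?thesis using add_neg[of P] add_neg[of "ec_neg R"] by simp
    next
      case (2 a b c x4)
      \<comment> \<open>The parabola has a fourth point \<open>T\<close>. Pairing the four points as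
        \<open>P Q\<close>, \<open>R T\<close> and as \<open>Q R\<close>, \<open>P T\<close> gives
        the inverse of \<open>T\<close> for both bracketings.\<close>
      define T where "T = Affine x4 (poly [:a, b, c:] x4)"
      obtain t s where 3: "collinear P Q (Affine t s)" "collinear R T (Affine t (- s))"
        using parabola_zero_sum[OF 2(2,1,3,4,5) refl] unfolding A T_def by metis
      have "[:a, b, c:]\<^sup>2 - f = smult (c\<^sup>2) ([:-x2, 1:] * [:-x3, 1:] * [:-x1, 1:] * [:-x4, 1:])"
        unfolding 2 by (simp only: ac_simps)
      then obtain t' s' where 4: "collinear Q R (Affine t' s')" "collinear P T (Affine t' (- s'))"
        using parabola_zero_sum[OF _ 2(1,4,5,3) refl] unfolding A T_def by metis
      have T: "on_curve E T" using collinear_on_curve 3 by blast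
      have "ec_add E (ec_add E P Q) R = ec_add E (ec_neg (ec_add E R T)) R"
        using collinear_add[OF 3(1)] collinear_add[OF 3(2)] by simp
      also have "\<dots> = ec_neg T" using neg_add_cancel[OF R T] .
      also have "\<dots> = ec_add E (ec_neg (ec_add E P T)) P" using neg_add_cancel[OF P T] by simp
      also have "\<dots> = ec_add E (ec_add E Q R) P"
        using collinear_add[OF 4(1)] collinear_add[OF 4(2)] by simp
      also have "\<dots> = ec_add E P (ec_add E Q R)" using add_commute on_curve_add P Q R by blast
      finally show ?thesis .
    qed
  qed auto
qed

section \<open>The points as an abelian group\<close>

definition point_group :: "'f ec_point monoid" where
  "point_group = \<lparr>carrier = points E, mult = ec_add E, one = Infinity\<rparr>"

lemma comm_group_point_group: "comm_group point_group"
proof (rule comm_groupI)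
  fix P assume "P \<in> carrier point_group"
  thus "\<exists>Q\<in>carrier point_group. Q \<otimes>\<^bsub>point_group\<^esub> P = \<one>\<^bsub>point_group\<^esub>"
    by (intro bexI[of _ "ec_neg P"])
      (auto simp: point_group_def points_def add_commute[of "ec_neg P" P])
next
  fix P Q R assume "P \<in> carrier point_group" "Q \<in> carrier point_group" "R \<in> carrier point_group"
  thus "P \<otimes>\<^bsub>point_group\<^esub> Q \<otimes>\<^bsub>point_group\<^esub> R = P \<otimes>\<^bsub>point_group\<^esub> (Q \<otimes>\<^bsub>point_group\<^esub> R)"
    by (simp add: point_group_def points_def add_assoc)
qed (auto simp: point_group_def points_def on_curve_add add_commute)

sublocale G: comm_group point_group
  by (rule comm_group_point_group)

lemma point_group_simps [simp]:
  "P \<in> carrier point_group \<longleftrightarrow> on_curve E P"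
  "P \<otimes>\<^bsub>point_group\<^esub> Q = ec_add E P Q"
  "\<one>\<^bsub>point_group\<^esub> = Infinity"
  by (auto simp: point_group_def points_def)

lemma point_group_inv [simp]: "on_curve E P \<Longrightarrow> inv\<^bsub>point_group\<^esub> P = ec_neg P"
  by (rule G.inv_equality) (auto simp: add_commute[of "ec_neg P" P])

lemma ec_mult_eq_pow:
  assumes "on_curve E P" shows "ec_mult E n P = P [^]\<^bsub>point_group\<^esub> n"
proof (induction n)
  case (Suc n)
  thus ?case using assms G.nat_pow_Suc2[of P n] by simp
qed auto

lemma on_curve_mult: "on_curve E P \<Longrightarrow> on_curve E (ec_mult E n P)"
  using G.nat_pow_closed[of P n] by (simp add: ec_mult_eq_pow)

lemma mult_add:
  assumes "on_curve E P" "on_curve E Q"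
  shows "ec_mult E n (ec_add E P Q) = ec_add E (ec_mult E n P) (ec_mult E n Q)"
  using G.nat_pow_distrib[of P Q n] assms by (simp add: ec_mult_eq_pow on_curve_add)

lemma mult_neg: "on_curve E P \<Longrightarrow> ec_mult E n (ec_neg P) = ec_neg (ec_mult E n P)"
  using G.nat_pow_inv[of P n] on_curve_mult[of P n] by (simp add: ec_mult_eq_pow)

text \<open>The remainders \<open>p\<close>, \<open>p'\<close> of the cubic modulo the two halves
  have opposite coefficients of \<open>x\<^sup>2\<close>. If these are nonzero, \<open>p\<close> and
  \<open>p'\<close> are parabolas whose fourth points lie over the zero \<open>t\<close> of
  \<open>p + p'\<close> and are opposite; otherwise both are lines and each triple is
  collinear.\<close>

lemma cubic_zero_sum:
  assumes r: "[:e, a, b, c:]\<^sup>2 - f = smult (c\<^sup>2) (([:-x1, 1:] * [:-x2, 1:] * [:-x3, 1:]) *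
       ([:-x4, 1:] * [:-x5, 1:] * [:-x6, 1:]))" (is "?r\<^sup>2 - f = smult _ (?q * ?q')")
    and c: "c \<noteq> 0"
    and Y: "y1 = poly [:e, a, b, c:] x1" "y2 = poly [:e, a, b, c:] x2" "y3 = poly [:e, a, b, c:] x3"
      "y4 = poly [:e, a, b, c:] x4" "y5 = poly [:e, a, b, c:] x5" "y6 = poly [:e, a, b, c:] x6"
  shows "ec_add E (ec_add E (ec_add E (Affine x1 y1) (Affine x2 y2)) (Affine x3 y3))
    (ec_add E (ec_add E (Affine x4 y4) (Affine x5 y5)) (Affine x6 y6)) = Infinity"
proof -
  define p where "p = ?r - smult c ?q"
  define p' where "p' = ?r - smult c ?q'"
  have 1: "?r = p + smult c ?q" "?r = p' + smult c ?q'" by (simp_all only: p_def p'_def diff_add_cancel)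
  define b1 b1' where "b1 = b + c * (x1 + x2 + x3)" and "b1' = b + c * (x4 + x5 + x6)"
  define a1 a1' where "a1 = a - c * (x1*x2 + x1*x3 + x2*x3)" and "a1' = a - c * (x4*x5 + x4*x6 + x5*x6)"
  define e1 e1' where "e1 = e + c * (x1*x2*x3)" and "e1' = e + c * (x4*x5*x6)"
  have p: "p = [:e1, a1, b1:]" by (simp add: p_def e1_def a1_def b1_def algebra_simps)
  have p': "p' = [:e1', a1', b1':]" by (simp add: p'_def e1'_def a1'_def b1'_def algebra_simps)
  have pf: "p\<^sup>2 - f = - (?q * smult c (p + p'))" by (rule split_interpolation[OF 1 r])
  have p'f: "p'\<^sup>2 - f = - (?q' * smult c (p + p'))"
    using split_interpolation[OF 1(2,1)] r by (simp only: mult.commute[of ?q ?q'] add.commute[of p p'])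
  have "c * (2 * b + c * (x1+x2+x3+x4+x5+x6)) = 0"
  proof -
    have "coeff (?r\<^sup>2 - f) 5 = coeff (smult (c\<^sup>2) (?q * ?q')) 5" by (simp only: r)
    thus ?thesis by (simp add: f_def power2_eq_square eval_nat_numeral algebra_simps)
  qed
  hence "2 * b + c * (x1+x2+x3+x4+x5+x6) = 0" using c by simp
  hence bb: "b1 + b1' = 0" by (simp add: b1_def b1'_def algebra_simps)
  have pp: "p + p' = [:e1 + e1', a1 + a1':]" using bb by (simp add: p p')
  \<comment> \<open>This coefficient shows that \<open>p + p'\<close> has degree exactly 1 when
    \<open>b1\<close> is nonzero, which is what provides \<open>t\<close>.\<close>
  have "coeff (p\<^sup>2 - f) 4 = coeff (- (?q * smult c (p + p'))) 4" by (simp only: pf)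
  hence bk: "b1\<^sup>2 = - c * (a1 + a1')"
    unfolding pp by (simp add: p f_def power2_eq_square eval_nat_numeral algebra_simps)
  have Yp: "y1 = poly p x1" "y2 = poly p x2" "y3 = poly p x3"
    "y4 = poly p' x4" "y5 = poly p' x5" "y6 = poly p' x6"
    unfolding Y p_def p'_def poly_diff poly_smult poly_mult by simp_all
  have b1': "b1' = - b1" using bb by (simp add: add_eq_0_iff)
  show ?thesis
  proof (cases "b1 = 0")
    case True
    hence ak: "a1 + a1' = 0" using bk c by simp
    \<comment> \<open>With \<open>b1 = 0\<close> the coefficient of \<open>x\<^sup>3\<close> turns
      \<open>c (p + p')\<close> into the constant 1, so \<open>p\<^sup>2 - f\<close> is minus a
      product of three linear factors.\<close>
    have "coeff (p\<^sup>2 - f) 3 = coeff (- (?q * smult c (p + p'))) 3" by (simp only: pf)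
    hence ck: "c * (e1 + e1') = 1"
      unfolding pp ak using True by (simp add: p f_def power2_eq_square eval_nat_numeral algebra_simps)
    have one: "smult c (p + p') = 1" using bb ak ck True by (simp add: p p')
    have pl: "p = [:e1, a1:]" "p' = [:e1', a1':]" using True by (simp_all add: p p' b1')
    have "on_line a1 e1 x1 y1 x2 y2 x3 y3"
      unfolding on_line_poly_iff pl(1)[symmetric] using pf Yp unfolding one by (simp only: mult_1_right simp_thms)
    hence "collinear (Affine x1 y1) (Affine x2 y2) (Affine x3 y3)" by auto
    moreover have "on_line a1' e1' x4 y4 x5 y5 x6 y6"
      unfolding on_line_poly_iff pl(2)[symmetric] using p'f Yp unfolding one by (simp only: mult_1_right simp_thms)
    hence "collinear (Affine x4 y4) (Affine x5 y5) (Affine x6 y6)" by auto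
    ultimately show ?thesis
      using add_neg[of "ec_neg (Affine x3 y3)"] add_neg[of "ec_neg (Affine x6 y6)"]
      by (auto simp only: collinear_add ec_neg_neg ec_add.simps(1))
  next
    case False
    define t where "t = c * (e1 + e1') / b1\<^sup>2"
    have lin: "smult c (p + p') = - smult (b1\<^sup>2) [:-t, 1:]"
    proof -
      have "b1\<^sup>2 * t = c * (e1 + e1')" using False by (simp add: t_def)
      thus ?thesis using bk unfolding pp by (simp del: mult_eq_0_iff)
    qed
    have P: "[:e1, a1, b1:]\<^sup>2 - f = smult (b1\<^sup>2) ([:-x1, 1:] * [:-x2, 1:] * [:-x3, 1:] * [:-t, 1:])"
      using pf unfolding lin unfolding p by (simp only: mult_minus_right minus_minus mult_smult_right)
    have P': "[:e1', a1', b1':]\<^sup>2 - f = smult (b1'\<^sup>2) ([:-x4, 1:] * [:-x5, 1:] * [:-x6, 1:] * [:-t, 1:])"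
      using p'f unfolding lin unfolding p' by (simp only: mult_minus_right minus_minus mult_smult_right b1' power2_minus)
    have "poly (smult c (p + p')) t = 0" unfolding lin by simp
    hence "poly p t + poly p' t = 0" using c by simp
    hence pt: "poly p' t = - poly p t" by (simp add: add_eq_0_iff)
    define T where "T = Affine t (poly p t)"
    have T': "Affine t (poly p' t) = ec_neg T" by (simp add: T_def pt)
    let ?P1 = "Affine x1 y1" and ?P2 = "Affine x2 y2" and ?P3 = "Affine x3 y3"
    let ?P4 = "Affine x4 y4" and ?P5 = "Affine x5 y5" and ?P6 = "Affine x6 y6"
    obtain u v where 1: "collinear ?P1 ?P2 (Affine u v)" "collinear ?P3 T (ec_neg (Affine u v))"
      using parabola_zero_sum[OF P False Yp(1-3)[unfolded p] refl] unfolding T_def p by (metis ec_neg.simps)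
    obtain u' v' where 2: "collinear ?P4 ?P5 (Affine u' v')" "collinear ?P6 (ec_neg T) (ec_neg (Affine u' v'))"
      using parabola_zero_sum[OF P' _ Yp(4-6)[unfolded p'] refl] False b1'
      unfolding T'[symmetric] p' by (metis ec_neg.simps neg_equal_0_iff_equal)
    have "ec_add E (ec_add E ?P1 ?P2) ?P3 = ec_neg T"
      using neg_add_cancel[of ?P3 T] collinear_on_curve[OF 1(2)] collinear_add[OF 1(1)] collinear_add[OF 1(2)]
      by simp
    moreover have "ec_add E (ec_add E ?P4 ?P5) ?P6 = ec_neg (ec_neg T)"
      using neg_add_cancel[of ?P6 "ec_neg T"] collinear_on_curve[OF 2(2)] collinear_add[OF 2(1)] collinear_add[OF 2(2)]
      by simp
    ultimately show ?thesis using add_neg[of "ec_neg T"] by simp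
  qed
qed

end

section \<open>Embeddings of rings and coprime polynomials\<close>

text \<open>Stated for domains so that the coefficientwise map on polynomials is again an instance
  and inherits all rules. The instances are the constants in \<open>K(x)\<close>, the algebraic
  closure and the given extension.\<close>

locale ring_embedding =
  fixes h :: "'a::idom \<Rightarrow> 'b::idom"
  assumes hom_one: "h 1 = 1" and hom_add: "h (a + b) = h a + h b" and hom_mult: "h (a * b) = h a * h b"
    and inj: "h a = 0 \<Longrightarrow> a = 0"
begin

lemma hom_zero: "h 0 = 0"
  using hom_add[of 0 0] by (simp only: add_0_right add_cancel_right_right)

lemma hom_minus: "h (- a) = - h a"
  using hom_add[of a "- a"] by (simp add: hom_zero eq_neg_iff_add_eq_0 add.commute)

lemma hom_diff: "h (a - b) = h a - h b"
  using hom_add[of a "- b"] by (simp add: hom_minus)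

lemma hom_power: "h (a ^ n) = h a ^ n"
  by (induction n) (auto simp: hom_one hom_mult)

lemma hom_sum: "h (sum g A) = (\<Sum>i\<in>A. h (g i))"
  by (induction A rule: infinite_finite_induct) (auto simp: hom_zero hom_add)

lemma hom_of_nat: "h (of_nat n) = of_nat n"
  by (induction n) (auto simp: hom_zero hom_one hom_add)

lemma hom_numeral: "h (numeral n) = numeral n"
  using hom_of_nat[of "numeral n"] by simp

lemma hom_eq_iff: "h a = h b \<longleftrightarrow> a = b"
  using inj[of "a - b"] by (auto simp: hom_diff)

lemma hom_eq_0_iff: "h a = 0 \<longleftrightarrow> a = 0"
  using inj[of a] by (auto simp: hom_zero)

lemmas hom_simps = hom_zero hom_one hom_add hom_mult hom_minus hom_diff hom_power hom_numeral
  hom_eq_iff hom_eq_0_iff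

lemma coeff_map: "coeff (map_poly h p) i = h (coeff p i)"
  by (rule coeff_map_poly) (rule hom_zero)

lemma map_pCons: "map_poly h (pCons a p) = pCons (h a) (map_poly h p)"
  by (rule map_poly_pCons) (rule hom_zero)

lemma ring_embedding_map_poly: "ring_embedding (map_poly h)"
proof
  show "map_poly h 1 = 1" by (rule poly_eqI) (auto simp: coeff_map hom_zero hom_one)
  fix p q
  show "map_poly h (p + q) = map_poly h p + map_poly h q"
    by (rule poly_eqI) (simp add: coeff_map hom_add)
  show "map_poly h (p * q) = map_poly h p * map_poly h q"
    by (rule poly_eqI) (simp add: coeff_map coeff_mult hom_sum hom_mult)
  assume "map_poly h p = 0"
  hence "h (coeff p i) = 0" for i using coeff_map[of p i] by simp
  thus "p = 0" by (intro poly_eqI) (simp add: inj)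
qed

end

lemmas (in ring_embedding) map_poly_simps = ring_embedding.hom_simps[OF ring_embedding_map_poly]

context ring_embedding
begin

lemma degree_map: "degree (map_poly h p) = degree p"
  by (rule degree_map_poly) (auto simp: hom_eq_0_iff)

lemma map_smult: "map_poly h (smult c p) = smult (h c) (map_poly h p)"
  by (rule poly_eqI) (simp add: coeff_map hom_mult)

lemma poly_map: "poly (map_poly h p) (h x) = h (poly p x)"
  by (induction p) (auto simp: map_pCons hom_add hom_mult hom_zero)

end

text \<open>The Bezout form is consumed as such: it cancels factors in divisibilities and inverts
  \<open>omega\<close> modulo \<open>h\<close>.\<close>

definition coprime_polys :: "'a::field poly \<Rightarrow> 'a poly \<Rightarrow> bool" where
  "coprime_polys p q \<longleftrightarrow> (\<exists>u v. u * p + v * q = 1)"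

lemma coprime_polys_square:
  assumes "coprime_polys p q" shows "coprime_polys p (q\<^sup>2)"
proof -
  obtain u v where uv: "u * p + v * q = 1" using assms by (auto simp: coprime_polys_def)
  have "(u\<^sup>2 * p + 2 * u * v * q) * p + v\<^sup>2 * q\<^sup>2 = (u * p + v * q)\<^sup>2" by Groebner_Basis.algebra
  thus ?thesis unfolding coprime_polys_def uv by auto
qed

lemma coprime_polys_dvd_cancel:
  assumes "coprime_polys p q" "q dvd p ^ n * r" shows "q dvd r"
  using assms(2)
proof (induction n)
  case (Suc n)
  obtain u v where uv: "u * p + v * q = 1" using assms by (auto simp: coprime_polys_def)
  have "p ^ n * r = (u * p + v * q) * (p ^ n * r)" unfolding uv by simp
  also have "\<dots> = u * (p ^ Suc n * r) + q * (v * p ^ n * r)" by (simp add: algebra_simps)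
  finally show ?case using Suc by (metis dvd_add dvd_mult dvd_triv_left)
qed simp

text \<open>A nonzero element of least degree in the ideal of \<open>p\<close> and \<open>q\<close>
  divides both, by division with remainder.\<close>

lemma bezout_or_common_factor:
  fixes p q :: "'a::field poly"
  assumes "p \<noteq> 0"
  shows "coprime_polys p q \<or> (\<exists>d. degree d > 0 \<and> d dvd p \<and> d dvd q)"
proof -
  define I where "I = {d. d \<noteq> 0 \<and> (\<exists>u v. d = u * p + v * q)}"
  have "p = 1 * p + 0 * q" by simp
  hence "p \<in> I" using assms unfolding I_def by blast
  then obtain d where d: "d \<in> I" "\<And>e. e \<in> I \<Longrightarrow> degree d \<le> degree e"
    using ex_has_least_nat[of "\<lambda>d. d \<in> I" p degree] by auto
  obtain u v where uv: "d = u * p + v * q" and d0: "d \<noteq> 0" using d(1) by (auto simp: I_def)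
  have dv: "d dvd a * p + b * q" for a b
  proof -
    let ?e = "(a * p + b * q) mod d"
    define k where "k = (a * p + b * q) div d"
    have "?e = (a * p + b * q) - k * d" unfolding k_def by (simp add: minus_div_mult_eq_mod)
    also have "\<dots> = (a - k * u) * p + (b - k * v) * q" unfolding uv by (simp add: algebra_simps)
    finally have "\<exists>u v. ?e = u * p + v * q" by blast
    hence "?e = 0" using d(2)[of ?e] degree_mod_less[OF d0, of "a * p + b * q"] by (force simp: I_def)
    thus ?thesis by auto
  qed
  show ?thesis
  proof (cases "degree d = 0")
    case True
    then obtain c where c: "d = [:c:]" "c \<noteq> 0" using d0 by (auto elim!: degree_eq_zeroE)
    have "([:1 / c:] * u) * p + ([:1 / c:] * v) * q = [:1 / c:] * d" unfolding uv by (simp add: algebra_simps)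
    also have "\<dots> = 1" using c by simp
    finally show ?thesis unfolding coprime_polys_def by blast
  next
    case False
    thus ?thesis using dv[of 1 0] dv[of 0 1] by auto
  qed
qed

lemma ring_embedding_to_ac: "ring_embedding to_ac"
  by unfold_locales auto

text \<open>A common factor of positive degree would have a root in the algebraic closure. Facts
  about points over the closure thereby yield inverses with coefficients in the ground
  field.\<close>

lemma coprime_polys_if_no_common_root:
  fixes p q :: "'a::field poly"
  assumes "p \<noteq> 0"
    and "\<And>x. poly (map_poly to_ac p) x = 0 \<Longrightarrow> poly (map_poly to_ac q) x = 0 \<Longrightarrow> False"
  shows "coprime_polys p q"
proof (rule ccontr)
  interpret ac: ring_embedding "to_ac :: 'a \<Rightarrow> _" by (rule ring_embedding_to_ac)
  assume "\<not> coprime_polys p q"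
  then obtain d where d: "degree d > 0" "d dvd p" "d dvd q"
    using bezout_or_common_factor[OF assms(1)] by blast
  then obtain x where x: "poly (map_poly to_ac d) x = 0"
    using alg_closed_imp_poly_has_root[of "map_poly to_ac d"] by (auto simp: ac.degree_map)
  have "poly (map_poly to_ac r) x = 0" if "d dvd r" for r
    using that x by (auto simp: ac.map_poly_simps)
  thus False using assms(2)[of x] d by auto
qed

section \<open>Isogenies given by rational functions\<close>

definition ccst :: "'a::field \<Rightarrow> 'a poly fract" where "ccst c = to_fract [:c:]"

lemma ring_embedding_ccst: "ring_embedding (ccst :: 'a::field \<Rightarrow> _)"
proof
  fix a b :: 'a
  have "[:a * b:] = [:a:] * [:b:]" by simp
  thus "ccst (a * b) = ccst a * ccst b" unfolding ccst_def by (simp only: to_fract_mult)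
  have "[:a + b:] = [:a:] + [:b:]" by simp
  thus "ccst (a + b) = ccst a + ccst b" unfolding ccst_def by (simp only: to_fract_add)
qed (auto simp: ccst_def one_pCons[symmetric])

interpretation ccst: ring_embedding ccst
  by (rule ring_embedding_ccst)

lemma to_fract_power: "to_fract (p ^ n) = to_fract p ^ n"
  by (induction n) auto

lemma to_fract_smult: "to_fract (smult c p) = ccst c * to_fract p"
proof -
  have "smult c p = [:c:] * p" by simp
  thus ?thesis unfolding ccst_def by (simp only: to_fract_mult)
qed

lemma to_fract_conv_poly:
  "to_fract p = poly (map_poly ccst p) (to_fract [:0, 1:])"
proof (induction p)
  case (pCons a p)
  have "pCons a p = [:a:] + [:0, 1:] * p" by simp
  hence "to_fract (pCons a p) = ccst a + to_fract [:0, 1:] * to_fract p"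
    unfolding ccst_def by (simp only: to_fract_add to_fract_mult)
  thus ?case using pCons by (simp add: ccst.map_pCons)
qed (auto simp: ccst.hom_simps)

section \<open>Simple subfields K(A) of K(x)\<close>

definition subfield_adjoin :: "'a::field poly fract \<Rightarrow> 'a poly fract set" where
  "subfield_adjoin A = {t. \<exists>p q. poly (map_poly ccst q) A \<noteq> 0 \<and>
     t = poly (map_poly ccst p) A / poly (map_poly ccst q) A}"

lemma subfield_adjoin_poly: "poly (map_poly ccst p) A \<in> subfield_adjoin A"
  unfolding subfield_adjoin_def
  by (rule CollectI, rule exI[of _ p], rule exI[of _ 1]) (simp add: ccst.map_poly_simps)

lemma subfield_adjoin_const: "ccst c \<in> subfield_adjoin A"
  using subfield_adjoin_poly[of "[:c:]" A] by (simp add: ccst.map_pCons ccst.map_poly_simps)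

lemma subfield_adjoin_gen: "A \<in> subfield_adjoin A"
  using subfield_adjoin_poly[of "[:0, 1:]" A]
  by (simp add: ccst.map_pCons ccst.map_poly_simps ccst.hom_simps)

lemma subfield_adjoin_add:
  assumes "s \<in> subfield_adjoin A" "t \<in> subfield_adjoin A" shows "s + t \<in> subfield_adjoin A"
proof -
  obtain p q p' q' where *: "poly (map_poly ccst q) A \<noteq> 0" "s = poly (map_poly ccst p) A / poly (map_poly ccst q) A"
    "poly (map_poly ccst q') A \<noteq> 0" "t = poly (map_poly ccst p') A / poly (map_poly ccst q') A"
    using assms by (auto simp: subfield_adjoin_def)
  have "poly (map_poly ccst (q * q')) A \<noteq> 0"
    "s + t = poly (map_poly ccst (p * q' + p' * q)) A / poly (map_poly ccst (q * q')) A"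
    using * by (auto simp: ccst.map_poly_simps add_frac_eq)
  thus ?thesis by (auto simp: subfield_adjoin_def)
qed

lemma subfield_adjoin_mult:
  assumes "s \<in> subfield_adjoin A" "t \<in> subfield_adjoin A" shows "s * t \<in> subfield_adjoin A"
proof -
  obtain p q p' q' where *: "poly (map_poly ccst q) A \<noteq> 0" "s = poly (map_poly ccst p) A / poly (map_poly ccst q) A"
    "poly (map_poly ccst q') A \<noteq> 0" "t = poly (map_poly ccst p') A / poly (map_poly ccst q') A"
    using assms by (auto simp: subfield_adjoin_def)
  have "poly (map_poly ccst (q * q')) A \<noteq> 0"
    "s * t = poly (map_poly ccst (p * p')) A / poly (map_poly ccst (q * q')) A"
    using * by (auto simp: ccst.map_poly_simps)
  thus ?thesis by (auto simp: subfield_adjoin_def)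
qed

lemma subfield_adjoin_inverse:
  assumes "s \<in> subfield_adjoin A" shows "inverse s \<in> subfield_adjoin A"
proof (cases "s = 0")
  case False
  obtain p q where *: "poly (map_poly ccst q) A \<noteq> 0" "s = poly (map_poly ccst p) A / poly (map_poly ccst q) A"
    using assms by (auto simp: subfield_adjoin_def)
  hence "poly (map_poly ccst p) A \<noteq> 0" "inverse s = poly (map_poly ccst q) A / poly (map_poly ccst p) A"
    using False by auto
  thus ?thesis by (auto simp: subfield_adjoin_def)
qed (use assms in auto)

lemma subfield_adjoin_minus: "s \<in> subfield_adjoin A \<Longrightarrow> - s \<in> subfield_adjoin A"
  using subfield_adjoin_mult[OF subfield_adjoin_const[of "-1"]] by (simp add: ccst.hom_simps)

lemma subfield_adjoin_diff:
  "s \<in> subfield_adjoin A \<Longrightarrow> t \<in> subfield_adjoin A \<Longrightarrow> s - t \<in> subfield_adjoin A"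
  using subfield_adjoin_add[OF _ subfield_adjoin_minus[of t A]] by simp

lemma subfield_adjoin_divide:
  "s \<in> subfield_adjoin A \<Longrightarrow> t \<in> subfield_adjoin A \<Longrightarrow> s / t \<in> subfield_adjoin A"
  using subfield_adjoin_mult[OF _ subfield_adjoin_inverse[of t A]] by (simp add: divide_inverse)

text \<open>If \<open>x = p(F/G) / q(F/G)\<close>, then after clearing denominators only the leading terms survive
  modulo \<open>G\<close>, so \<open>G\<close> divides a non-zero polynomial of degree at most 1.\<close>

lemma var_notin_subfield_adjoin:
  fixes F G :: "'a::field poly"
  assumes cop: "coprime_polys F G" and deg: "degree G \<ge> 2"
  shows "to_fract [:0, 1:] \<notin> subfield_adjoin (to_fract F / to_fract G)"
proof
  define A where "A = to_fract F / to_fract G"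
  have G0: "G \<noteq> 0" using deg by auto
  assume "to_fract [:0, 1:] \<in> subfield_adjoin (to_fract F / to_fract G)"
  then obtain p q where q: "poly (map_poly ccst q) A \<noteq> 0"
    and pq: "to_fract [:0, 1:] * poly (map_poly ccst q) A = poly (map_poly ccst p) A"
    by (auto simp: subfield_adjoin_def A_def field_simps)
  have q0: "q \<noteq> 0" using q by (auto simp: ccst.map_poly_simps)
  define n where "n = max (degree p) (degree q)"
  \<comment> \<open>\<open>H r\<close> is \<open>G ^ n * r(F / G)\<close>, the homogenised
    polynomial.\<close>
  define H where "H r = (\<Sum>i\<le>n. smult (coeff r i) (F ^ i * G ^ (n - i)))" for r
  have H: "to_fract (H r) = to_fract G ^ n * poly (map_poly ccst r) A" if "degree r \<le> n" for r
  proof -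
    have "poly (map_poly ccst r) A = (\<Sum>i\<le>n. ccst (coeff r i) * A ^ i)"
    proof -
      have "poly (map_poly ccst r) A = (\<Sum>i\<le>degree r. ccst (coeff r i) * A ^ i)"
        by (simp add: poly_altdef ccst.degree_map ccst.coeff_map)
      also have "\<dots> = (\<Sum>i\<le>n. ccst (coeff r i) * A ^ i)"
        by (rule sum.mono_neutral_left) (use that in \<open>auto simp: coeff_eq_0 ccst.hom_simps\<close>)
      finally show ?thesis .
    qed
    moreover have "to_fract (F ^ i * G ^ (n - i)) = to_fract G ^ n * A ^ i" if "i \<le> n" for i
    proof -
      have "to_fract G ^ n = to_fract G ^ i * to_fract G ^ (n - i)" using that by (simp flip: power_add)
      thus ?thesis using G0 by (simp add: to_fract_power A_def power_divide)
    qed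
    ultimately show ?thesis unfolding H_def
      by (simp add: to_fract_smult sum_distrib_left algebra_simps del: to_fract_mult)
  qed
  have "to_fract ([:0, 1:] * H q) = to_fract (H p)"
    using H[of p] H[of q] pq by (simp add: n_def del: mult_pCons_left)
  hence HH: "[:0, 1:] * H q = H p" by (simp only: to_fract_eq_iff)
  have lead: "G dvd H r - smult (coeff r n) (F ^ n)" for r
  proof -
    have "H r = (\<Sum>i<n. smult (coeff r i) (F ^ i * G ^ (n - i))) + smult (coeff r n) (F ^ n)"
      unfolding H_def by (simp flip: lessThan_Suc_atMost)
    moreover have "G dvd (\<Sum>i<n. smult (coeff r i) (F ^ i * G ^ (n - i)))"
      by (intro dvd_sum dvd_smult dvd_mult) auto
    ultimately show ?thesis by simp
  qed
  have "F ^ n * [:- coeff p n, coeff q n:] =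
      (H p - smult (coeff p n) (F ^ n)) - [:0, 1:] * (H q - smult (coeff q n) (F ^ n))"
    unfolding HH[symmetric] by (simp add: algebra_simps)
  moreover have "G dvd (H p - smult (coeff p n) (F ^ n)) - [:0, 1:] * (H q - smult (coeff q n) (F ^ n))"
    by (rule dvd_diff[OF lead[of p] dvd_mult[OF lead[of q]]])
  ultimately have "G dvd F ^ n * [:- coeff p n, coeff q n:]" by (simp only:)
  hence "G dvd [:- coeff p n, coeff q n:]" by (rule coprime_polys_dvd_cancel[OF cop])
  \<comment> \<open>As \<open>n\<close> is the larger of the two degrees, one of the two entries is
    a leading coefficient.\<close>
  moreover have "[:- coeff p n, coeff q n:] \<noteq> 0"
  proof
    assume "[:- coeff p n, coeff q n:] = 0"
    hence *: "coeff p n = 0" "coeff q n = 0" by auto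
    show False
    proof (cases "n = degree q")
      case True thus False using * q0 by simp
    next
      case False
      hence "n = degree p" "degree p > 0" by (auto simp: n_def max_def split: if_splits)
      thus False using * by (metis degree_0 leading_coeff_0_iff less_irrefl)
    qed
  qed
  ultimately have "degree G \<le> degree [:- coeff p n, coeff q n:]" by (rule dvd_imp_degree_le)
  also have "\<dots> \<le> 1" by simp
  finally show False using deg by simp
qed

section \<open>Degrees over subfields of the function field of y^2 = cubic\<close>

locale ff_even =
  fixes e2 e4 e6 :: "'a::field"
begin

abbreviation E' :: "'a weierstrass" where "E' \<equiv> Weierstrass 0 e2 0 e4 e6"
abbreviation R :: "'a ffun ring" where "R \<equiv> function_field E'"

definition rhs :: "'a poly fract" where "rhs = to_fract [:e6, e4, e2, 1:]"

lemma ff_simps: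
  "carrier R = UNIV" "\<one>\<^bsub>R\<^esub> = (1, 0)" "\<zero>\<^bsub>R\<^esub> = (0, 0)"
  "(u, v) \<otimes>\<^bsub>R\<^esub> (u', v') = (u * u' + v * v' * rhs, u * v' + u' * v)"
  "(u, v) \<oplus>\<^bsub>R\<^esub> (u', v') = (u + u', v + v')"
  by (simp_all add: function_field_def rhs_def)

sublocale F: field R by (rule function_field_field)

lemma ff_minus: "\<ominus>\<^bsub>R\<^esub> (u, v) = (- u, - v)"
  by (rule F.minus_equality) (auto simp: ff_simps)

lemma ff_diff: "(u, v) \<ominus>\<^bsub>R\<^esub> (u', v') = (u - u', v - v')"
  by (simp add: a_minus_def ff_minus ff_simps)

text \<open>This is the norm of \<open>u + v y\<close> to \<open>K(x)\<close>; were it zero, the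
  cubic would be a square in \<open>K(x)\<close>, which its odd degree forbids.\<close>

lemma norm_nonzero:
  assumes "(u, v) \<noteq> (0, 0)" shows "u * u - v * v * rhs \<noteq> 0"
proof (cases "v = 0")
  case False
  have "(u / v) * (u / v) + to_fract 0 * (u / v) \<noteq> rhs"
    unfolding rhs_def by (rule weierstrass_no_root) auto
  thus ?thesis using False by (auto simp: field_simps)
qed (use assms in auto)

lemma ff_inv:
  assumes "(u, v) \<noteq> (0, 0)"
  shows "inv\<^bsub>R\<^esub> (u, v) = (u / (u * u - v * v * rhs), - v / (u * u - v * v * rhs))"
proof (rule F.comm_inv_char)
  define n where "n = u * u - v * v * rhs"
  have n: "n \<noteq> 0" using norm_nonzero[OF assms] by (simp add: n_def)
  have "u * (u / n) + v * (- v / n) * rhs = n / n"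
    unfolding n_def diff_divide_distrib by simp
  thus "(u, v) \<otimes>\<^bsub>R\<^esub> (u / (u * u - v * v * rhs), - v / (u * u - v * v * rhs)) = \<one>\<^bsub>R\<^esub>"
    using n by (simp add: ff_simps flip: n_def)
qed (auto simp: ff_simps)

lemma pow_even: "(u, 0) [^]\<^bsub>R\<^esub> (n::nat) = (u ^ n, 0)"
  by (induction n) (auto simp: ff_simps mult.commute)

lemma ff_const_eq: "ff_const c = (ccst c, 0)"
  by (simp add: ff_const_def ccst_def)

definition xx :: "'a poly fract" where "xx = to_fract [:0, 1:]"

text \<open>The variable is a zero of \<open>F(X) - A G(X)\<close> with \<open>A = F / G\<close>;
  because \<open>G\<close> has smaller degree, the leading coefficient of \<open>F\<close>
  survives.\<close>

lemma x_algebraic: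
  assumes "subfield L R" "range ff_const \<subseteq> L" "(to_fract F / to_fract G, 0) \<in> L"
    and deg: "degree G < degree F" and G: "G \<noteq> 0"
  shows "(F.algebraic over L) (xx, 0)"
proof -
  define A where "A = to_fract F / to_fract G"
  define c where "c i = (ccst (coeff F i) - A * ccst (coeff G i), 0 :: 'a poly fract)" for i
  \<comment> \<open>Polynomials over \<open>L\<close> are coefficient lists with the leading
    coefficient first, hence the \<open>rev\<close>.\<close>
  define l where "l n = rev (map c [0..<n])" for n
  have cL: "c i \<in> L" for i
  proof -
    have "(ccst (coeff F i), 0) \<ominus>\<^bsub>R\<^esub> (A, 0) \<otimes>\<^bsub>R\<^esub> (ccst (coeff G i), 0) \<in> L"
      using assms(1-3) unfolding A_def[symmetric] ff_const_eq[symmetric] a_minus_def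
      by (intro subringE(5-7)[OF subfieldE(1)[OF assms(1)]]) auto
    thus ?thesis by (simp add: c_def ff_simps ff_diff)
  qed
  have ev: "F.eval (l n) (xx, 0) = ((\<Sum>i<n. (ccst (coeff F i) - A * ccst (coeff G i)) * xx ^ i), 0)" for n
    by (induction n) (auto simp: l_def ff_simps pow_even c_def algebra_simps)
  have sum: "(\<Sum>i<Suc (degree F). ccst (coeff p i) * xx ^ i) = to_fract p" if "degree p \<le> degree F" for p
  proof -
    have "to_fract p = (\<Sum>i\<le>degree p. ccst (coeff p i) * xx ^ i)"
      using to_fract_conv_poly[of p] by (simp add: poly_altdef ccst.degree_map ccst.coeff_map flip: xx_def)
    also have "\<dots> = (\<Sum>i\<le>degree F. ccst (coeff p i) * xx ^ i)"
      by (rule sum.mono_neutral_left) (use that in \<open>auto simp: coeff_eq_0 ccst.hom_simps\<close>)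
    finally show ?thesis by (simp only: lessThan_Suc_atMost)
  qed
  let ?p = "l (Suc (degree F))"
  show ?thesis
  proof (rule F.algebraicI)
    show "?p \<noteq> []" by (simp add: l_def)
    have "coeff G (degree F) = 0" using deg by (simp add: coeff_eq_0)
    hence "c (degree F) \<noteq> (0, 0)" using deg by (auto simp: c_def ccst.hom_simps)
    hence "hd ?p \<noteq> \<zero>\<^bsub>R\<^esub>" by (simp add: l_def ff_simps)
    moreover have "set ?p \<subseteq> L" using cL by (auto simp: l_def)
    ultimately show "?p \<in> carrier (L [X]\<^bsub>R\<^esub>)"
      unfolding univ_poly_carrier[symmetric] polynomial_def by auto
    have "(\<Sum>i<Suc (degree F). (ccst (coeff F i) - A * ccst (coeff G i)) * xx ^ i) =
        (\<Sum>i<Suc (degree F). ccst (coeff F i) * xx ^ i) - A * (\<Sum>i<Suc (degree F). ccst (coeff G i) * xx ^ i)"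
      by (simp only: sum_distrib_left sum_subtractf[symmetric]) (simp add: algebra_simps)
    also have "\<dots> = 0" using sum[of F] sum[of G] deg G by (simp add: A_def)
    finally show "F.eval ?p (xx, 0) = \<zero>\<^bsub>R\<^esub>" unfolding ev by (simp add: ff_simps)
  qed
qed

text \<open>The tower is \<open>L\<close>, \<open>L(x)\<close>, the function field: the first step
  is finite as \<open>x\<close> is algebraic, and the second is spanned by 1 and \<open>y\<close>
  because \<open>L(x)\<close> contains \<open>K(x)\<close>. Only with a finite dimension does
  \<open>isogeny_degree\<close> carry information.\<close>

lemma finite_dimension_carrier:
  assumes "subfield L R" "range ff_const \<subseteq> L" "(to_fract F / to_fract G, 0) \<in> L"
    and deg: "degree G < degree F" and G: "G \<noteq> 0"
  shows "F.finite_dimension L (carrier R)"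
proof -
  define L1 where "L1 = F.simple_extension L (xx, 0)"
  have alg: "(F.algebraic over L) (xx, 0)" by (rule x_algebraic[OF assms])
  have sf: "subfield L1 R"
    unfolding L1_def using F.simple_extension_is_subfield[OF assms(1)] alg by (simp add: ff_simps)
  have fd: "F.finite_dimension L L1"
    unfolding L1_def using F.finite_dimension_simple_extension[OF assms(1)] alg by (simp add: ff_simps)
  have LL1: "L \<subseteq> L1" and x1: "(xx, 0) \<in> L1" unfolding L1_def
    using F.simple_extension_incl[of L] F.simple_extension_mem[OF subfieldE(1)[OF assms(1)]]
    by (auto simp: ff_simps)
  note sub = subringE[OF subfieldE(1)[OF sf]]
  have p1: "(to_fract p, 0) \<in> L1" for p
  proof (induction p)
    case 0 thus ?case using sub(2) by (simp add: ff_simps)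
  next
    case (pCons a p)
    have "pCons a p = [:a:] + [:0, 1:] * p" by simp
    hence "to_fract (pCons a p) = ccst a + xx * to_fract p"
      unfolding ccst_def xx_def by (simp only: to_fract_add to_fract_mult)
    moreover have "(ccst a, 0) \<in> L1" using assms(2) LL1 unfolding ff_const_eq[symmetric] by auto
    hence "(ccst a, 0) \<oplus>\<^bsub>R\<^esub> (xx, 0) \<otimes>\<^bsub>R\<^esub> (to_fract p, 0) \<in> L1"
      using pCons x1 by (intro sub(6,7))
    ultimately show ?case by (simp add: ff_simps)
  qed
  have t1: "(t, 0) \<in> L1" for t
  proof (cases t)
    case (Fract p q)
    hence t: "t = to_fract p * inverse (to_fract q)" by (simp add: Fract_conv_to_fract divide_inverse)
    have "inv\<^bsub>R\<^esub> (to_fract q, 0) = (inverse (to_fract q), 0)"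
      using Fract ff_inv[of "to_fract q" 0] by (simp add: field_simps)
    moreover have "inv\<^bsub>R\<^esub> (to_fract q, 0) \<in> L1"
      using F.subfield_m_inv(1)[OF sf, of "(to_fract q, 0)"] p1 Fract by (simp add: ff_simps)
    ultimately have "(to_fract p, 0) \<otimes>\<^bsub>R\<^esub> (inverse (to_fract q), 0) \<in> L1"
      using p1 by (intro sub(6)) auto
    thus ?thesis by (simp add: t ff_simps)
  qed
  have "F.Span L1 [(0, 1), (1, 0)] = carrier R"
  proof -
    have "z \<in> F.line_extension L1 (0, 1) (F.line_extension L1 (1, 0) {\<zero>\<^bsub>R\<^esub>})" for z
    proof -
      obtain u v where z: "z = (u, v)" by (cases z)
      have "z = (v, 0) \<otimes>\<^bsub>R\<^esub> (0, 1) \<oplus>\<^bsub>R\<^esub> ((u, 0) \<otimes>\<^bsub>R\<^esub> (1, 0) \<oplus>\<^bsub>R\<^esub> \<zero>\<^bsub>R\<^esub>)"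
        by (simp add: z ff_simps)
      moreover have "(u, 0) \<otimes>\<^bsub>R\<^esub> (1, 0) \<oplus>\<^bsub>R\<^esub> \<zero>\<^bsub>R\<^esub> \<in> F.line_extension L1 (1, 0) {\<zero>\<^bsub>R\<^esub>}"
        using t1 unfolding F.line_extension_mem_iff by blast
      ultimately show ?thesis using t1 by (subst F.line_extension_mem_iff) blast
    qed
    thus ?thesis by (auto simp: ff_simps)
  qed
  hence "F.finite_dimension L1 (carrier R)"
    using F.Span_finite_dimension[OF sf, of "[(0, 1), (1, 0)]"] by (simp add: ff_simps)
  thus ?thesis using F.telescopic_base_dim(1)[OF assms(1) sf fd] by simp
qed

text \<open>An element outside \<open>L\<close> is linearly independent of 1 over
  \<open>L\<close>.\<close>

lemma dim_gt_1:
  assumes "subfield L R" "F.finite_dimension L (carrier R)" "z \<notin> L"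
  shows "F.dim L (carrier R) > 1"
proof -
  have d: "F.dimension (F.dim L (carrier R)) L (carrier R)"
    using F.finite_dimensionE[OF assms(1,2)] by (simp add: over_def)
  have L0: "\<zero>\<^bsub>R\<^esub> \<in> L" using subringE(2)[OF subfieldE(1)[OF assms(1)]] by simp
  have "F.Span L [\<one>\<^bsub>R\<^esub>] \<subseteq> L"
  proof
    fix w assume "w \<in> F.Span L [\<one>\<^bsub>R\<^esub>]"
    hence "\<exists>k\<in>L. w = k \<otimes>\<^bsub>R\<^esub> \<one>\<^bsub>R\<^esub> \<oplus>\<^bsub>R\<^esub> \<zero>\<^bsub>R\<^esub>" by (simp add: F.line_extension_mem_iff)
    thus "w \<in> L" by (auto simp: ff_simps)
  qed
  hence "F.independent L [z, \<one>\<^bsub>R\<^esub>]"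
    using assms(3) by (intro F.li_Cons F.li_Nil) (auto simp: ff_simps)
  from F.independent_length_le_dimension[OF assms(1) d this]
  show ?thesis by (auto simp: ff_simps)
qed

end

section \<open>K-magnification from polynomial data\<close>

lemma has_value_AffineI:
  assumes "F \<otimes>\<^bsub>function_field E\<^esub> ff_of_cfun h = ff_of_cfun g"
    "cfun_eval h x y \<noteq> 0" "cfun_eval g x y = c * cfun_eval h x y"
  shows "has_value E F (Affine x y) c"
  unfolding has_value_def using assms by (intro exI[of _ g] exI[of _ h]) auto

lemma has_value_InfinityI:
  assumes "F \<otimes>\<^bsub>function_field E\<^esub> ff_of_cfun h = ff_of_cfun g" "h \<noteq> (0, 0)"
    "cfun_pole g \<le> cfun_pole h" "c = cfun_coeff g (cfun_pole h) / cfun_coeff h (cfun_pole h)"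
  shows "has_value E F Infinity c"
  unfolding has_value_def using assms by (intro exI[of _ g] exI[of _ h]) auto

context ff_even
begin

text \<open>The isogeny is \<open>(x, y) \<mapsto> (F / D\<^sup>2, y N / D\<^sup>3)\<close>, followed by the change of variables
  that undoes completing the square on the target.\<close>

lemma K_magnifiedI:
  fixes E :: "'a weierstrass" and D F N :: "'a poly"
  defines "\<alpha> \<equiv> wa1 E / 2" and "\<beta> \<equiv> wa3 E / 2"
  assumes two: "(2::'a) \<noteq> 0" and ell: "elliptic_curve E" "elliptic_curve E'"
    and D: "degree D \<ge> 1" and F: "degree F = 2 * degree D + 1" and N: "degree N = 3 * degree D"
    and cop: "coprime_polys F D"
    and eq: "N\<^sup>2 * [:e6, e4, e2, 1:] = F ^ 3 + [:wa2 E + \<alpha>\<^sup>2:] * F\<^sup>2 * D\<^sup>2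
       + [:wa4 E + 2 * \<alpha> * \<beta>:] * F * D ^ 4 + [:wa6 E + \<beta>\<^sup>2:] * D ^ 6"
    and Q: "y\<^sup>2 = x ^ 3 + e2 * x\<^sup>2 + e4 * x + e6" "poly D x \<noteq> 0"
    and xP: "poly F x = xP * (poly D x)\<^sup>2" and yP: "y * poly N x = (yP + \<alpha> * xP + \<beta>) * poly D x ^ 3"
  shows "K_magnified E (Affine xP yP)"
proof -
  define A B where "A = to_fract F / to_fract (D\<^sup>2)" and "B = to_fract N / to_fract (D ^ 3)"
  define a b where "a = ccst \<alpha>" and "b = ccst \<beta>"
  define \<phi> where "\<phi> = ((A, 0 :: 'a poly fract), (- (a * A + b), B))"
  have D0: "D \<noteq> 0" and F0: "F \<noteq> 0" and N0: "N \<noteq> 0" using D F N by auto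
  define d n t where "d = to_fract D" and "n = to_fract N" and "t = to_fract F"
  have nz: "d \<noteq> 0" "n \<noteq> 0" using D0 N0 by (auto simp: d_def n_def)
  have A: "A = t / d\<^sup>2" and B: "B = n / d ^ 3" by (auto simp: A_def B_def t_def d_def n_def to_fract_power)
  have A': "A * d\<^sup>2 = t" and B': "B * d ^ 3 = n" using nz by (auto simp: A B)
  have rhs0: "rhs \<noteq> 0" by (simp add: rhs_def)
  have cs: "ccst (wa1 E) = 2 * a" "ccst (wa3 E) = 2 * b" "ccst (wa2 E + \<alpha>\<^sup>2) = ccst (wa2 E) + a\<^sup>2"
    "ccst (wa4 E + 2 * \<alpha> * \<beta>) = ccst (wa4 E) + 2 * a * b" "ccst (wa6 E + \<beta>\<^sup>2) = ccst (wa6 E) + b\<^sup>2"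
  proof -
    have "wa1 E = 2 * \<alpha>" "wa3 E = 2 * \<beta>" using two by (auto simp: \<alpha>_def \<beta>_def)
    thus "ccst (wa1 E) = 2 * a" "ccst (wa3 E) = 2 * b" unfolding a_def b_def by (metis ccst.hom_mult ccst.hom_numeral)+
  qed (auto simp: a_def b_def ccst.hom_simps)
  have "to_fract (N\<^sup>2 * [:e6, e4, e2, 1:]) = to_fract (F ^ 3 + [:wa2 E + \<alpha>\<^sup>2:] * F\<^sup>2 * D\<^sup>2
       + [:wa4 E + 2 * \<alpha> * \<beta>:] * F * D ^ 4 + [:wa6 E + \<beta>\<^sup>2:] * D ^ 6)" by (simp only: eq)
  hence eq': "n\<^sup>2 * rhs = t ^ 3 + (ccst (wa2 E) + a\<^sup>2) * t\<^sup>2 * d\<^sup>2 + (ccst (wa4 E) + 2 * a * b) * t * d ^ 4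
      + (ccst (wa6 E) + b\<^sup>2) * d ^ 6"
    by (simp only: to_fract_add to_fract_mult to_fract_power ccst_def[symmetric] cs n_def t_def d_def rhs_def)
  have "d ^ 6 * (B\<^sup>2 * rhs) = d ^ 6 * (A ^ 3 + (ccst (wa2 E) + a\<^sup>2) * A\<^sup>2 + (ccst (wa4 E) + 2 * a * b) * A
      + (ccst (wa6 E) + b\<^sup>2))"
    using eq' unfolding A'[symmetric] B'[symmetric] by Groebner_Basis.algebra
  hence AB: "B\<^sup>2 * rhs = A ^ 3 + (ccst (wa2 E) + a\<^sup>2) * A\<^sup>2 + (ccst (wa4 E) + 2 * a * b) * A
      + (ccst (wa6 E) + b\<^sup>2)" using nz by simp
  have rat: "rational_map E' E \<phi>"
    unfolding rational_map_def Let_def \<phi>_def ff_const_eq cs fst_conv snd_conv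
    using AB by (simp add: ff_simps power2_eq_square power3_eq_cube algebra_simps)
  have inf: "maps_to E' \<phi> Infinity Infinity"
  proof -
    \<comment> \<open>All three homogeneous coordinates get the denominator \<open>N\<close> times
      the cubic, of pole order \<open>6 deg D + 6\<close>. The numerators \<open>y F D\<close> and
      \<open>y D\<^sup>3\<close> have smaller pole orders, so their values at infinity are
      0.\<close>
    let ?h = "(N * [:e6, e4, e2, 1:], 0 :: 'a poly)"
    have nf: "N * [:e6, e4, e2, 1:] \<noteq> 0" using N0 by (simp del: mult_pCons_right)
    have dnf: "degree (N * [:e6, e4, e2, 1:]) = 3 * degree D + 3"
      using N0 N by (subst degree_mult_eq) auto
    have pole: "cfun_pole ?h = 2 * (3 * degree D + 3)" using dnf by (simp add: cfun_pole_def del: mult_pCons_right)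
    have ch: "cfun_coeff ?h (2 * (3 * degree D + 3)) \<noteq> 0"
    proof -
      have "coeff (N * [:e6, e4, e2, 1:]) (3 * degree D + 3) \<noteq> 0"
        using nf dnf by (metis leading_coeff_0_iff)
      moreover have "2 * (3 * degree D + 3) div 2 = 3 * degree D + 3" by simp
      ultimately show ?thesis by (simp only: cfun_coeff_def fst_conv dvd_triv_left if_True not_False_eq_True)
    qed
    have h0: "?h \<noteq> (0, 0)" using nf by simp
    \<comment> \<open>\<open>G\<close> is \<open>1 / (B y)\<close>, rewritten as
      \<open>y / (B rhs)\<close> in the basis 1, \<open>y\<close>; it scales the term
      \<open>B y\<close> of the ordinate to 1.\<close>
    define g0 where "g0 = 1 / (B * rhs)"
    define G where "G = (0 :: 'a poly fract, g0)"
    have toh: "ff_of_cfun ?h = (n * rhs, 0)" by (simp add: ff_of_cfun_def n_def rhs_def del: mult_pCons_right)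
    have Bn: "g0 * (n * rhs) = d ^ 3" using rhs0 nz by (simp add: g0_def B field_simps)
    have p1: "cfun_pole (0, D ^ 3) \<le> 2 * (3 * degree D + 3)"
      by (simp add: cfun_pole_def degree_power_eq D0)
    have dFD: "degree (F * D) = 3 * degree D + 1" using F0 D0 F by (simp add: degree_mult_eq)
    have FD0: "F * D \<noteq> 0" using F0 D0 by simp
    have v1: "has_value E' (G \<otimes>\<^bsub>R\<^esub> (A, 0)) Infinity 0"
    proof (rule has_value_InfinityI)
      have "A * d ^ 3 = t * d" using nz by (simp add: A power2_eq_square power3_eq_cube)
      hence "A * g0 * (n * rhs) = t * d" using Bn by (simp only: mult.assoc)
      thus "G \<otimes>\<^bsub>R\<^esub> (A, 0) \<otimes>\<^bsub>R\<^esub> ff_of_cfun ?h = ff_of_cfun (0, F * D)"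
        unfolding toh G_def by (simp add: ff_simps ff_of_cfun_def t_def d_def ac_simps)
      show "cfun_pole (0, F * D) \<le> cfun_pole ?h"
        unfolding pole using dFD FD0 by (simp add: cfun_pole_def)
    qed (use h0 in \<open>simp_all add: pole cfun_coeff_def\<close>)
    have v3: "has_value E' G Infinity 0"
    proof (rule has_value_InfinityI)
      show "G \<otimes>\<^bsub>R\<^esub> ff_of_cfun ?h = ff_of_cfun (0, D ^ 3)"
        unfolding toh G_def using Bn by (simp add: ff_simps ff_of_cfun_def d_def to_fract_power ac_simps)
      show "cfun_pole (0, D ^ 3) \<le> cfun_pole ?h" unfolding pole by (rule p1)
    qed (use h0 in \<open>simp_all add: pole cfun_coeff_def\<close>)
    have v2: "has_value E' (G \<otimes>\<^bsub>R\<^esub> (- (a * A + b), B)) Infinity 1"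
    proof -
      \<comment> \<open>The correction that undoes completing the square has pole order at most
        \<open>6 deg D + 5\<close>, so numerator and denominator share their leading term and the
        value is 1.\<close>
      let ?m = "- ([:\<alpha>:] * (F * D) + [:\<beta>:] * D ^ 3)"
      let ?g = "(N * [:e6, e4, e2, 1:], ?m)"
      have dm: "degree ?m \<le> 3 * degree D + 1"
        unfolding degree_minus
        by (rule degree_add_le) (use dFD in \<open>auto simp: degree_power_eq D0 intro: order_trans[OF degree_smult_le]\<close>)
      show ?thesis
      proof (rule has_value_InfinityI)
        have "g0 * B * rhs = 1" using rhs0 nz by (simp add: g0_def B)
        moreover have "(a * A + b) * g0 * (n * rhs) = a * (t * d) + b * d ^ 3"
        proof -
          have "A * d ^ 3 = t * d" using nz by (simp add: A power2_eq_square power3_eq_cube)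
          moreover have "(a * A + b) * g0 * (n * rhs) = (a * A + b) * d ^ 3"
            using Bn by (simp only: mult.assoc)
          ultimately show ?thesis by (simp add: algebra_simps)
        qed
        moreover have "to_fract ?m = - (a * (t * d) + b * d ^ 3)"
          unfolding to_fract_uminus to_fract_add to_fract_mult to_fract_power a_def b_def ccst_def t_def d_def ..
        moreover have "G \<otimes>\<^bsub>R\<^esub> (- (a * A + b), B) \<otimes>\<^bsub>R\<^esub> (n * rhs, 0) =
            (g0 * B * rhs * (n * rhs), - ((a * A + b) * g0 * (n * rhs)))"
          by (simp add: G_def ff_simps algebra_simps)
        ultimately have "G \<otimes>\<^bsub>R\<^esub> (- (a * A + b), B) \<otimes>\<^bsub>R\<^esub> ff_of_cfun ?h = (n * rhs, to_fract ?m)"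
          unfolding toh by (simp only: mult_1_left)
        thus "G \<otimes>\<^bsub>R\<^esub> (- (a * A + b), B) \<otimes>\<^bsub>R\<^esub> ff_of_cfun ?h = ff_of_cfun ?g"
          unfolding ff_of_cfun_def fst_conv snd_conv n_def rhs_def by (simp only: to_fract_mult)
        show "cfun_pole ?g \<le> cfun_pole ?h" unfolding pole using dm dnf
          by (simp add: cfun_pole_def del: mult_pCons_right mult_pCons_left)
        show "1 = cfun_coeff ?g (cfun_pole ?h) / cfun_coeff ?h (cfun_pole ?h)"
          using ch unfolding pole by (simp add: cfun_coeff_def)
      qed (rule h0)
    qed
    show ?thesis unfolding maps_to_def \<phi>_def
      by (rule exI[of _ G]) (use v1 v2 v3 in simp)
  qed
  have val: "maps_to E' \<phi> (Affine x y) (Affine xP yP)"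
  proof -
    have v1: "has_value E' ((1, 0) \<otimes>\<^bsub>R\<^esub> (A, 0)) (Affine x y) xP"
    proof (rule has_value_AffineI)
      show "(1, 0) \<otimes>\<^bsub>R\<^esub> (A, 0) \<otimes>\<^bsub>R\<^esub> ff_of_cfun (D\<^sup>2, 0) = ff_of_cfun (F, 0)"
        using A' by (simp add: ff_simps ff_of_cfun_def to_fract_power d_def t_def)
    qed (use Q xP in \<open>auto simp: cfun_eval_def\<close>)
    have v2: "has_value E' ((1, 0) \<otimes>\<^bsub>R\<^esub> (- (a * A + b), B)) (Affine x y) yP"
    proof (rule has_value_AffineI)
      let ?m = "- ([:\<alpha>:] * (F * D) + [:\<beta>:] * D ^ 3)"
      have "A * d ^ 3 = t * d" using nz by (simp add: A power2_eq_square power3_eq_cube)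
      hence "- (a * A + b) * d ^ 3 = - (a * (t * d) + b * d ^ 3)" by (simp add: algebra_simps)
      also have "\<dots> = to_fract ?m"
        unfolding to_fract_uminus to_fract_add to_fract_mult to_fract_power a_def b_def ccst_def t_def d_def ..
      finally show "(1, 0) \<otimes>\<^bsub>R\<^esub> (- (a * A + b), B) \<otimes>\<^bsub>R\<^esub> ff_of_cfun (D ^ 3, 0) = ff_of_cfun (?m, N)"
        using B' unfolding ff_of_cfun_def fst_conv snd_conv ff_simps to_fract_power d_def[symmetric] n_def[symmetric]
        by (simp add: mult.commute)
      have *: "poly F x * poly D x = xP * poly D x ^ 3" by (simp add: xP power2_eq_square power3_eq_cube)
      have "cfun_eval (?m, N) x y = - (\<alpha> * (poly F x * poly D x) + \<beta> * poly D x ^ 3) + y * poly N x"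
        by (simp add: cfun_eval_def)
      also have "\<dots> = yP * poly D x ^ 3" unfolding * yP by (simp add: algebra_simps)
      finally show "cfun_eval (?m, N) x y = yP * cfun_eval (D ^ 3, 0) x y" by (simp add: cfun_eval_def)
    qed (use Q in \<open>auto simp: cfun_eval_def\<close>)
    have v3: "has_value E' (1, 0) (Affine x y) 1"
      by (rule has_value_AffineI[where h = "(1, 0)" and g = "(1, 0)"]) (auto simp: ff_simps ff_of_cfun_def cfun_eval_def)
    show ?thesis unfolding maps_to_def \<phi>_def
      by (rule exI[of _ "(1, 0)"]) (use v1 v2 v3 in simp)
  qed
  define L where "L = pullback_field E' \<phi>"
  have L: "L = generate_field R (range ff_const \<union> {(A, 0), (- (a * A + b), B)})"
    by (simp add: L_def pullback_field_def \<phi>_def)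
  have sf: "subfield L R" unfolding L by (rule F.generate_field_is_subfield) (simp add: ff_simps)
  have Lc: "range ff_const \<subseteq> L" and LA: "(to_fract F / to_fract (D\<^sup>2), 0) \<in> L"
    unfolding L A_def[symmetric] by (auto intro: generate_field.incl)
  have dD: "degree (D\<^sup>2) = 2 * degree D" by (simp add: degree_power_eq D0)
  have fin: "F.finite_dimension L (carrier R)"
    using finite_dimension_carrier[OF sf Lc LA] dD F D0 by simp
  \<comment> \<open>Since \<open>(B y)\<^sup>2\<close> lies in \<open>K(A)\<close>, the elements
    \<open>u + w B y\<close> with \<open>u\<close>, \<open>w\<close> in \<open>K(A)\<close> form a
    field. As \<open>x\<close> has no \<open>y\<close> part, it remains to see that \<open>x\<close>
    is not in \<open>K(A)\<close>.\<close>
  have "L \<subseteq> {(u, v) | u v. u \<in> subfield_adjoin A \<and> (\<exists>w\<in>subfield_adjoin A. v = w * B)}" (is "_ \<subseteq> ?S")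
    unfolding L
  proof (rule F.generate_field_min_subfield1)
    note adj = subfield_adjoin_const subfield_adjoin_gen subfield_adjoin_add subfield_adjoin_mult
      subfield_adjoin_diff subfield_adjoin_divide subfield_adjoin_minus
    have B2: "B * B * rhs \<in> subfield_adjoin A"
    proof -
      have "A ^ 3 + (ccst (wa2 E) + a\<^sup>2) * A\<^sup>2 + (ccst (wa4 E) + 2 * a * b) * A + (ccst (wa6 E) + b\<^sup>2)
          \<in> subfield_adjoin A"
        unfolding power2_eq_square power3_eq_cube cs[symmetric] a_def b_def
          ccst.hom_numeral[of "Num.Bit0 Num.One", symmetric]
        by (intro adj)
      thus ?thesis using AB by (simp add: power2_eq_square)
    qed
    have z0: "0 \<in> subfield_adjoin A" and z1: "1 \<in> subfield_adjoin A"
      using subfield_adjoin_const[of 0 A] subfield_adjoin_const[of 1 A] by (auto simp: ccst.hom_simps)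
    show "subfield ?S R"
    proof (rule F.subfieldI'[OF F.subringI])
      show "\<one>\<^bsub>R\<^esub> \<in> ?S" using z0 z1 by (auto simp: ff_simps)
      show "\<ominus>\<^bsub>R\<^esub> h \<in> ?S" if hS: "h \<in> ?S" for h
      proof -
        obtain u w where h: "h = (u, w * B)" "u \<in> subfield_adjoin A" "w \<in> subfield_adjoin A" using hS by auto
        have "- u \<in> subfield_adjoin A" "- w \<in> subfield_adjoin A" "- (w * B) = - w * B" using h adj by auto
        thus ?thesis unfolding h ff_minus by blast
      qed
      fix h1 h2 assume "h1 \<in> ?S" "h2 \<in> ?S"
      then obtain u1 w1 u2 w2 where h: "h1 = (u1, w1 * B)" "u1 \<in> subfield_adjoin A" "w1 \<in> subfield_adjoin A"
        "h2 = (u2, w2 * B)" "u2 \<in> subfield_adjoin A" "w2 \<in> subfield_adjoin A" by auto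
      have "h1 \<oplus>\<^bsub>R\<^esub> h2 = (u1 + u2, (w1 + w2) * B)" by (simp add: h ff_simps algebra_simps)
      moreover have "u1 + u2 \<in> subfield_adjoin A" "w1 + w2 \<in> subfield_adjoin A" using h by (auto intro: adj)
      ultimately show "h1 \<oplus>\<^bsub>R\<^esub> h2 \<in> ?S" by blast
      have "h1 \<otimes>\<^bsub>R\<^esub> h2 = (u1 * u2 + w1 * w2 * (B * B * rhs), (u1 * w2 + u2 * w1) * B)"
        by (simp add: h ff_simps algebra_simps)
      moreover have "u1 * u2 + w1 * w2 * (B * B * rhs) \<in> subfield_adjoin A" "u1 * w2 + u2 * w1 \<in> subfield_adjoin A"
        using adj(3)[OF adj(4)[OF h(2) h(5)] adj(4)[OF adj(4)[OF h(3) h(6)] B2]] h by (auto intro: adj)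
      ultimately show "h1 \<otimes>\<^bsub>R\<^esub> h2 \<in> ?S" by blast
    next
      fix k assume kS: "k \<in> ?S - {\<zero>\<^bsub>R\<^esub>}"
      then obtain u w where k: "k = (u, w * B)" "u \<in> subfield_adjoin A" "w \<in> subfield_adjoin A"
        by blast
      have k0: "(u, w * B) \<noteq> (0, 0)" using kS k(1) by (simp add: ff_simps)
      define m where "m = u * u - w * w * (B * B * rhs)"
      have m: "m \<in> subfield_adjoin A"
        unfolding m_def by (rule adj(5)[OF adj(4)[OF k(2) k(2)] adj(4)[OF adj(4)[OF k(3) k(3)] B2]])
      have "inv\<^bsub>R\<^esub> k = (u / m, - w / m * B)"
        using ff_inv[OF k0] by (simp add: k m_def ac_simps)
      moreover have "u / m \<in> subfield_adjoin A" "- w / m \<in> subfield_adjoin A" using k m by (auto intro!: adj)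
      ultimately show "inv\<^bsub>R\<^esub> k \<in> ?S" by blast
    qed (simp add: ff_simps)
    have "(0::'a poly fract) = 0 * B" "B = 1 * B" by simp_all
    moreover have "- (a * A + b) \<in> subfield_adjoin A" unfolding a_def b_def by (intro adj)
    ultimately show "range ff_const \<union> {(A, 0), (- (a * A + b), B)} \<subseteq> ?S"
      using z0 z1 adj(1)[of _ A] adj(2)[of A] unfolding ff_const_eq by blast
  qed (simp add: ff_simps)
  moreover have "xx \<notin> subfield_adjoin A"
    unfolding xx_def A_def using D dD by (intro var_notin_subfield_adjoin coprime_polys_square cop) auto
  ultimately have "(xx, 0) \<notin> L" by auto
  hence "isogeny_degree E' \<phi> > 1"
    unfolding isogeny_degree_def L_def[symmetric] by (rule dim_gt_1[OF sf fin])
  moreover have "Affine x y \<in> points E'" using Q by (simp add: points_def)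
  ultimately show ?thesis unfolding K_magnified_def isogeny_def using ell rat inf val by blast
qed

end

section \<open>Tripling\<close>

lemma wdisc_cubic:
  fixes a2 a4 a6 :: "'a::field"
  shows "wdisc (Weierstrass 0 a2 0 a4 a6) =
    16 * (a2\<^sup>2 * a4\<^sup>2 - 4 * a4 ^ 3 - 4 * a2 ^ 3 * a6 - 27 * a6\<^sup>2 + 18 * a2 * a4 * a6)"
  unfolding wdisc_def Let_def weierstrass.sel zero_power2 mult_zero_left mult_zero_right add_0_left add_0_right
  by Groebner_Basis.algebra

lemma cubic_curveI:
  fixes a2 a4 a6 :: "'a::field"
  assumes two: "(2::'a) \<noteq> 0" and "elliptic_curve (Weierstrass 0 a2 0 a4 a6)"
  shows "cubic_curve a2 a4 a6"
proof
  fix x assume f: "x ^ 3 + a2 * x\<^sup>2 + a4 * x + a6 = 0"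
  show "3 * x\<^sup>2 + 2 * a2 * x + a4 \<noteq> 0"
  proof
    assume d: "3 * x\<^sup>2 + 2 * a2 * x + a4 = 0"
    \<comment> \<open>A double root determines \<open>a4\<close> and \<open>a6\<close> from
      \<open>x\<close> and \<open>a2\<close>, and with these values the discriminant vanishes
      identically.\<close>
    have a4: "a4 = - (3 * x\<^sup>2 + 2 * a2 * x)" using d by (simp add: add_eq_0_iff)
    have "a6 = - (x ^ 3 + a2 * x\<^sup>2 + a4 * x)" using f by (simp add: add_eq_0_iff)
    hence a6: "a6 = 2 * x ^ 3 + a2 * x\<^sup>2" unfolding a4 by (simp add: algebra_simps power2_eq_square power3_eq_cube)
    have "wdisc (Weierstrass 0 a2 0 a4 a6) = 0"
      unfolding wdisc_cubic a6 a4 by Groebner_Basis.algebra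
    thus False using assms(2) by (simp add: elliptic_curve_def)
  qed
qed (rule two)

text \<open>The coefficient \<open>c\<close> may be 0, so cancelling leading terms are handled by
  arithmetic. The leading coefficients obtained below as 12 - 9, 9 - 8 and 27 - 28 hold in every
  characteristic.\<close>

definition has_lead :: "'a::comm_ring_1 poly \<Rightarrow> nat \<Rightarrow> 'a \<Rightarrow> bool" where
  "has_lead p n c \<longleftrightarrow> degree p \<le> n \<and> coeff p n = c"

lemma has_lead_mult:
  assumes "has_lead p m a" "has_lead q n b" shows "has_lead (p * q) (m + n) (a * b)"
  unfolding has_lead_def
proof
  have d: "degree p \<le> m" "degree q \<le> n" using assms by (auto simp: has_lead_def)
  show "degree (p * q) \<le> m + n" using degree_mult_le[of p q] d by linarith
  have "coeff (p * q) (m + n) = (\<Sum>i\<le>m + n. coeff p i * coeff q (m + n - i))" by (rule coeff_mult)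
  also have "\<dots> = (\<Sum>i\<in>{m}. coeff p i * coeff q (m + n - i))"
  proof (rule sum.mono_neutral_right)
    show "\<forall>i\<in>{..m + n} - {m}. coeff p i * coeff q (m + n - i) = 0"
    proof
      fix i assume "i \<in> {..m + n} - {m}"
      hence "i > m \<or> m + n - i > n" by auto
      thus "coeff p i * coeff q (m + n - i) = 0" using d by (auto simp: coeff_eq_0)
    qed
  qed auto
  finally show "coeff (p * q) (m + n) = a * b" using assms by (simp add: has_lead_def)
qed

lemma has_lead_add: "has_lead p n a \<Longrightarrow> has_lead q n b \<Longrightarrow> has_lead (p + q) n (a + b)"
  by (auto simp: has_lead_def intro: degree_add_le)

lemma has_lead_diff: "has_lead p n a \<Longrightarrow> has_lead q n b \<Longrightarrow> has_lead (p - q) n (a - b)"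
  by (auto simp: has_lead_def intro: degree_diff_le)

lemma has_lead_minus: "has_lead p n a \<Longrightarrow> has_lead (- p) n (- a)"
  by (auto simp: has_lead_def)

lemma has_lead_power: "has_lead p n a \<Longrightarrow> has_lead (p ^ k) (k * n) (a ^ k)"
proof (induction k)
  case (Suc k)
  thus ?case using has_lead_mult[of p n a "p ^ k" "k * n" "a ^ k"] by simp
qed (simp add: has_lead_def)

lemma has_lead_numeral: "has_lead (numeral k :: 'a::comm_ring_1 poly) 0 (numeral k)"
  by (simp add: has_lead_def numeral_poly)

lemma has_lead_Suc: "has_lead p n a \<Longrightarrow> has_lead p (Suc n) 0"
  by (auto simp: has_lead_def coeff_eq_0)

lemma has_lead_degree: "has_lead p n c \<Longrightarrow> c \<noteq> 0 \<Longrightarrow> degree p = n"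
  unfolding has_lead_def by (metis le_degree le_antisym)

context cubic_curve
begin

text \<open>Here \<open>hf\<close> is \<open>f'' / 2\<close>, so that \<open>psi = 2 f f'' - f'\<^sup>2\<close> is the third division polynomial, and
  \<open>3 (x, y) = (phi / psi\<^sup>2, y omega / psi\<^sup>3)\<close>.\<close>

definition vx :: "'f poly" where "vx = [:0, 1:]"
definition df :: "'f poly" where "df = [:a4, 2 * a2, 3:]"
definition hf :: "'f poly" where "hf = [:a2, 3:]"
definition psi :: "'f poly" where "psi = 4 * f * hf - df\<^sup>2"
text \<open>\<open>4 y f4\<close> is the fourth division polynomial, and
  \<open>32 f\<^sup>2 f4 - psi\<^sup>3\<close> is the fifth. In these terms \<open>omega\<close> is
  the fifth minus \<open>4 f4\<^sup>2\<close>, and \<open>phi\<close> is the usual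
  \<open>x psi\<^sup>2\<close> minus the product of the second and the fourth.\<close>

definition f4 :: "'f poly" where "f4 = df * psi - 8 * f\<^sup>2"
definition omega :: "'f poly" where "omega = - (psi ^ 3 + 4 * f4 * (f4 - 8 * f\<^sup>2))"
definition phi :: "'f poly" where "phi = vx * psi\<^sup>2 - 8 * f * f4"

lemma f_expand:
  "f = vx ^ 3 + [:a2:] * vx\<^sup>2 + [:a4:] * vx + [:a6:]"
  "df = 3 * vx\<^sup>2 + 2 * [:a2:] * vx + [:a4:]"
  "hf = 3 * vx + [:a2:]"
  by (simp_all add: f_def df_def hf_def vx_def power2_eq_square power3_eq_cube numeral_poly)

text \<open>Divided by \<open>s ^ 6\<close>, this is the Taylor expansion of the cubic at
  \<open>x + u / s\<^sup>2\<close>; it keeps the coefficients of the curve out of the next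
  identity.\<close>

lemma taylor:
  "(vx * s\<^sup>2 + u) ^ 3 + [:a2:] * (vx * s\<^sup>2 + u)\<^sup>2 * s\<^sup>2 + [:a4:] * (vx * s\<^sup>2 + u) * s ^ 4 + [:a6:] * s ^ 6 =
   s ^ 6 * f + s ^ 4 * df * u + s\<^sup>2 * hf * u\<^sup>2 + u ^ 3"
  unfolding f_expand by Groebner_Basis.algebra

text \<open>After the Taylor expansion the only relation among \<open>f\<close>, \<open>df\<close>,
  \<open>hf\<close> and \<open>psi\<close> that enters is \<open>4 f hf = psi + df\<^sup>2\<close>,
  which keeps the identity small. It expresses, with denominators cleared, that
  \<open>3 (x, y)\<close> lies on the curve.\<close>

lemma triple_curve_eq:
  "omega\<^sup>2 * f = phi ^ 3 + [:a2:] * phi\<^sup>2 * psi\<^sup>2 + [:a4:] * phi * psi ^ 4 + [:a6:] * psi ^ 6"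
proof -
  have "phi = vx * psi\<^sup>2 + (- 8 * f * f4)" by (simp add: phi_def)
  hence "phi ^ 3 + [:a2:] * phi\<^sup>2 * psi\<^sup>2 + [:a4:] * phi * psi ^ 4 + [:a6:] * psi ^ 6 =
      psi ^ 6 * f + psi ^ 4 * df * (- 8 * f * f4) + psi\<^sup>2 * hf * (- 8 * f * f4)\<^sup>2 + (- 8 * f * f4) ^ 3"
    using taylor[of psi "- 8 * f * f4"] by (simp only:)
  also have "\<dots> = psi ^ 6 * f - 8 * f * df * f4 * psi ^ 4 + 16 * f * f4\<^sup>2 * psi\<^sup>2 * (4 * f * hf)
      - 512 * f ^ 3 * f4 ^ 3"
    by Groebner_Basis.algebra
  also have "4 * f * hf = psi + df\<^sup>2" by (simp add: psi_def)
  also have "psi ^ 6 * f - 8 * f * df * f4 * psi ^ 4 + 16 * f * f4\<^sup>2 * psi\<^sup>2 * (psi + df\<^sup>2) - 512 * f ^ 3 * f4 ^ 3 = omega\<^sup>2 * f"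
    unfolding omega_def f4_def by Groebner_Basis.algebra
  finally show ?thesis ..
qed

lemma has_lead_polys:
  "has_lead f 3 1" "has_lead df 2 3" "has_lead hf 1 3" "has_lead psi 4 3" "has_lead f4 6 1"
  "has_lead omega 12 1" "has_lead phi 9 1"
proof -
  show f: "has_lead f 3 1" by (simp add: has_lead_def f_def eval_nat_numeral)
  show df: "has_lead df 2 3" by (simp add: has_lead_def df_def eval_nat_numeral)
  show hf: "has_lead hf 1 3" by (simp add: has_lead_def hf_def)
  have vx: "has_lead vx 1 1" by (simp add: has_lead_def vx_def)
  have num: "has_lead (numeral k * p) n (numeral k * c)" if "has_lead p n c" for k n c and p :: "'f poly"
    using has_lead_mult[OF has_lead_numeral that, of k] by simp
  have "has_lead (4 * f * hf) 4 12" using has_lead_mult[OF num[OF f] hf, of "Num.Bit0 (Num.Bit0 Num.One)"] by simp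
  moreover have "has_lead (df\<^sup>2) 4 9" using has_lead_power[OF df, of 2] by simp
  ultimately show psi: "has_lead psi 4 3" unfolding psi_def using has_lead_diff by force
  have f2: "has_lead (8 * f\<^sup>2) 6 8"
    using num[OF has_lead_power[OF f, of 2], of "Num.Bit0 (Num.Bit0 (Num.Bit0 Num.One))"] by simp
  moreover have "has_lead (df * psi) 6 9" using has_lead_mult[OF df psi] by simp
  ultimately show f4: "has_lead f4 6 1" unfolding f4_def using has_lead_diff by force
  have "has_lead (f4 - 8 * f\<^sup>2) 6 (- 7)" using has_lead_diff[OF f4 f2] by simp
  hence "has_lead (4 * f4 * (f4 - 8 * f\<^sup>2)) 12 (- 28)"
    using has_lead_mult[OF num[OF f4], of _ _ _ "Num.Bit0 (Num.Bit0 Num.One)"] by force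
  moreover have "has_lead (psi ^ 3) 12 27" using has_lead_power[OF psi, of 3] by simp
  ultimately have "has_lead (psi ^ 3 + 4 * f4 * (f4 - 8 * f\<^sup>2)) 12 (27 + - 28)" by (rule has_lead_add[rotated])
  from has_lead_minus[OF this] show "has_lead omega 12 1" unfolding omega_def by simp
  have "has_lead (vx * psi\<^sup>2) 9 9" using has_lead_mult[OF vx has_lead_power[OF psi, of 2]] by simp
  moreover have "has_lead (8 * f * f4) 9 8"
    using has_lead_mult[OF num[OF f] f4, of "Num.Bit0 (Num.Bit0 (Num.Bit0 Num.One))"] by simp
  ultimately show "has_lead phi 9 1" unfolding phi_def using has_lead_diff by force
qed

text \<open>At a zero of \<open>psi\<close> the value of \<open>phi\<close> is
  \<open>64 f\<^sup>3\<close>, so \<open>f\<close> vanishes; then \<open>psi = - df\<^sup>2\<close>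
  makes \<open>x\<close> a double root.\<close>

lemma psi_phi_no_common_root:
  assumes "poly psi x = 0" "poly phi x = 0" shows False
proof -
  have e: "(8::'f) = 2 ^ 3" by simp
  have "8 * poly f x * (8 * (poly f x)\<^sup>2) = 0" using assms by (simp add: phi_def f4_def)
  hence f0: "poly f x = 0" using two unfolding e by (simp del: power_numeral)
  hence "poly df x = 0" using assms(1) by (simp add: psi_def)
  thus False using nonsingular[of x] f0
    by (simp add: f_def df_def algebra_simps power2_eq_square power3_eq_cube)
qed

lemma triple_point:
  assumes "on_curve E (Affine x y)"
  shows "ec_mult E 3 (Affine x y) = (if poly psi x = 0 then Infinity
    else Affine (poly phi x / (poly psi x)\<^sup>2) (y * poly omega x / poly psi x ^ 3))"
proof -
  define p D H where "p = poly psi x" and "D = poly df x" and "H = poly hf x"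
  have F: "poly f x = y\<^sup>2" using assms
    by (simp add: f_def algebra_simps power2_eq_square power3_eq_cube)
  have D: "D = 3 * x\<^sup>2 + 2 * a2 * x + a4" and H: "H = 3 * x + a2"
    by (auto simp: D_def H_def df_def hf_def algebra_simps power2_eq_square)
  have p: "p = 4 * y\<^sup>2 * H - D\<^sup>2" by (simp add: p_def psi_def F D_def H_def)
  have phi: "poly phi x = x * p\<^sup>2 - 8 * y\<^sup>2 * (D * p - 8 * y ^ 4)"
    by (simp add: phi_def f4_def F D_def p_def vx_def flip: power_mult)
  have om: "poly omega x = - (p ^ 3 + 4 * (D * p - 8 * y ^ 4) * (D * p - 16 * y ^ 4))"
    by (simp add: omega_def f4_def F D_def p_def flip: power_mult)
  show ?thesis
  proof (cases "y = 0")
    case True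
    \<comment> \<open>A point of ordinate 0 is its own triple, and here \<open>psi\<close> is
      \<open>- D\<^sup>2\<close>.\<close>
    have "D \<noteq> 0" using nonsingular[of x] assms True by (simp add: D)
    hence "p \<noteq> 0" using p True by simp
    thus ?thesis using True phi by (simp add: p_def[symmetric] eval_nat_numeral)
  next
    case False
    have y2: "2 * y \<noteq> 0" "y + y \<noteq> 0" using two False by (simp_all flip: mult_2)
    have four: "(4::'f) \<noteq> 0" using two by (metis mult_eq_0_iff num_double numeral_times_numeral)
    have eight: "(8::'f) \<noteq> 0" using two four by (metis mult_eq_0_iff num_double numeral_times_numeral)
    define l where "l = D / (2 * y)"
    define x2 where "x2 = l\<^sup>2 - a2 - x - x"
    define z2 where "z2 = - l * x2 - (y - l * x)"
    have dbl: "ec_add E (Affine x y) (Affine x y) = Affine x2 z2"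
      using y2 by (simp add: Let_def x2_def z2_def l_def D)
    have l: "l * (2 * y) = D" using y2 by (simp add: l_def)
    \<comment> \<open>This measures how far doubling moves the abscissa; the shift is 0 exactly for
      points of order 3.\<close>
    have "4 * y\<^sup>2 * (x2 - x) = - p"
    proof -
      have e: "x2 - x = l\<^sup>2 - H" by (simp add: x2_def H)
      have "4 * y\<^sup>2 * (x2 - x) = (l * (2 * y))\<^sup>2 - 4 * y\<^sup>2 * H" unfolding e by (simp add: algebra_simps power2_eq_square)
      thus ?thesis unfolding l p by simp
    qed
    hence x2: "x2 - x = - p / (4 * y\<^sup>2)" using False four by (simp add: field_simps)
    have z2: "z2 = - y - l * (x2 - x)" by (simp add: z2_def algebra_simps)
    show ?thesis
    proof (cases "p = 0")
      case True
      hence "x2 = x" using x2 by simp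
      hence "z2 = - y" using z2 by simp
      thus ?thesis using \<open>x2 = x\<close> True dbl by (simp add: p_def eval_nat_numeral)
    next
      case False
      note p0 = this
      have nx: "x2 \<noteq> x" using x2 False \<open>y \<noteq> 0\<close> four by auto
      define k where "k = (z2 - y) / (x2 - x)"
      have k: "k = 8 * y ^ 3 / p - l"
      proof -
        have d0: "x2 - x \<noteq> 0" using nx by simp
        have "2 * y / (x2 - x) = - (8 * y ^ 3 / p)"
          unfolding x2 using p0 \<open>y \<noteq> 0\<close> by (simp add: field_simps power2_eq_square power3_eq_cube)
        moreover have "k = - (2 * y) / (x2 - x) - l" unfolding k_def z2 using d0 by (simp add: field_simps)
        ultimately show ?thesis by simp
      qed
      define x3 where "x3 = k\<^sup>2 - a2 - x - x2"
      have tr: "ec_mult E 3 (Affine x y) = Affine x3 (- k * x3 - (y - k * x))"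
        using dbl nx by (simp add: eval_nat_numeral Let_def k_def x3_def)
      have lk: "D = 2 * y * l" using l by (simp add: mult.commute)
      \<comment> \<open>Writing the slope of the line through the point and its double as
        \<open>q - l\<close> lets \<open>x3 - x = k\<^sup>2 - l\<^sup>2\<close> factor, and
        \<open>q p\<close> is a polynomial.\<close>
      define q where "q = 8 * y ^ 3 / p"
      have qp: "q * p = 8 * y ^ 3" using p0 by (simp add: q_def)
      have "x3 - x = k\<^sup>2 - l\<^sup>2"
        by (simp add: x3_def x2_def)
      hence x3: "x3 - x = q * (q - 2 * l)" unfolding k q_def[symmetric] by (simp add: algebra_simps power2_eq_square)
      have "p\<^sup>2 * (x3 - x) = (q * p) * (q * p - 2 * l * p)" unfolding x3 by (simp add: algebra_simps power2_eq_square)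
      also have "\<dots> = - 8 * y\<^sup>2 * (D * p - 8 * y ^ 4)" unfolding qp lk by Groebner_Basis.algebra
      finally have px: "p\<^sup>2 * (x3 - x) = - 8 * y\<^sup>2 * (D * p - 8 * y ^ 4)" .
      hence "p\<^sup>2 * x3 = poly phi x" unfolding phi by (simp add: algebra_simps)
      hence 1: "x3 = poly phi x / p\<^sup>2" using p0 by (simp add: field_simps)
      have "p ^ 3 * (- k * x3 - (y - k * x)) = - (p ^ 3 * y) - (p * k) * (p\<^sup>2 * (x3 - x))"
        by (simp add: algebra_simps power2_eq_square power3_eq_cube)
      also have "p * k = 8 * y ^ 3 - l * p" unfolding k using p0 by (simp add: algebra_simps)
      also note px
      also have "- (p ^ 3 * y) - (8 * y ^ 3 - l * p) * (- 8 * y\<^sup>2 * (D * p - 8 * y ^ 4)) = y * poly omega x"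
        unfolding om lk by Groebner_Basis.algebra
      finally have "- k * x3 - (y - k * x) = y * poly omega x / p ^ 3" using p0 by (simp add: field_simps)
      thus ?thesis unfolding tr using 1 p0 by (simp add: p_def)
    qed
  qed
qed

end

section \<open>Completing the square and base change\<close>

definition sq_curve :: "'a::field weierstrass \<Rightarrow> 'a weierstrass" where
  "sq_curve E = Weierstrass 0 (wa2 E + (wa1 E / 2)\<^sup>2) 0
     (wa4 E + 2 * (wa1 E / 2) * (wa3 E / 2)) (wa6 E + (wa3 E / 2)\<^sup>2)"

fun sq_point :: "'a::field weierstrass \<Rightarrow> 'a ec_point \<Rightarrow> 'a ec_point" where
  "sq_point E Infinity = Infinity"
| "sq_point E (Affine x y) = Affine x (y + wa1 E / 2 * x + wa3 E / 2)"

lemma half_double: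
  fixes E :: "'a::field weierstrass"
  assumes "(2::'a) \<noteq> 0" obtains \<alpha> \<beta> where "wa1 E = 2 * \<alpha>" "wa3 E = 2 * \<beta>" "wa1 E / 2 = \<alpha>" "wa3 E / 2 = \<beta>"
  by (rule that[of "wa1 E / 2" "wa3 E / 2"]) (use assms in auto)

lemma on_curve_sq:
  fixes E :: "'a::field weierstrass"
  assumes two: "(2::'a) \<noteq> 0"
  shows "on_curve (sq_curve E) (sq_point E P) \<longleftrightarrow> on_curve E P"
proof (cases P)
  case (Affine x y)
  obtain \<alpha> \<beta> where *: "wa1 E = 2 * \<alpha>" "wa3 E = 2 * \<beta>" "wa1 E / 2 = \<alpha>" "wa3 E / 2 = \<beta>"
    using half_double[OF two] by blast
  have "(y + \<alpha> * x + \<beta>)\<^sup>2 - (x ^ 3 + (wa2 E + \<alpha>\<^sup>2) * x\<^sup>2 + (wa4 E + 2 * \<alpha> * \<beta>) * x + (wa6 E + \<beta>\<^sup>2)) =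
      (y\<^sup>2 + 2 * \<alpha> * x * y + 2 * \<beta> * y) - (x ^ 3 + wa2 E * x\<^sup>2 + wa4 E * x + wa6 E)"
    by Groebner_Basis.algebra
  hence "(y + \<alpha> * x + \<beta>)\<^sup>2 = x ^ 3 + (wa2 E + \<alpha>\<^sup>2) * x\<^sup>2 + (wa4 E + 2 * \<alpha> * \<beta>) * x + (wa6 E + \<beta>\<^sup>2) \<longleftrightarrow>
      y\<^sup>2 + 2 * \<alpha> * x * y + 2 * \<beta> * y = x ^ 3 + wa2 E * x\<^sup>2 + wa4 E * x + wa6 E"
    by (metis eq_iff_diff_eq_0)
  thus ?thesis unfolding Affine sq_curve_def sq_point.simps on_curve.simps weierstrass.sel *(3,4) unfolding *(1,2) by simp
qed simp

lemma wdisc_sq: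
  fixes E :: "'a::field weierstrass"
  assumes two: "(2::'a) \<noteq> 0" shows "wdisc (sq_curve E) = wdisc E"
proof -
  obtain \<alpha> \<beta> where *: "wa1 E = 2 * \<alpha>" "wa3 E = 2 * \<beta>" "wa1 E / 2 = \<alpha>" "wa3 E / 2 = \<beta>"
    using half_double[OF two] by blast
  show ?thesis unfolding sq_curve_def wdisc_cubic *(3,4)
    unfolding wdisc_def Let_def *(1,2) by Groebner_Basis.algebra
qed

text \<open>The change of ordinate adds \<open>wa1 E / 2\<close> to the slope of every chord and
  tangent. Lying on the curve matters in the tangent case: it gives \<open>z1 = z2\<close>, so the
  denominator \<open>2 z1\<close> is nonzero.\<close>

lemma sq_point_add:
  fixes E :: "'a::field weierstrass"
  assumes two: "(2::'a) \<noteq> 0" and PQ: "on_curve E P" "on_curve E Q"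
  shows "sq_point E (ec_add E P Q) = ec_add (sq_curve E) (sq_point E P) (sq_point E Q)"
proof (cases "P = Infinity \<or> Q = Infinity")
  case True
  thus ?thesis by (cases P; cases Q) auto
next
  case False
  then obtain x1 y1 x2 y2 where P: "P = Affine x1 y1" and Q: "Q = Affine x2 y2" by (cases P; cases Q) auto
  obtain \<alpha> \<beta> where *: "wa1 E = 2 * \<alpha>" "wa3 E = 2 * \<beta>" "wa1 E / 2 = \<alpha>" "wa3 E / 2 = \<beta>"
    using half_double[OF two] by blast
  define z1 z2 where "z1 = y1 + \<alpha> * x1 + \<beta>" and "z2 = y2 + \<alpha> * x2 + \<beta>"
  have s: "sq_point E P = Affine x1 z1" "sq_point E Q = Affine x2 z2" by (simp_all add: P Q z1_def z2_def *(3,4))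
  have third: "sq_point E (let x3 = l\<^sup>2 + wa1 E * l - wa2 E - x1 - x2;
       y3 = - (l + wa1 E) * x3 - (y1 - l * x1) - wa3 E in Affine x3 y3) =
     (let x3 = (l + \<alpha>)\<^sup>2 - (wa2 E + \<alpha>\<^sup>2) - x1 - x2; y3 = - (l + \<alpha>) * x3 - (z1 - (l + \<alpha>) * x1) in Affine x3 y3)" for l
  proof -
    have "l\<^sup>2 + 2 * \<alpha> * l - wa2 E - x1 - x2 = (l + \<alpha>)\<^sup>2 - (wa2 E + \<alpha>\<^sup>2) - x1 - x2"
      by Groebner_Basis.algebra
    moreover have "- (l + 2 * \<alpha>) * x3 - (y1 - l * x1) - 2 * \<beta> + \<alpha> * x3 + \<beta> = - (l + \<alpha>) * x3 - (z1 - (l + \<alpha>) * x1)" for x3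
      unfolding z1_def by Groebner_Basis.algebra
    ultimately show ?thesis by (simp only: Let_def sq_point.simps *(3,4)) (simp only: *(1,2) ec_point.inject)
  qed
  have add1: "ec_add E P Q = (let x3 = l\<^sup>2 + wa1 E * l - wa2 E - x1 - x2;
       y3 = - (l + wa1 E) * x3 - (y1 - l * x1) - wa3 E in Affine x3 y3)"
    if "\<not> (x1 = x2 \<and> y1 + y2 + wa1 E * x2 + wa3 E = 0)"
      "l = (if x1 \<noteq> x2 then (y2 - y1) / (x2 - x1)
            else (3 * x1\<^sup>2 + 2 * wa2 E * x1 + wa4 E - wa1 E * y1) / (2 * y1 + wa1 E * x1 + wa3 E))" for l
    unfolding P Q ec_add.simps if_not_P[OF that(1)] that(2)[symmetric] unfolding Let_def ..
  have add2: "ec_add (sq_curve E) (Affine x1 z1) (Affine x2 z2) = (let x3 = l\<^sup>2 - (wa2 E + \<alpha>\<^sup>2) - x1 - x2;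
       y3 = - l * x3 - (z1 - l * x1) in Affine x3 y3)"
    if "\<not> (x1 = x2 \<and> z1 + z2 = 0)"
      "l = (if x1 \<noteq> x2 then (z2 - z1) / (x2 - x1)
            else (3 * x1\<^sup>2 + 2 * (wa2 E + \<alpha>\<^sup>2) * x1 + (wa4 E + 2 * \<alpha> * \<beta>)) / (2 * z1))" for l
  proof -
    have "\<not> (x1 = x2 \<and> z1 + z2 + 0 * x2 + 0 = 0)" using that(1) by simp
    note n = if_not_P[OF this]
    have l: "(if x1 \<noteq> x2 then (z2 - z1) / (x2 - x1)
            else (3 * x1\<^sup>2 + 2 * (wa2 E + \<alpha>\<^sup>2) * x1 + (wa4 E + 2 * \<alpha> * \<beta>) - 0 * z1) / (2 * z1 + 0 * x1 + 0)) = l"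
      using that(2) by simp
    show ?thesis unfolding sq_curve_def ec_add.simps weierstrass.sel *(3,4) n l Let_def by simp
  qed
  show ?thesis
  proof (cases "x1 = x2")
    case False
    have x0: "x2 - x1 \<noteq> 0" using False by simp
    have sl: "(y2 - y1) / (x2 - x1) + \<alpha> = (z2 - z1) / (x2 - x1)"
    proof -
      have "z2 - z1 = (y2 - y1) + \<alpha> * (x2 - x1)" by (simp add: z1_def z2_def algebra_simps)
      thus ?thesis using x0 by (simp add: add_divide_distrib)
    qed
    show ?thesis unfolding s
      by (subst add1[OF _ refl], use False in simp, subst add2[OF _ refl], use False in simp)
        (simp only: False if_True not_False_eq_True third sl)
  next
    case True
    have c: "y1 + y2 + wa1 E * x2 + wa3 E = z1 + z2" unfolding z1_def z2_def True *(1,2) by (simp add: algebra_simps)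
    have d: "2 * y1 + wa1 E * x1 + wa3 E = 2 * z1" unfolding z1_def *(1,2) by (simp add: algebra_simps)
    show ?thesis
    proof (cases "z1 + z2 = 0")
      case z: True
      thus ?thesis unfolding s unfolding P Q using True c by (simp add: sq_curve_def)
    next
      case z: False
      define n where "n = 3 * x1\<^sup>2 + 2 * wa2 E * x1 + wa4 E - wa1 E * y1"
      have n: "3 * x1\<^sup>2 + 2 * (wa2 E + \<alpha>\<^sup>2) * x1 + (wa4 E + 2 * \<alpha> * \<beta>) = n + \<alpha> * (2 * z1)"
        unfolding n_def z1_def *(1) by Groebner_Basis.algebra
      have "on_curve (sq_curve E) (Affine x1 z1)" "on_curve (sq_curve E) (Affine x2 z2)"
        using PQ on_curve_sq[OF two, of E] s by metis+
      hence "z1\<^sup>2 = z2\<^sup>2" using True by (simp add: sq_curve_def)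
      hence "(z1 - z2) * (z1 + z2) = 0" by (simp add: power2_eq_square algebra_simps)
      hence "z1 = z2" using z by simp
      hence z0: "z1 \<noteq> 0" using z by auto
      have sl: "n / (2 * z1) + \<alpha> = (n + \<alpha> * (2 * z1)) / (2 * z1)" using two z0 by (simp add: add_divide_distrib)
      have n1: "\<not> (x1 = x2 \<and> y1 + y2 + wa1 E * x2 + wa3 E = 0)" and n2: "\<not> (x1 = x2 \<and> z1 + z2 = 0)"
        using z c by auto
      have "ec_add E P Q = (let x3 = (n / (2 * z1))\<^sup>2 + wa1 E * (n / (2 * z1)) - wa2 E - x1 - x2;
         y3 = - (n / (2 * z1) + wa1 E) * x3 - (y1 - (n / (2 * z1)) * x1) - wa3 E in Affine x3 y3)"
        by (rule add1[OF n1]) (simp only: True n_def d[unfolded True] not_True_eq_False if_False simp_thms)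
      moreover have "ec_add (sq_curve E) (Affine x1 z1) (Affine x2 z2) =
          (let x3 = (n / (2 * z1) + \<alpha>)\<^sup>2 - (wa2 E + \<alpha>\<^sup>2) - x1 - x2;
           y3 = - (n / (2 * z1) + \<alpha>) * x3 - (z1 - (n / (2 * z1) + \<alpha>) * x1) in Affine x3 y3)"
        by (rule add2[OF n2]) (simp only: sl n[unfolded True] True not_True_eq_False if_False simp_thms)
      ultimately show ?thesis unfolding s by (simp only: third)
    qed
  qed
qed

text \<open>Membership is part of the induction: closure under addition is known for the model with
  \<open>wa1 = wa3 = 0\<close> and is pulled back along \<open>sq_point\<close>.\<close>

lemma sq_point_mult:
  fixes E :: "'a::field weierstrass"
  assumes two: "(2::'a) \<noteq> 0" and ell: "elliptic_curve E" and P: "on_curve E P"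
  shows "sq_point E (ec_mult E n P) = ec_mult (sq_curve E) n (sq_point E P)
    \<and> on_curve E (ec_mult E n P)"
proof (induction n)
  case (Suc n)
  interpret C: cubic_curve "wa2 E + (wa1 E / 2)\<^sup>2" "wa4 E + 2 * (wa1 E / 2) * (wa3 E / 2)" "wa6 E + (wa3 E / 2)\<^sup>2"
    using cubic_curveI[OF two] ell wdisc_sq[OF two, of E] unfolding elliptic_curve_def sq_curve_def by metis
  have 1: "sq_point E (ec_add E P (ec_mult E n P)) = ec_add (sq_curve E) (sq_point E P) (ec_mult (sq_curve E) n (sq_point E P))"
    using sq_point_add[OF two P] Suc by metis
  have "on_curve (sq_curve E) (ec_add (sq_curve E) (sq_point E P) (ec_mult (sq_curve E) n (sq_point E P)))"
    using C.on_curve_add[folded sq_curve_def] Suc P on_curve_sq[OF two, of E] by metis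
  hence "on_curve E (ec_add E P (ec_mult E n P))" using 1 on_curve_sq[OF two, of E] by metis
  thus ?case using 1 by simp
qed simp

lemma sq_point_eq_Infinity [simp]: "sq_point E P = Infinity \<longleftrightarrow> P = Infinity"
  by (cases P) auto

lemma sq_point_surj: obtains P where "sq_point E P = Q"
proof (cases Q)
  case (Affine x y)
  thus ?thesis by (intro that[of "Affine x (y - wa1 E / 2 * x - wa3 E / 2)"]) simp
qed (use that[of Infinity] in simp)

locale field_hom = ring_embedding h for h :: "'a::field \<Rightarrow> 'b::field"
begin

lemma hom_divide: "h (a / b) = h a / h b"
proof (cases "b = 0")
  case False
  have "h (a / b) * h b = h a" using False by (simp flip: hom_mult)
  thus ?thesis using False by (simp add: field_simps hom_eq_0_iff)
qed (simp add: hom_zero)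

lemmas hom_simps = hom_simps hom_divide

lemma map_weierstrass_sel [simp]:
  "wa1 (map_weierstrass h E) = h (wa1 E)" "wa2 (map_weierstrass h E) = h (wa2 E)"
  "wa3 (map_weierstrass h E) = h (wa3 E)" "wa4 (map_weierstrass h E) = h (wa4 E)"
  "wa6 (map_weierstrass h E) = h (wa6 E)"
  by (simp_all add: weierstrass.map_sel)

lemma on_curve_map: "on_curve (map_weierstrass h E) (map_ec_point h P) \<longleftrightarrow> on_curve E P"
proof (cases P)
  case (Affine x y)
  show ?thesis unfolding Affine by (simp flip: hom_simps(1-8)) (simp only: hom_eq_iff)
qed simp

lemma map_ec_add: "map_ec_point h (ec_add E P Q) = ec_add (map_weierstrass h E) (map_ec_point h P) (map_ec_point h Q)"
proof (cases "P = Infinity \<or> Q = Infinity")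
  case True
  thus ?thesis by (cases P; cases Q) auto
next
  case False
  then obtain x1 y1 x2 y2 where P: "P = Affine x1 y1" and Q: "Q = Affine x2 y2" by (cases P; cases Q) auto
  have c: "h y1 + h y2 + h (wa1 E) * h x2 + h (wa3 E) = 0 \<longleftrightarrow> y1 + y2 + wa1 E * x2 + wa3 E = 0"
    using hom_eq_0_iff[of "y1 + y2 + wa1 E * x2 + wa3 E"] by (simp only: hom_add hom_mult)
  show ?thesis unfolding P Q
    by (simp add: Let_def c hom_eq_iff) (auto simp: hom_simps)
qed

lemma map_ec_mult: "map_ec_point h (ec_mult E n P) = ec_mult (map_weierstrass h E) n (map_ec_point h P)"
  by (induction n) (auto simp: map_ec_add)

lemma map_ec_point_eq_iff: "map_ec_point h P = map_ec_point h Q \<longleftrightarrow> P = Q"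
  by (cases P; cases Q) (auto simp: hom_eq_iff)

lemma map_sq_curve: "map_weierstrass h (sq_curve E) = sq_curve (map_weierstrass h E)"
  unfolding sq_curve_def weierstrass.map map_weierstrass_sel hom_simps ..

lemma map_sq_point: "map_ec_point h (sq_point E P) = sq_point (map_weierstrass h E) (map_ec_point h P)"
  by (cases P) (auto simp: hom_simps)

lemma wdisc_map: "wdisc (map_weierstrass h E) = h (wdisc E)"
  by (simp add: wdisc_def Let_def hom_simps)

lemma cubic_curve_map:
  assumes "cubic_curve a2 a4 a6" "elliptic_curve (Weierstrass 0 a2 0 a4 a6)"
  shows "cubic_curve (h a2) (h a4) (h a6)"
proof (rule cubic_curveI)
  have "(2::'a) \<noteq> 0" using assms(1) by (simp add: cubic_curve_def)
  thus "(2::'b) \<noteq> 0" using hom_numeral[of "Num.Bit0 Num.One"] hom_eq_0_iff[of 2] by simp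
  show "elliptic_curve (Weierstrass 0 (h a2) 0 (h a4) (h a6))"
    using assms(2) wdisc_map[of "Weierstrass 0 a2 0 a4 a6"] by (simp add: elliptic_curve_def hom_eq_0_iff hom_zero)
qed

lemma cubic_polys_map:
  assumes "cubic_curve a2 a4 a6" "cubic_curve (h a2) (h a4) (h a6)"
  shows "cubic_curve.f (h a2) (h a4) (h a6) = map_poly h (cubic_curve.f a2 a4 a6)"
    and "cubic_curve.df (h a2) (h a4) = map_poly h (cubic_curve.df a2 a4)"
    and "cubic_curve.psi (h a2) (h a4) (h a6) = map_poly h (cubic_curve.psi a2 a4 a6)"
    and "cubic_curve.omega (h a2) (h a4) (h a6) = map_poly h (cubic_curve.omega a2 a4 a6)"
    and "cubic_curve.phi (h a2) (h a4) (h a6) = map_poly h (cubic_curve.phi a2 a4 a6)"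
proof -
  interpret A: cubic_curve a2 a4 a6 by fact
  interpret B: cubic_curve "h a2" "h a4" "h a6" by fact
  show f: "B.f = map_poly h A.f" by (simp add: A.f_def B.f_def map_pCons hom_one map_poly_simps)
  show df: "B.df = map_poly h A.df" by (simp add: A.df_def B.df_def map_pCons hom_simps map_poly_simps)
  have hf: "B.hf = map_poly h A.hf" by (simp add: A.hf_def B.hf_def map_pCons hom_simps map_poly_simps)
  have vx: "B.vx = map_poly h A.vx" by (simp add: A.vx_def B.vx_def map_pCons hom_simps map_poly_simps)
  show psi: "B.psi = map_poly h A.psi" by (simp add: A.psi_def B.psi_def f df hf map_poly_simps)
  have f4: "B.f4 = map_poly h A.f4" by (simp add: A.f4_def B.f4_def f df psi map_poly_simps)
  show "B.omega = map_poly h A.omega" by (simp add: A.omega_def B.omega_def f f4 psi map_poly_simps)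
  show "B.phi = map_poly h A.phi" by (simp add: A.phi_def B.phi_def f f4 psi vx map_poly_simps)
qed

end

lemma field_hom_to_ac: "field_hom to_ac"
  unfolding field_hom_def by (rule ring_embedding_to_ac)

lemma field_hom_if_field_embedding:
  assumes "field_embedding \<iota>" shows "field_hom \<iota>"
proof
  show 1: "\<iota> 1 = 1" and "\<iota> (a + b) = \<iota> a + \<iota> b" and 2: "\<iota> (a * b) = \<iota> a * \<iota> b" for a b
    using assms by (auto simp: field_embedding_def)
  fix a assume a: "\<iota> a = 0"
  show "a = 0"
  proof (rule ccontr)
    assume "a \<noteq> 0"
    hence "\<iota> 1 = \<iota> a * \<iota> (inverse a)" by (simp flip: 2)
    thus False using a 1 by simp
  qed
qed

section \<open>Proper factors from roots of small degree\<close>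

lemma annihilating_poly_of_small_degree:
  fixes \<iota> :: "'k::field \<Rightarrow> 'l::field" and z :: 'l
  assumes fin: "finite_extension \<iota>" and deg: "extension_degree \<iota> < n"
  obtains p where "p \<noteq> 0" "degree p < n" "poly (map_poly \<iota> p) z = 0"
proof -
  interpret h: field_hom \<iota> using fin by (auto simp: finite_extension_def intro: field_hom_if_field_embedding)
  interpret V: vector_space "\<lambda>c z. \<iota> c * z"
    by unfold_locales (auto simp: h.hom_simps algebra_simps)
  obtain T where T: "finite T" "V.span T = UNIV" using fin by (auto simp: finite_extension_def)
  obtain B where B: "V.independent B" "UNIV \<subseteq> V.span B" "card B = V.dim UNIV"
    using V.basis_exists[of UNIV] by metis
  have fB: "finite B" using V.independent_span_bound[OF T(1) B(1)] T(2) by simp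
  have pz: "poly (map_poly \<iota> p) z = (\<Sum>i<n. \<iota> (coeff p i) * z ^ i)" if "degree p < n" for p
  proof -
    have "poly (map_poly \<iota> p) z = (\<Sum>i\<le>degree p. \<iota> (coeff p i) * z ^ i)"
      by (simp add: poly_altdef h.degree_map h.coeff_map)
    also have "\<dots> = (\<Sum>i<n. \<iota> (coeff p i) * z ^ i)"
      by (rule sum.mono_neutral_left) (use that in \<open>auto simp: coeff_eq_0 h.hom_simps\<close>)
    finally show ?thesis .
  qed
  have "\<exists>u. (\<exists>i<n. u i \<noteq> 0) \<and> (\<Sum>i<n. \<iota> (u i) * z ^ i) = 0"
  \<comment> \<open>Linear dependence concerns the set of powers; if two powers coincide, their
    difference is the relation.\<close>
  proof (cases "inj_on (\<lambda>i. z ^ i) {..<n}")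
    case False
    then obtain i j where ij: "i < n" "j < n" "i \<noteq> j" "z ^ i = z ^ j" by (auto simp: inj_on_def)
    define u where "u k = (if k = i then 1 else if k = j then -1 else 0 :: 'k)" for k
    have "(\<Sum>k<n. \<iota> (u k) * z ^ k) = (\<Sum>k\<in>{i, j}. \<iota> (u k) * z ^ k)"
      by (rule sum.mono_neutral_right) (use ij in \<open>auto simp: u_def h.hom_simps\<close>)
    also have "\<dots> = 0" using ij by (simp add: u_def h.hom_simps)
    finally show ?thesis using ij(1) by (intro exI[of _ u]) (auto simp: u_def)
  next
    case True
    define S where "S = (\<lambda>i. z ^ i) ` {..<n}"
    have "card S = n" using True by (simp add: S_def card_image)
    hence "V.dependent S" using V.independent_span_bound[OF fB, of S] B(2,3) deg
      unfolding extension_degree_def by auto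
    then obtain u where u: "\<exists>v\<in>S. u v \<noteq> 0" "(\<Sum>v\<in>S. \<iota> (u v) * v) = 0"
      using V.dependent_finite[of S] by (auto simp: S_def)
    have "(\<Sum>i<n. \<iota> (u (z ^ i)) * z ^ i) = 0"
      using u(2) unfolding S_def by (subst (asm) sum.reindex[OF True]) simp
    thus ?thesis using u(1) by (intro exI[of _ "\<lambda>i. u (z ^ i)"]) (auto simp: S_def)
  qed
  then obtain u i where u: "i < n" "u i \<noteq> 0" "(\<Sum>i<n. \<iota> (u i) * z ^ i) = 0" by auto
  define p where "p = (\<Sum>i<n. monom (u i) i)"
  have c: "coeff p j = (if j < n then u j else 0)" for j
    by (simp add: p_def coeff_sum if_distrib cong: if_cong)
  have "degree p < n" using c u(1) by (intro degree_lessI) auto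
  moreover have "p \<noteq> 0" using c[of i] u by auto
  moreover have "poly (map_poly \<iota> p) z = 0" using pz[OF \<open>degree p < n\<close>] u(3) by (simp add: c)
  ultimately show ?thesis using that by blast
qed

text \<open>A polynomial of least degree annihilating \<open>z\<close> divides \<open>g\<close> and
  has degree below \<open>n\<close>; it or its cofactor has degree at most half of
  \<open>n\<close>.\<close>

lemma proper_factor:
  fixes \<iota> :: "'k::field \<Rightarrow> 'l::field"
  assumes fin: "finite_extension \<iota>" and deg: "extension_degree \<iota> < n"
    and g: "degree g = n" and z: "poly (map_poly \<iota> g) z = 0"
  obtains h where "h dvd g" "lead_coeff h = 1" "0 < degree h" "2 * degree h \<le> n"
proof -
  interpret h: field_hom \<iota> using fin by (auto simp: finite_extension_def intro: field_hom_if_field_embedding)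
  have n0: "n > 0" using deg by simp
  have g0: "g \<noteq> 0" using g n0 by auto
  define I where "I = {p. p \<noteq> 0 \<and> poly (map_poly \<iota> p) z = 0}"
  obtain p0 where p0: "p0 \<in> I" "degree p0 < n"
    using annihilating_poly_of_small_degree[OF fin deg, of z] by (auto simp: I_def)
  obtain p where p: "p \<in> I" "\<And>e. e \<in> I \<Longrightarrow> degree p \<le> degree e"
    using ex_has_least_nat[of "\<lambda>d. d \<in> I" p0 degree] p0 by auto
  have pn: "degree p < n" and pz: "p \<noteq> 0" "poly (map_poly \<iota> p) z = 0" using p p0 by (force, auto simp: I_def)
  have pd: "degree p > 0"
  proof (rule ccontr)
    assume "\<not> degree p > 0"
    then obtain c where "p = [:c:]" by (auto elim: degree_eq_zeroE)
    thus False using pz by (simp add: h.map_pCons h.hom_simps h.map_poly_simps)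
  qed
  have "g mod p = g - g div p * p" by (simp add: minus_div_mult_eq_mod)
  hence "poly (map_poly \<iota> (g mod p)) z = 0" using z pz by (simp add: h.map_poly_simps)
  hence "g mod p = 0" using p(2)[of "g mod p"] degree_mod_less[OF pz(1), of g] by (force simp: I_def)
  then obtain q where q: "g = p * q" using mod_0_imp_dvd by blast
  have q0: "q \<noteq> 0" using q g0 by auto
  have dg: "degree p + degree q = n" using q pz q0 g by (simp add: degree_mult_eq)
  have *: "\<exists>h. h dvd g \<and> lead_coeff h = 1 \<and> degree h = degree r" if "r dvd g" "r \<noteq> 0" for r
    using that by (intro exI[of _ "smult (inverse (lead_coeff r)) r"]) (auto simp: smult_dvd_iff)
  show ?thesis
  proof (cases "2 * degree p \<le> n")
    case True
    thus ?thesis using *[of p] q pz pd that by fastforce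
  next
    case False
    thus ?thesis using *[of q] q q0 dg pn that by fastforce
  qed
qed

text \<open>Multiplication by 3 serves as the isogeny, with \<open>phi\<close>, \<open>psi\<close>,
  \<open>omega\<close> as the polynomials \<open>F\<close>, \<open>D\<close>, \<open>N\<close>; its
  source is the completed square model. Characteristic different from 3 keeps the degree of
  \<open>psi\<close> at 4.\<close>

lemma tripled_magnified:
  fixes E :: "'k::field weierstrass"
  assumes two: "(2::'k) \<noteq> 0" and three: "(3::'k) \<noteq> 0" and ell: "elliptic_curve E"
    and Q: "on_curve (sq_curve E) Q" and trip: "ec_mult (sq_curve E) 3 Q = sq_point E P" and P: "P \<noteq> Infinity"
  shows "K_magnified E P"
proof -
  define a2 a4 a6 where "a2 = wa2 E + (wa1 E / 2)\<^sup>2" and "a4 = wa4 E + 2 * (wa1 E / 2) * (wa3 E / 2)"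
    and "a6 = wa6 E + (wa3 E / 2)\<^sup>2"
  have sq: "sq_curve E = Weierstrass 0 a2 0 a4 a6" by (simp add: sq_curve_def a2_def a4_def a6_def)
  have ell': "elliptic_curve (Weierstrass 0 a2 0 a4 a6)"
    using ell wdisc_sq[OF two, of E] by (simp add: elliptic_curve_def sq)
  interpret C: cubic_curve a2 a4 a6 by (rule cubic_curveI[OF two ell'])
  interpret ac: field_hom "to_ac :: 'k \<Rightarrow> _" by (rule field_hom_to_ac)
  interpret A: cubic_curve "to_ac a2" "to_ac a4" "to_ac a6"
    by (rule ac.cubic_curve_map[OF C.cubic_curve_axioms ell'])
  note map = ac.cubic_polys_map[OF C.cubic_curve_axioms A.cubic_curve_axioms]
  obtain xP yP where P': "P = Affine xP yP" using P by (cases P) auto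
  obtain x y where Q': "Q = Affine x y" using trip P by (cases Q) (auto simp: P' eval_nat_numeral)
  have t: "poly C.psi x \<noteq> 0" "poly C.phi x / (poly C.psi x)\<^sup>2 = xP"
    "y * poly C.omega x / poly C.psi x ^ 3 = yP + wa1 E / 2 * xP + wa3 E / 2"
    using C.triple_point[of x y] Q trip unfolding sq Q' P' by (auto split: if_splits)
  have deg: "degree C.psi = 4" "degree C.phi = 9" "degree C.omega = 12"
    using has_lead_degree C.has_lead_polys three by (metis, metis zero_neq_one, metis zero_neq_one)
  have cop: "coprime_polys C.phi C.psi"
    by (rule coprime_polys_if_no_common_root) (use deg A.psi_phi_no_common_root in \<open>auto simp: map\<close>)
  have eq: "C.omega\<^sup>2 * [:a6, a4, a2, 1:] = C.phi ^ 3 + [:wa2 E + (wa1 E / 2)\<^sup>2:] * C.phi\<^sup>2 * C.psi\<^sup>2 +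
      [:wa4 E + 2 * (wa1 E / 2) * (wa3 E / 2):] * C.phi * C.psi ^ 4 + [:wa6 E + (wa3 E / 2)\<^sup>2:] * C.psi ^ 6"
    using C.triple_curve_eq unfolding C.f_def a2_def[symmetric] a4_def[symmetric] a6_def[symmetric] .
  have "y\<^sup>2 = x ^ 3 + a2 * x\<^sup>2 + a4 * x + a6" using Q by (simp add: Q' sq)
  moreover have "poly C.phi x = xP * (poly C.psi x)\<^sup>2"
    unfolding t(2)[symmetric] using t(1) by simp
  moreover have "y * poly C.omega x = (yP + wa1 E / 2 * xP + wa3 E / 2) * poly C.psi x ^ 3"
    unfolding t(3)[symmetric] using t(1) by simp
  ultimately show ?thesis unfolding P' using t(1) deg
    by (intro ff_even.K_magnifiedI[OF two ell ell' _ _ _ cop eq]) auto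
qed

section \<open>The dual of a 3-isogeny\<close>

context cubic_curve
begin

lemma poly_taylor:
  "poly f (x + u) = poly f x + poly df x * u + poly hf x * u\<^sup>2 + u ^ 3"
  "poly df (x + u) = poly df x + 2 * poly hf x * u + 3 * u\<^sup>2"
  "poly hf (x + u) = poly hf x + 3 * u"
proof -
  have e: "poly f z = z ^ 3 + a2 * z\<^sup>2 + a4 * z + a6" "poly df z = 3 * z\<^sup>2 + 2 * a2 * z + a4" "poly hf z = 3 * z + a2" for z
    by (simp_all add: f_def df_def hf_def algebra_simps power2_eq_square power3_eq_cube)
  show "poly f (x + u) = poly f x + poly df x * u + poly hf x * u\<^sup>2 + u ^ 3"
    "poly df (x + u) = poly df x + 2 * poly hf x * u + 3 * u\<^sup>2"
    "poly hf (x + u) = poly hf x + 3 * u"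
    unfolding e by Groebner_Basis.algebra+
qed

text \<open>Around the abscissa \<open>x0\<close> of a 3-torsion point the cubic is \<open>u\<^sup>3 + w (3 n u + 1)\<^sup>2\<close>.\<close>

lemma three_torsion_normal_form:
  assumes three: "(3::'f) \<noteq> 0" and x0: "poly psi x0 = 0"
  obtains w n where "w \<noteq> 0" "poly f x0 = w" "poly df x0 = 6 * w * n" "poly hf x0 = 9 * w * n\<^sup>2"
    "4 * n ^ 3 * w \<noteq> 1"
proof -
  define w f1 f2 where "w = poly f x0" and "f1 = poly df x0" and "f2 = poly hf x0"
  have p: "4 * w * f2 = f1\<^sup>2" using x0 by (simp add: psi_def w_def f1_def f2_def)
  have w0: "w \<noteq> 0"
  proof
    assume w: "w = 0"
    hence "f1 = 0" using p by simp
    thus False using w nonsingular[of x0]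
      by (simp add: w_def f1_def f_def df_def algebra_simps power2_eq_square power3_eq_cube)
  qed
  \<comment> \<open>This \<open>n\<close> makes \<open>w + f1 u + f2 u\<^sup>2\<close> the square
    \<open>w (3 n u + 1)\<^sup>2\<close>; its discriminant vanishes because
    \<open>4 w f2 = f1\<^sup>2\<close>.\<close>
  define n where "n = f1 / (6 * w)"
  have "(6::'f) = 2 * 3" "(4::'f) = 2 * 2" by simp_all
  hence six: "(6::'f) \<noteq> 0" and four: "(4::'f) \<noteq> 0" using two three by (metis mult_eq_0_iff)+
  have f1: "f1 = 6 * w * n" using w0 six by (simp add: n_def)
  have "(4 * w) * f2 = (4 * w) * (9 * w * n\<^sup>2)" unfolding p f1 by Groebner_Basis.algebra
  moreover have "4 * w \<noteq> 0" using w0 four by simp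
  ultimately have f2: "f2 = 9 * w * n\<^sup>2" by (metis mult_left_cancel)
  have "4 * n ^ 3 * w \<noteq> 1"
  proof
    assume c: "4 * n ^ 3 * w = 1"
    hence n0: "n \<noteq> 0" by auto
    \<comment> \<open>If \<open>4 n\<^sup>3 w = 1\<close>, the normal form has a double root at
      \<open>- 1 / n\<close>.\<close>
    define u where "u = - (1 / n)"
    have un: "n * u = - 1" using n0 by (simp add: u_def)
    have "n ^ 3 * poly f (x0 + u) = n ^ 3 * w * (3 * (n * u) + 1)\<^sup>2 + (n * u) ^ 3"
      unfolding poly_taylor unfolding w_def[symmetric] f1_def[symmetric] f2_def[symmetric] f1 f2 by Groebner_Basis.algebra
    hence "n ^ 3 * poly f (x0 + u) = 0" unfolding un using c by (simp add: algebra_simps)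
    moreover have "n\<^sup>2 * poly df (x0 + u) = 6 * (n ^ 3 * w) * (3 * (n * u) + 1) + 3 * (n * u)\<^sup>2"
      unfolding poly_taylor unfolding w_def[symmetric] f1_def[symmetric] f2_def[symmetric] f1 f2 by Groebner_Basis.algebra
    hence "n\<^sup>2 * poly df (x0 + u) = 3 - 3 * (4 * n ^ 3 * w)" unfolding un by (simp add: algebra_simps)
    ultimately have "poly f (x0 + u) = 0" "poly df (x0 + u) = 0" using n0 c by auto
    thus False using nonsingular[of "x0 + u"]
      by (simp add: f_def df_def algebra_simps power2_eq_square power3_eq_cube)
  qed
  from that[OF w0 w_def[symmetric] f1[unfolded f1_def] f2[unfolded f2_def] this] show ?thesis .
qed

text \<open>\<open>3 z\<close> is \<open>psi\<close> with the zero \<open>x0\<close> split off, and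
  \<open>z / u\<^sup>2\<close> is the abscissa on the quotient by the subgroup over
  \<open>x0\<close>. Divided by \<open>u ^ 6\<close>, the polynomials \<open>phi\<close>,
  \<open>psi\<^sup>2\<close> and the last factor of \<open>omega\<close> depend on
  \<open>z / u\<^sup>2\<close> alone: tripling is the quotient map followed by its dual. The first
  factor of \<open>omega\<close> belongs to the ordinate of the quotient map.\<close>

lemma psi_phi_omega_near_three_torsion:
  fixes u w n :: 'f
  assumes w: "poly f x0 = w" "poly df x0 = 6 * w * n" "poly hf x0 = 9 * w * n\<^sup>2"
  defines "z \<equiv> u ^ 3 + 12 * w * n\<^sup>2 * u\<^sup>2 + 12 * w * n * u + 4 * w" and "c \<equiv> 1 - 4 * n ^ 3 * w"
  shows "poly psi (x0 + u) = 3 * u * z"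
    and "poly phi (x0 + u) = x0 * (9 * u\<^sup>2 * z\<^sup>2) + (z ^ 3 - 36 * w * n\<^sup>2 * u\<^sup>2 * z\<^sup>2 - 108 * w * n * c * u ^ 4 * z - 108 * w * c\<^sup>2 * u ^ 6)"
    and "poly omega (x0 + u) = (u ^ 3 - 12 * w * n * u - 8 * w) * (z ^ 3 + 108 * w * n * c * u ^ 4 * z + 216 * w * c\<^sup>2 * u ^ 6)"
proof -
  note t = poly_taylor[of x0 u, unfolded w]
  show p: "poly psi (x0 + u) = 3 * u * z"
    unfolding psi_def poly_diff poly_mult poly_power poly_numeral t z_def by Groebner_Basis.algebra
  show "poly phi (x0 + u) = x0 * (9 * u\<^sup>2 * z\<^sup>2) + (z ^ 3 - 36 * w * n\<^sup>2 * u\<^sup>2 * z\<^sup>2 - 108 * w * n * c * u ^ 4 * z - 108 * w * c\<^sup>2 * u ^ 6)"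
    unfolding phi_def f4_def poly_diff poly_mult poly_power poly_numeral p t unfolding vx_def z_def c_def
    by (simp only: poly_pCons poly_0) Groebner_Basis.algebra
  show "poly omega (x0 + u) = (u ^ 3 - 12 * w * n * u - 8 * w) * (z ^ 3 + 108 * w * n * c * u ^ 4 * z + 216 * w * c\<^sup>2 * u ^ 6)"
    unfolding omega_def f4_def poly_diff poly_add poly_minus poly_mult poly_power poly_numeral p t unfolding z_def c_def
    by Groebner_Basis.algebra
qed

end

text \<open>The quotient curve is \<open>s\<^sup>2 = t\<^sup>3 - 27 w (n t + c)\<^sup>2\<close>, and
  the dual isogeny sends \<open>(t, s)\<close> to the abscissa \<open>F0 / (3 t)\<^sup>2\<close> of
  the normal form; the squared factor on the left comes from the ordinate.\<close>

lemma dual_three_isogeny_eq: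
  fixes t w n c :: "'a::idom"
  defines "F0 \<equiv> t ^ 3 - 36 * w * n\<^sup>2 * t\<^sup>2 - 108 * w * n * c * t - 108 * w * c\<^sup>2"
  assumes c: "c = 1 - 4 * n ^ 3 * w"
  shows "(t ^ 3 + 108 * w * n * c * t + 216 * w * c\<^sup>2)\<^sup>2 * (t ^ 3 - 27 * w * (n * t + c)\<^sup>2) =
    F0 ^ 3 + 9 * w * n\<^sup>2 * F0\<^sup>2 * (3 * t)\<^sup>2 + 6 * w * n * F0 * (3 * t) ^ 4 + w * (3 * t) ^ 6"
  unfolding F0_def c by Groebner_Basis.algebra

text \<open>The relation on \<open>u\<close> amounts to \<open>z = t u\<^sup>2\<close> with
  \<open>t = e + 12 w n\<^sup>2\<close> in \<open>K\<close>: the image in the quotient has a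
  rational abscissa. The ordinate \<open>s\<close> then needs no descent, being determined by the
  ordinate of \<open>P\<close> through \<open>s N0 = \<eta> (3 t)\<^sup>3\<close>.\<close>

lemma three_isogeny_magnified:
  fixes E :: "'k::field weierstrass"
  assumes two: "(2::'k) \<noteq> 0" and three: "(3::'k) \<noteq> 0" and ell: "elliptic_curve E"
    and sq: "sq_curve E = Weierstrass 0 a2 0 a4 a6"
    and C: "cubic_curve a2 a4 a6" and A: "cubic_curve (to_ac a2) (to_ac a4) (to_ac a6)"
    and P: "on_curve E (Affine xP yP)" and yP: "yP + wa1 E / 2 * xP + wa3 E / 2 \<noteq> 0"
    and x0: "poly (cubic_curve.psi a2 a4 a6) x0 = 0"
    and x: "poly (cubic_curve.phi (to_ac a2) (to_ac a4) (to_ac a6)) (to_ac x0 + u) =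
      to_ac xP * (poly (cubic_curve.psi (to_ac a2) (to_ac a4) (to_ac a6)) (to_ac x0 + u))\<^sup>2"
    and px: "poly (cubic_curve.psi (to_ac a2) (to_ac a4) (to_ac a6)) (to_ac x0 + u) \<noteq> 0"
    and u: "u ^ 3 - to_ac e * u\<^sup>2 + 2 * to_ac (poly (cubic_curve.df a2 a4) x0) * u +
      4 * to_ac (poly (cubic_curve.f a2 a4 a6) x0) = 0"
  shows "K_magnified E (Affine xP yP)"
proof -
  interpret C: cubic_curve a2 a4 a6 by fact
  interpret A: cubic_curve "to_ac a2" "to_ac a4" "to_ac a6" by fact
  interpret ac: field_hom "to_ac :: 'k \<Rightarrow> _" by (rule field_hom_to_ac)
  note map = ac.cubic_polys_map[OF C A]
  obtain w n where w0: "w \<noteq> 0" and w: "poly C.f x0 = w" "poly C.df x0 = 6 * w * n" "poly C.hf x0 = 9 * w * n\<^sup>2"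
    and c1: "4 * n ^ 3 * w \<noteq> 1" using C.three_torsion_normal_form[OF three x0] by blast
  define c where "c = 1 - 4 * n ^ 3 * w"
  have c0: "c \<noteq> 0" using c1 by (simp add: c_def)
  define t where "t = e + 12 * w * n\<^sup>2"
  define w' n' c' where "w' = to_ac w" and "n' = to_ac n" and "c' = to_ac c"
  have "A.hf = map_poly to_ac C.hf" by (simp add: A.hf_def C.hf_def ac.map_pCons ac.map_poly_simps)
  hence wA: "poly A.f (to_ac x0) = w'" "poly A.df (to_ac x0) = 6 * w' * n'" "poly A.hf (to_ac x0) = 9 * w' * n'\<^sup>2"
    by (simp_all add: map ac.poly_map w w'_def n'_def)
  define z where "z = u ^ 3 + 12 * w' * n'\<^sup>2 * u\<^sup>2 + 12 * w' * n' * u + 4 * w'"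
  have c': "1 - 4 * n' ^ 3 * w' = c'" by (simp add: c'_def c_def n'_def w'_def)
  note near = A.psi_phi_omega_near_three_torsion[OF wA, of u, folded z_def, unfolded c']
  have zt: "z = u\<^sup>2 * to_ac t"
  proof -
    have "u ^ 3 - to_ac e * u\<^sup>2 + 12 * w' * n' * u + 4 * w' = 0" using u by (simp add: w w'_def n'_def mult.assoc)
    hence "z = to_ac e * u\<^sup>2 + 12 * w' * n'\<^sup>2 * u\<^sup>2" unfolding z_def by Groebner_Basis.algebra
    thus ?thesis by (simp add: t_def w'_def n'_def algebra_simps)
  qed
  have u0: "u \<noteq> 0" and t0: "t \<noteq> 0" using px unfolding near zt by auto
  define F0 N0 where "F0 = t ^ 3 - 36 * w * n\<^sup>2 * t\<^sup>2 - 108 * w * n * c * t - 108 * w * c\<^sup>2"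
    and "N0 = t ^ 3 + 108 * w * n * c * t + 216 * w * c\<^sup>2"
  have F0: "F0 + x0 * (3 * t)\<^sup>2 = xP * (3 * t)\<^sup>2"
  proof -
    have "u ^ 6 * to_ac (F0 + x0 * (3 * t)\<^sup>2) = u ^ 6 * to_ac (xP * (3 * t)\<^sup>2)"
    proof -
      have "to_ac x0 * (9 * u\<^sup>2 * z\<^sup>2) + (z ^ 3 - 36 * w' * n'\<^sup>2 * u\<^sup>2 * z\<^sup>2 - 108 * w' * n' * c' * u ^ 4 * z - 108 * w' * c'\<^sup>2 * u ^ 6) =
          to_ac xP * (3 * u * z)\<^sup>2" using x unfolding near .
      thus ?thesis unfolding F0_def zt by (simp add: w'_def[symmetric] n'_def[symmetric] c'_def[symmetric]) Groebner_Basis.algebra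
    qed
    hence "to_ac (F0 + x0 * (3 * t)\<^sup>2) = to_ac (xP * (3 * t)\<^sup>2)" using u0 by simp
    thus ?thesis by (simp only: to_ac_eq_iff)
  qed
  define \<eta> where "\<eta> = yP + wa1 E / 2 * xP + wa3 E / 2"
  have fP: "\<eta>\<^sup>2 = poly C.f xP"
    using P on_curve_sq[OF two, of E "Affine xP yP"] unfolding sq
    by (simp add: \<eta>_def C.f_def algebra_simps power2_eq_square power3_eq_cube)
  have curve: "(poly A.omega (to_ac x0 + u))\<^sup>2 * poly A.f (to_ac x0 + u) =
      poly A.psi (to_ac x0 + u) ^ 6 * to_ac (\<eta>\<^sup>2)"
  proof -
    have "poly (A.omega\<^sup>2 * A.f) (to_ac x0 + u) = poly (A.phi ^ 3 + [:to_ac a2:] * A.phi\<^sup>2 * A.psi\<^sup>2 + [:to_ac a4:] * A.phi * A.psi ^ 4 + [:to_ac a6:] * A.psi ^ 6) (to_ac x0 + u)"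
      by (simp only: A.triple_curve_eq)
    hence "(poly A.omega (to_ac x0 + u))\<^sup>2 * poly A.f (to_ac x0 + u) =
       poly A.phi (to_ac x0 + u) ^ 3 + to_ac a2 * (poly A.phi (to_ac x0 + u))\<^sup>2 * (poly A.psi (to_ac x0 + u))\<^sup>2
       + to_ac a4 * poly A.phi (to_ac x0 + u) * poly A.psi (to_ac x0 + u) ^ 4 + to_ac a6 * poly A.psi (to_ac x0 + u) ^ 6"
      by (simp add: poly_add poly_mult poly_power)
    also have "\<dots> = poly A.psi (to_ac x0 + u) ^ 6 * (to_ac xP ^ 3 + to_ac a2 * (to_ac xP)\<^sup>2 + to_ac a4 * to_ac xP + to_ac a6)"
      unfolding x by Groebner_Basis.algebra
    finally show ?thesis unfolding fP by (simp add: C.f_def algebra_simps power2_eq_square power3_eq_cube)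
  qed
  \<comment> \<open>The ordinate of the triple is \<open>\<eta>\<close> up to sign and hence
    nonzero; so \<open>omega\<close>, and with it \<open>N0\<close>, does not vanish.\<close>
  have "poly A.omega (to_ac x0 + u) \<noteq> 0"
  proof
    assume "poly A.omega (to_ac x0 + u) = 0"
    \<comment> \<open>By \<open>curve\<close>, a zero of \<open>omega\<close> would kill the
      right-hand side as well.\<close>
    hence "poly A.psi (to_ac x0 + u) ^ 6 * to_ac (\<eta>\<^sup>2) = 0" using curve by simp
    thus False using px yP unfolding \<eta>_def[symmetric] by (simp only: mult_eq_0_iff power_eq_0_iff to_ac_eq_0_iff) auto
  qed
  hence "z ^ 3 + 108 * w' * n' * c' * u ^ 4 * z + 216 * w' * c'\<^sup>2 * u ^ 6 \<noteq> 0" unfolding near by auto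
  moreover have "z ^ 3 + 108 * w' * n' * c' * u ^ 4 * z + 216 * w' * c'\<^sup>2 * u ^ 6 = u ^ 6 * to_ac N0"
    unfolding zt N0_def by (simp add: w'_def n'_def c'_def) Groebner_Basis.algebra
  ultimately have N0: "N0 \<noteq> 0" by auto
  define s where "s = \<eta> * (3 * t) ^ 3 / N0"
  have sN: "s * N0 = \<eta> * (3 * t) ^ 3" using N0 by (simp add: s_def)
  define e2 e4 e6 where "e2 = - 27 * w * n\<^sup>2" and "e4 = - 54 * w * n * c" and "e6 = - 27 * w * c\<^sup>2"
  \<comment> \<open>\<open>F\<close> is \<open>F0 + x0 (3 t)\<^sup>2\<close> as a polynomial in
    \<open>t\<close>: the normal form has \<open>x0\<close> moved to 0, and this moves it
    back.\<close>
  define F where "F = [:- 108 * w * c\<^sup>2, - 108 * w * n * c, 9 * x0 - 36 * w * n\<^sup>2, 1:]"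
  define N where "N = [:216 * w * c\<^sup>2, 108 * w * n * c, 0, 1:]"
  define D where "D = [:0, 3 :: 'k:]"
  have eq: "N\<^sup>2 * [:e6, e4, e2, 1:] = F ^ 3 + [:a2:] * F\<^sup>2 * D\<^sup>2 + [:a4:] * F * D ^ 4 + [:a6:] * D ^ 6"
  proof -
    \<comment> \<open>Named constant polynomials let \<open>dual_three_isogeny_eq\<close> be used in
      the polynomial ring.\<close>
    define T W M K Z where "T = [:0, 1 :: 'k:]" and "W = [:w:]" and "M = [:n:]" and "K = [:c:]" and "Z = [:x0:]"
    define G where "G = T ^ 3 - 36 * W * M\<^sup>2 * T\<^sup>2 - 108 * W * M * K * T - 108 * W * K\<^sup>2"
    have num: "numeral k = [:numeral k :: 'k:]" for k by (simp add: numeral_poly)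
    have K: "K = 1 - 4 * M ^ 3 * W"
      by (simp add: K_def M_def W_def c_def num power3_eq_cube one_pCons)
    have D: "D = 3 * T" by (simp add: D_def T_def num)
    have F: "F = G + Z * (3 * T)\<^sup>2"
      by (simp add: F_def G_def T_def W_def M_def K_def Z_def num power2_eq_square power3_eq_cube algebra_simps)
    have N: "N = T ^ 3 + 108 * W * M * K * T + 216 * W * K\<^sup>2"
      by (simp add: N_def T_def W_def M_def K_def num power2_eq_square power3_eq_cube algebra_simps)
    have E: "[:e6, e4, e2, 1:] = T ^ 3 - 27 * W * (M * T + K)\<^sup>2"
      by (simp add: e2_def e4_def e6_def T_def W_def M_def K_def num power2_eq_square power3_eq_cube algebra_simps)
    have "poly C.f x0 = x0 ^ 3 + a2 * x0\<^sup>2 + a4 * x0 + a6" "poly C.df x0 = 3 * x0\<^sup>2 + 2 * a2 * x0 + a4" "poly C.hf x0 = 3 * x0 + a2"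
      by (simp_all add: C.f_def C.df_def C.hf_def algebra_simps power2_eq_square power3_eq_cube)
    hence "[:w:] = [:x0 ^ 3 + a2 * x0\<^sup>2 + a4 * x0 + a6:]" "[:6 * w * n:] = [:3 * x0\<^sup>2 + 2 * a2 * x0 + a4:]"
      "[:9 * w * n\<^sup>2:] = [:3 * x0 + a2:]" using w by simp_all
    hence W: "W = Z ^ 3 + [:a2:] * Z\<^sup>2 + [:a4:] * Z + [:a6:]" "6 * W * M = 3 * Z\<^sup>2 + 2 * [:a2:] * Z + [:a4:]"
      "9 * W * M\<^sup>2 = 3 * Z + [:a2:]"
      by (simp_all add: W_def M_def Z_def num power2_eq_square power3_eq_cube algebra_simps)
    have "N\<^sup>2 * [:e6, e4, e2, 1:] = G ^ 3 + (9 * W * M\<^sup>2) * G\<^sup>2 * (3 * T)\<^sup>2 + (6 * W * M) * G * (3 * T) ^ 4 + W * (3 * T) ^ 6"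
      unfolding N E G_def by (rule dual_three_isogeny_eq[OF K])
    also have "\<dots> = (G + Z * (3 * T)\<^sup>2) ^ 3 + [:a2:] * (G + Z * (3 * T)\<^sup>2)\<^sup>2 * (3 * T)\<^sup>2 + [:a4:] * (G + Z * (3 * T)\<^sup>2) * (3 * T) ^ 4 + [:a6:] * (3 * T) ^ 6"
      unfolding W(2,3) unfolding W(1) by Groebner_Basis.algebra
    finally show ?thesis unfolding F D .
  qed
  have Ft: "poly F t = xP * (poly D t)\<^sup>2"
    using F0 by (simp add: F_def F0_def D_def power2_eq_square power3_eq_cube algebra_simps)
  have Nt: "poly N t = N0" by (simp add: N_def N0_def power2_eq_square power3_eq_cube algebra_simps)
  have Dt: "poly D t = 3 * t" by (simp add: D_def)
  \<comment> \<open>Evaluate the curve identity at \<open>t\<close> and divide by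
    \<open>N0\<^sup>2\<close>.\<close>
  have st: "s\<^sup>2 = t ^ 3 + e2 * t\<^sup>2 + e4 * t + e6"
  proof -
    have "poly (N\<^sup>2 * [:e6, e4, e2, 1:]) t = poly (F ^ 3 + [:a2:] * F\<^sup>2 * D\<^sup>2 + [:a4:] * F * D ^ 4 + [:a6:] * D ^ 6) t"
      by (simp only: eq)
    hence "N0\<^sup>2 * poly [:e6, e4, e2, 1:] t = (xP * (3 * t)\<^sup>2) ^ 3 + a2 * (xP * (3 * t)\<^sup>2)\<^sup>2 * (3 * t)\<^sup>2 + a4 * (xP * (3 * t)\<^sup>2) * (3 * t) ^ 4 + a6 * (3 * t) ^ 6"
      unfolding poly_mult poly_add poly_power Ft Nt Dt by simp
    also have "\<dots> = (xP ^ 3 + a2 * xP\<^sup>2 + a4 * xP + a6) * ((3 * t) ^ 3)\<^sup>2" by Groebner_Basis.algebra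
    also have "xP ^ 3 + a2 * xP\<^sup>2 + a4 * xP + a6 = \<eta>\<^sup>2"
      unfolding fP by (simp add: C.f_def algebra_simps power2_eq_square power3_eq_cube)
    also have "\<eta>\<^sup>2 * ((3 * t) ^ 3)\<^sup>2 = (\<eta> * (3 * t) ^ 3)\<^sup>2" by (simp only: power_mult_distrib)
    also have "\<dots> = N0\<^sup>2 * s\<^sup>2" unfolding sN[symmetric] by (simp only: power_mult_distrib mult.commute)
    finally have "poly [:e6, e4, e2, 1:] t = s\<^sup>2" using N0 by simp
    thus ?thesis by (simp add: power2_eq_square power3_eq_cube algebra_simps)
  qed
  have ell': "elliptic_curve (Weierstrass 0 e2 0 e4 e6)"
  proof -
    have "wdisc (Weierstrass 0 e2 0 e4 e6) = - (2 ^ 4 * 3 ^ 9 * w\<^sup>2 * c ^ 3)"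
      unfolding wdisc_cubic e2_def e4_def e6_def c_def by Groebner_Basis.algebra
    moreover have "2 ^ 4 * 3 ^ 9 * w\<^sup>2 * c ^ 3 \<noteq> 0" using two three w0 c0 by (simp del: power_numeral)
    ultimately show ?thesis unfolding elliptic_curve_def by simp
  qed
  \<comment> \<open>\<open>D\<close> vanishes only at 0, so this value decides coprimality.\<close>
  have "poly F 0 \<noteq> 0"
  proof -
    have e: "(108::'k) = 2\<^sup>2 * 3 ^ 3" by simp
    have "(108::'k) \<noteq> 0" using two three unfolding e by (simp del: power_numeral)
    thus ?thesis using w0 c0 by (simp add: F_def)
  qed
  have cop: "coprime_polys F D"
  proof (rule coprime_polys_if_no_common_root)
    show "F \<noteq> 0" by (simp add: F_def)
    fix r assume r: "poly (map_poly to_ac F) r = 0" "poly (map_poly to_ac D) r = 0"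
    have "r * to_ac 3 = 0" using r(2) unfolding D_def ac.map_pCons by simp
    hence "r = to_ac 0" using three by (metis ac.hom_eq_0_iff mult_eq_0_iff)
    thus False using r(1) \<open>poly F 0 \<noteq> 0\<close> by (simp only: ac.poly_map ac.hom_eq_0_iff)
  qed
  have a: "a2 = wa2 E + (wa1 E / 2)\<^sup>2" "a4 = wa4 E + 2 * (wa1 E / 2) * (wa3 E / 2)" "a6 = wa6 E + (wa3 E / 2)\<^sup>2"
    using sq unfolding sq_curve_def by (simp_all only: weierstrass.inject)
  have deg: "degree D = 1" "degree F = 3" "degree N = 3" using three by (simp_all add: D_def F_def N_def)
  have "s * poly N t = (yP + wa1 E / 2 * xP + wa3 E / 2) * poly D t ^ 3" unfolding Nt Dt sN \<eta>_def ..
  moreover have "poly D t \<noteq> 0" using t0 three by (simp add: Dt)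
  ultimately show ?thesis using deg st Ft
    by (intro ff_even.K_magnifiedI[OF two ell ell' _ _ _ cop eq[unfolded a]]) auto
qed

section \<open>The points R with 3 R = P\<close>

lemma coprime_polys_sym: "coprime_polys p q \<Longrightarrow> coprime_polys q p"
  unfolding coprime_polys_def by (metis add.commute)

section \<open>Splitting monic polynomials of degree at most 4\<close>

lemma monic_root_factor:
  fixes p :: "'a::alg_closed_field poly"
  assumes "lead_coeff p = 1" "degree p = Suc n"
  obtains x q where "p = [:-x, 1:] * q" "lead_coeff q = 1" "degree q = n"
proof -
  obtain x where "poly p x = 0" using alg_closed_imp_poly_has_root[of p] assms(2) by auto
  then obtain q where q: "p = [:-x, 1:] * q" by (metis poly_eq_0_iff_dvd dvdE)
  have "q \<noteq> 0" using q assms by auto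
  hence "degree p = Suc (degree q)" unfolding q by (subst degree_mult_eq) auto
  moreover have "lead_coeff q = 1" using assms(1) unfolding q lead_coeff_mult by simp
  ultimately show ?thesis using that q assms(2) by auto
qed

lemma monic_degree_0: "lead_coeff p = 1 \<Longrightarrow> degree p = 0 \<Longrightarrow> p = 1"
  by (metis degree_eq_zeroE lead_coeff_pCons(2) one_pCons)

lemma monic_split:
  fixes p :: "'a::alg_closed_field poly"
  assumes "lead_coeff p = 1"
  shows "degree p = 2 \<Longrightarrow> \<exists>x1 x2. p = [:-x1, 1:] * [:-x2, 1:]"
    and "degree p = 3 \<Longrightarrow> \<exists>x1 x2 x3. p = [:-x1, 1:] * [:-x2, 1:] * [:-x3, 1:]"
    and "degree p = 4 \<Longrightarrow> \<exists>x1 x2 x3 x4. p = [:-x1, 1:] * [:-x2, 1:] * [:-x3, 1:] * [:-x4, 1:]"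
proof -
  have 1: "\<exists>x1. p = [:-x1, 1:]" if "lead_coeff p = 1" "degree p = 1" for p :: "'a poly"
    using monic_root_factor[of p 0] monic_degree_0 that by (metis One_nat_def mult.right_neutral)
  have 2: "\<exists>x1 x2. p = [:-x1, 1:] * [:-x2, 1:]" if "lead_coeff p = 1" "degree p = 2" for p :: "'a poly"
    using monic_root_factor[of p 1] 1 that by (metis Suc_1)
  have 3: "\<exists>x1 x2 x3. p = [:-x1, 1:] * [:-x2, 1:] * [:-x3, 1:]" if a: "lead_coeff p = 1" "degree p = 3" for p :: "'a poly"
  proof -
    have d: "degree p = Suc 2" using a by simp
    obtain x q where q: "p = [:-x, 1:] * q" "lead_coeff q = 1" "degree q = 2"
      by (rule monic_root_factor[OF a(1) d])
    thus ?thesis using 2[of q] by (metis mult.assoc)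
  qed
  have 4: "\<exists>x1 x2 x3 x4. p = [:-x1, 1:] * [:-x2, 1:] * [:-x3, 1:] * [:-x4, 1:]" if a: "lead_coeff p = 1" "degree p = 4" for p :: "'a poly"
  proof -
    have d: "degree p = Suc 3" using a by simp
    obtain x q where q: "p = [:-x, 1:] * q" "lead_coeff q = 1" "degree q = 3"
      by (rule monic_root_factor[OF a(1) d])
    thus ?thesis using 3[of q] by (metis mult.assoc)
  qed
  show "degree p = 2 \<Longrightarrow> \<exists>x1 x2. p = [:-x1, 1:] * [:-x2, 1:]"
    and "degree p = 3 \<Longrightarrow> \<exists>x1 x2 x3. p = [:-x1, 1:] * [:-x2, 1:] * [:-x3, 1:]"
    and "degree p = 4 \<Longrightarrow> \<exists>x1 x2 x3 x4. p = [:-x1, 1:] * [:-x2, 1:] * [:-x3, 1:] * [:-x4, 1:]"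
    using 2 3 4 assms by blast+
qed

lemma cofactor_lead:
  fixes h q :: "'a::idom poly"
  assumes "has_lead (h * q) n c" "c \<noteq> 0" "lead_coeff h = 1"
  shows "degree h + degree q = n" "lead_coeff q = c"
proof -
  have n: "degree (h * q) = n" using has_lead_degree assms by blast
  have q0: "q \<noteq> 0" "h \<noteq> 0" using assms by (auto simp: has_lead_def)
  show "degree h + degree q = n" using n q0 by (simp add: degree_mult_eq)
  show "lead_coeff q = c" using assms n lead_coeff_mult[of h q] by (simp add: has_lead_def)
qed

lemma poly_explicit:
  "degree p < 1 \<Longrightarrow> p = [:coeff p 0:]"
  "degree p < 2 \<Longrightarrow> p = [:coeff p 0, coeff p 1:]"
  "degree p < 3 \<Longrightarrow> p = [:coeff p 0, coeff p 1, coeff p 2:]"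
  "degree p < 4 \<Longrightarrow> p = [:coeff p 0, coeff p 1, coeff p 2, coeff p 3:]"
  by (rule poly_eqI, auto simp: coeff_pCons coeff_eq_0 eval_nat_numeral split: nat.splits)+

section \<open>Cosets of a subgroup of order 3\<close>

context cubic_curve
begin

text \<open>The abscissae over a point of the quotient are the roots of
  \<open>z = t u\<^sup>2\<close>, a cubic in \<open>u\<close> in which only the coefficient of
  \<open>u\<^sup>2\<close> varies with \<open>t\<close>. This is why two symmetric functions depend
  on the torsion point alone.\<close>

lemma three_torsion_translates:
  assumes R: "on_curve E (Affine x1 y1)" and T: "on_curve E (Affine x0 y0)" and psi0: "poly psi x0 = 0" and ne: "x1 \<noteq> x0"
  obtains x2 y2 x3 y3 where "ec_add E (Affine x1 y1) (Affine x0 y0) = Affine x2 y2"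
    "ec_add E (Affine x1 y1) (Affine x0 (- y0)) = Affine x3 y3"
    "(x1 - x0) * (x2 - x0) + (x1 - x0) * (x3 - x0) + (x2 - x0) * (x3 - x0) = 2 * poly df x0"
    "(x1 - x0) * (x2 - x0) * (x3 - x0) = - 4 * poly f x0"
proof -
  define u where "u = x1 - x0"
  have u0: "u \<noteq> 0" using ne by (simp add: u_def)
  define w f1 f2 where "w = poly f x0" and "f1 = poly df x0" and "f2 = poly hf x0"
  have y0: "y0\<^sup>2 = w" using T by (simp add: w_def f_def algebra_simps power2_eq_square power3_eq_cube)
  have x1: "x1 = x0 + u" by (simp add: u_def)
  have "y1\<^sup>2 = poly f (x0 + u)" using R unfolding x1[symmetric] by (simp add: f_def algebra_simps power2_eq_square power3_eq_cube)
  hence y1: "y1\<^sup>2 = w + f1 * u + f2 * u\<^sup>2 + u ^ 3" by (simp add: poly_taylor w_def f1_def f2_def)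
  have p: "4 * w * f2 = f1\<^sup>2" using psi0 by (simp add: psi_def w_def f1_def f2_def)
  have f2: "f2 = 3 * x0 + a2" by (simp add: f2_def hf_def)
  define x where "x v = ((v - y1) / (x0 - x1))\<^sup>2 - a2 - x1 - x0" for v
  have add: "\<exists>y. ec_add E (Affine x1 y1) (Affine x0 v) = Affine (x v) y" for v
    using ne by (simp add: Let_def x_def)
  have key: "u\<^sup>2 * (x v - x0) = 2 * w + f1 * u - 2 * y1 * v" if "v\<^sup>2 = w" for v
  proof -
    have "u\<^sup>2 * ((v - y1) / (x0 - x1))\<^sup>2 = (v - y1)\<^sup>2" using u0 by (simp add: x1 power_divide)
    hence "u\<^sup>2 * (x v - x0) = (v - y1)\<^sup>2 - u\<^sup>2 * (f2 + u)"
      by (simp add: x_def f2 x1 algebra_simps)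
    also have "(v - y1)\<^sup>2 = v\<^sup>2 + y1\<^sup>2 - 2 * y1 * v" by (simp add: power2_eq_square algebra_simps)
    also have "v\<^sup>2 + y1\<^sup>2 - 2 * y1 * v - u\<^sup>2 * (f2 + u) = 2 * w + f1 * u - 2 * y1 * v"
      unfolding that y1 by Groebner_Basis.algebra
    finally show ?thesis .
  qed
  define u2 u3 where "u2 = x y0 - x0" and "u3 = x (- y0) - x0"
  have k2: "u\<^sup>2 * u2 = 2 * w + f1 * u - 2 * y1 * y0" and k3: "u\<^sup>2 * u3 = 2 * w + f1 * u + 2 * y1 * y0"
    using key[of y0] key[of "- y0"] y0 by (auto simp: u2_def u3_def)
  \<comment> \<open>The formulas for \<open>y0\<close> and \<open>- y0\<close> are conjugate; in
    their product \<open>4 w f2 = f1\<^sup>2\<close> removes the term in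
    \<open>u\<^sup>2\<close>.\<close>
  have "(u\<^sup>2 * u2) * (u\<^sup>2 * u3) = (2 * w + f1 * u)\<^sup>2 - 4 * y1\<^sup>2 * y0\<^sup>2"
    unfolding k2 k3 by Groebner_Basis.algebra
  also have "\<dots> = u\<^sup>2 * (f1\<^sup>2 - 4 * w * f2) - 4 * w * u ^ 3" unfolding y1 y0 by Groebner_Basis.algebra
  finally have "u ^ 3 * (u * u2 * u3) = u ^ 3 * (- 4 * w)"
    unfolding p by (simp add: algebra_simps power2_eq_square power3_eq_cube)
  hence e3: "u * u2 * u3 = - 4 * w" using u0 by (metis mult_left_cancel power_not_zero)
  have "u * (u * u2 + u * u3 + u2 * u3) = u\<^sup>2 * u2 + u\<^sup>2 * u3 + u * u2 * u3"
    by (simp add: algebra_simps power2_eq_square)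
  also have "\<dots> = u * (2 * f1)" unfolding k2 k3 e3 by (simp add: algebra_simps)
  finally have e2: "u * u2 + u * u3 + u2 * u3 = 2 * f1" using u0 by (metis mult_left_cancel)
  obtain y2 y3 where "ec_add E (Affine x1 y1) (Affine x0 y0) = Affine (x y0) y2"
    "ec_add E (Affine x1 y1) (Affine x0 (- y0)) = Affine (x (- y0)) y3" using add by blast
  thus ?thesis using that e2 e3 unfolding u_def u2_def u3_def w_def f1_def by blast
qed

text \<open>The ordinate of the triple is \<open>y\<close> times a quantity depending on
  \<open>x\<close> only, and it is nonzero.\<close>

lemma triple_inj_on_fibre:
  assumes "on_curve E (Affine x y)" "on_curve E (Affine x y')" "\<eta> \<noteq> 0"
    "ec_mult E 3 (Affine x y) = Affine xP \<eta>" "ec_mult E 3 (Affine x y') = Affine xP \<eta>"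
  shows "y = y'"
  using assms by (auto simp: triple_point split: if_splits)

end

text \<open>\<open>C\<close> is the completed square curve over \<open>K\<close> and
  \<open>A\<close> the same curve over an algebraic closure. That the ordinate \<open>\<eta>\<close>
  of \<open>P\<close> on it is nonzero says that \<open>P\<close> does not have order 2.\<close>

locale triple_fibre =
  fixes E :: "'k::field weierstrass" and xP yP a2 a4 a6 \<eta> :: 'k
  assumes two: "(2::'k) \<noteq> 0" and three: "(3::'k) \<noteq> 0" and ell: "elliptic_curve E"
    and P: "on_curve E (Affine xP yP)"
    and sq: "sq_curve E = Weierstrass 0 a2 0 a4 a6"
    and eta: "\<eta> = yP + wa1 E / 2 * xP + wa3 E / 2" "\<eta> \<noteq> 0"
begin

lemma ell_sq: "elliptic_curve (Weierstrass 0 a2 0 a4 a6)"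
  using ell wdisc_sq[OF two, of E] by (simp add: elliptic_curve_def sq)

sublocale C: cubic_curve a2 a4 a6
  by (rule cubic_curveI[OF two ell_sq])

sublocale ac: field_hom "to_ac :: 'k \<Rightarrow> 'k alg_closure"
  by (rule field_hom_to_ac)

sublocale A: cubic_curve "to_ac a2" "to_ac a4" "to_ac a6"
  by (rule ac.cubic_curve_map[OF C.cubic_curve_axioms ell_sq])

lemmas polys_map = ac.cubic_polys_map[OF C.cubic_curve_axioms A.cubic_curve_axioms]

lemma curve_map: "map_weierstrass to_ac C.E = A.E"
  by simp

definition PK :: "'k ec_point" where "PK = Affine xP \<eta>"
definition PA :: "'k alg_closure ec_point" where "PA = Affine (to_ac xP) (to_ac \<eta>)"

lemma PA_map: "map_ec_point to_ac PK = PA"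
  by (simp add: PK_def PA_def)

lemma PK_sq: "sq_point E (Affine xP yP) = PK"
  unfolding PK_def sq_point.simps eta(1)[symmetric] ..

lemma on_curve_PK: "on_curve C.E PK"
  using P on_curve_sq[OF two, of E "Affine xP yP"] unfolding PK_sq sq by simp

lemma on_curve_A: "on_curve A.E (map_ec_point to_ac S) \<longleftrightarrow> on_curve C.E S"
  unfolding curve_map[symmetric] by (rule ac.on_curve_map)

lemma on_curve_PA: "on_curve A.E PA"
  using on_curve_PK unfolding PA_map[symmetric] on_curve_A .

lemma map_add_A: "map_ec_point to_ac (ec_add C.E S T) = ec_add A.E (map_ec_point to_ac S) (map_ec_point to_ac T)"
  unfolding curve_map[symmetric] by (rule ac.map_ec_add)

lemma map_neg: "map_ec_point to_ac (ec_neg S) = ec_neg (map_ec_point to_ac S)"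
  by (cases S) auto

lemma magnified_if_third:
  assumes "on_curve C.E S" "ec_mult A.E 3 (map_ec_point to_ac S) = PA"
  shows "K_magnified E (Affine xP yP)"
proof -
  have "map_ec_point to_ac (ec_mult C.E 3 S) = map_ec_point to_ac PK"
    using assms(2) unfolding PA_map ac.map_ec_mult curve_map .
  hence "ec_mult C.E 3 S = PK" by (simp only: ac.map_ec_point_eq_iff)
  thus ?thesis using assms(1) tripled_magnified[OF two three ell, of S "Affine xP yP"]
    unfolding sq PK_sq by simp
qed

lemma torsion_if_torsion:
  assumes "on_curve C.E T" "T \<noteq> Infinity" "ec_mult A.E 3 (map_ec_point to_ac T) = Infinity"
  shows "\<exists>T\<in>points E. T \<noteq> Infinity \<and> ec_mult E 3 T = Infinity"
proof -
  have "map_ec_point to_ac (ec_mult C.E 3 T) = map_ec_point to_ac Infinity"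
    using assms(3) unfolding ac.map_ec_mult curve_map by simp
  hence T3: "ec_mult C.E 3 T = Infinity" by (simp only: ac.map_ec_point_eq_iff)
  obtain S where S: "sq_point E S = T" by (rule sq_point_surj)
  have on: "on_curve E S" using assms(1) on_curve_sq[OF two, of E S] unfolding S sq by simp
  have "sq_point E (ec_mult E 3 S) = Infinity" using sq_point_mult[OF two ell on, of 3] T3 unfolding S sq by simp
  hence "ec_mult E 3 S = Infinity" by simp
  moreover have "S \<noteq> Infinity" using S assms(2) by auto
  ultimately show ?thesis using on by (auto simp: points_def)
qed

text \<open>\<open>h\<close> is a factor of the polynomial of the abscissae of the points \<open>R\<close> with \<open>3 R = P\<close>, and
  \<open>r\<close> interpolates their ordinates (a Mumford representation).\<close>

definition fibre_factor :: "'k poly \<Rightarrow> 'k poly \<Rightarrow> bool" where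
  "fibre_factor h r \<longleftrightarrow> lead_coeff h = 1 \<and> degree r < degree h \<and> h dvd r\<^sup>2 - C.f \<and>
    (\<forall>x. poly (map_poly to_ac h) x = 0 \<longrightarrow> poly A.psi x \<noteq> 0 \<and> poly A.phi x = to_ac xP * (poly A.psi x)\<^sup>2 \<and>
      on_curve A.E (Affine x (poly (map_poly to_ac r) x)) \<and>
      ec_mult A.E 3 (Affine x (poly (map_poly to_ac r) x)) = PA)"

text \<open>The condition on the ordinates, \<open>r omega = \<eta> psi\<^sup>3\<close> modulo
  \<open>h\<close>, is solved by inverting \<open>omega\<close>. Then \<open>h\<close> divides
  \<open>r\<^sup>2 - f\<close> by the congruence of \<open>omega\<^sup>2 f\<close> and
  \<open>\<eta>\<^sup>2 psi ^ 6\<close>, after cancelling \<open>omega\<^sup>2\<close>.\<close>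

lemma fibre_factor_exists:
  assumes h: "lead_coeff h = 1" "degree h > 0" "h dvd C.phi - [:xP:] * C.psi\<^sup>2"
  obtains r where "fibre_factor h r"
proof -
  obtain k where k: "C.phi = [:xP:] * C.psi\<^sup>2 + h * k" using h(3) by (metis dvdE diff_eq_eq add.commute)
  have fP': "[:xP:] ^ 3 + [:a2:] * [:xP:]\<^sup>2 + [:a4:] * [:xP:] + [:a6:] = [:\<eta>:]\<^sup>2"
  proof -
    have "xP ^ 3 + a2 * xP\<^sup>2 + a4 * xP + a6 = \<eta>\<^sup>2" using on_curve_PK by (simp add: PK_def)
    thus ?thesis by (simp add: power2_eq_square power3_eq_cube algebra_simps)
  qed
  \<comment> \<open>\<open>m\<close> is \<open>k\<close> times the difference quotient of the
    homogenised cubic at \<open>phi\<close> and \<open>xP psi\<^sup>2\<close>, whose difference is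
    \<open>h k\<close>.\<close>
  define m where "m = (C.phi\<^sup>2 + C.phi * ([:xP:] * C.psi\<^sup>2) + ([:xP:] * C.psi\<^sup>2)\<^sup>2
      + [:a2:] * C.psi\<^sup>2 * (C.phi + [:xP:] * C.psi\<^sup>2) + [:a4:] * C.psi ^ 4) * k"
  have cong: "C.omega\<^sup>2 * C.f = C.psi ^ 6 * [:\<eta>:]\<^sup>2 + h * m"
  proof -
    have "h * m = (C.phi - [:xP:] * C.psi\<^sup>2) * (C.phi\<^sup>2 + C.phi * ([:xP:] * C.psi\<^sup>2) + ([:xP:] * C.psi\<^sup>2)\<^sup>2
      + [:a2:] * C.psi\<^sup>2 * (C.phi + [:xP:] * C.psi\<^sup>2) + [:a4:] * C.psi ^ 4)"
      unfolding m_def using k by (simp add: algebra_simps)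
    also have "\<dots> = (C.phi ^ 3 + [:a2:] * C.phi\<^sup>2 * C.psi\<^sup>2 + [:a4:] * C.phi * C.psi ^ 4 + [:a6:] * C.psi ^ 6)
      - C.psi ^ 6 * ([:xP:] ^ 3 + [:a2:] * [:xP:]\<^sup>2 + [:a4:] * [:xP:] + [:a6:])"
      by Groebner_Basis.algebra
    finally have "h * m = C.omega\<^sup>2 * C.f - C.psi ^ 6 * [:\<eta>:]\<^sup>2" unfolding C.triple_curve_eq fP' .
    thus ?thesis by (metis add.commute diff_add_cancel)
  qed
  \<comment> \<open>\<open>psi\<close> is nonzero since it has no common root with
    \<open>phi\<close>, and then \<open>omega\<close> is nonzero since \<open>\<eta>\<close>
    is.\<close>
  have root: "poly A.phi x = to_ac xP * (poly A.psi x)\<^sup>2 \<and> poly A.psi x \<noteq> 0 \<and> poly A.omega x \<noteq> 0 \<and>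
      (poly A.omega x)\<^sup>2 * poly A.f x = poly A.psi x ^ 6 * (to_ac \<eta>)\<^sup>2"
    if x: "poly (map_poly to_ac h) x = 0" for x
  proof -
    have "map_poly to_ac C.phi = map_poly to_ac ([:xP:] * C.psi\<^sup>2 + h * k)" by (simp only: k[symmetric])
    hence "A.phi = [:to_ac xP:] * A.psi\<^sup>2 + map_poly to_ac h * map_poly to_ac k"
      unfolding polys_map by (simp only: ac.map_poly_simps ac.map_pCons)
    hence 1: "poly A.phi x = to_ac xP * (poly A.psi x)\<^sup>2" using x by (simp add: poly_power)
    hence 2: "poly A.psi x \<noteq> 0" using A.psi_phi_no_common_root[of x] by auto
    have "map_poly to_ac (C.omega\<^sup>2 * C.f) = map_poly to_ac (C.psi ^ 6 * [:\<eta>:]\<^sup>2 + h * m)" by (simp only: cong)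
    hence "A.omega\<^sup>2 * A.f = A.psi ^ 6 * [:to_ac \<eta>:]\<^sup>2 + map_poly to_ac h * map_poly to_ac m"
      unfolding polys_map by (simp only: ac.map_poly_simps ac.map_pCons)
    hence "poly (A.omega\<^sup>2 * A.f) x = poly (A.psi ^ 6 * [:to_ac \<eta>:]\<^sup>2 + map_poly to_ac h * map_poly to_ac m) x"
      by (simp only:)
    hence 3: "(poly A.omega x)\<^sup>2 * poly A.f x = poly A.psi x ^ 6 * (to_ac \<eta>)\<^sup>2"
      using x by (simp add: poly_power poly_mult)
    hence "poly A.omega x \<noteq> 0" using 2 eta(2) by auto
    thus ?thesis using 1 2 3 by blast
  qed
  have h0: "h \<noteq> 0" using h(1) by auto
  have cop: "coprime_polys h C.omega"
    by (rule coprime_polys_if_no_common_root[OF h0]) (use root in \<open>auto simp: polys_map\<close>)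
  then obtain u v where uv: "u * h + v * C.omega = 1" by (auto simp: coprime_polys_def)
  define g where "g = [:\<eta>:] * C.psi ^ 3 * v"
  define r where "r = g mod h"
  have g: "g = g div h * h + r" by (simp add: r_def)
  have ro: "r * C.omega = [:\<eta>:] * C.psi ^ 3 + h * (- ([:\<eta>:] * C.psi ^ 3 * u) - g div h * C.omega)"
  proof -
    have "r = g - g div h * h" using g by (metis add_diff_cancel_left')
    hence "r * C.omega = [:\<eta>:] * C.psi ^ 3 * (v * C.omega) - g div h * h * C.omega"
      unfolding g_def by (simp only: left_diff_distrib mult.assoc)
    also have "v * C.omega = 1 - u * h" using uv by (metis add_diff_cancel_left')
    also have "[:\<eta>:] * C.psi ^ 3 * (1 - u * h) - g div h * h * C.omega =
        [:\<eta>:] * C.psi ^ 3 + h * (- ([:\<eta>:] * C.psi ^ 3 * u) - g div h * C.omega)" by Groebner_Basis.algebra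
    finally show ?thesis .
  qed
  define s where "s = - ([:\<eta>:] * C.psi ^ 3 * u) - g div h * C.omega"
  have "C.omega ^ 2 * (r\<^sup>2 - C.f) = (r * C.omega)\<^sup>2 - C.omega\<^sup>2 * C.f" by (simp add: algebra_simps power2_eq_square)
  also have "\<dots> = h * (2 * [:\<eta>:] * C.psi ^ 3 * s + h * s\<^sup>2 - m)"
    unfolding ro s_def[symmetric] cong by Groebner_Basis.algebra
  finally have "h dvd C.omega ^ 2 * (r\<^sup>2 - C.f)" by simp
  hence dv: "h dvd r\<^sup>2 - C.f" by (rule coprime_polys_dvd_cancel[OF coprime_polys_sym[OF cop]])
  have "fibre_factor h r"
    unfolding fibre_factor_def
  proof (intro conjI allI impI)
    show "degree r < degree h" unfolding r_def using degree_mod_less[OF h0, of g] h(2) by auto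
    fix x assume x: "poly (map_poly to_ac h) x = 0"
    note rt = root[OF x]
    show "poly A.psi x \<noteq> 0" "poly A.phi x = to_ac xP * (poly A.psi x)\<^sup>2" using rt by auto
    define y where "y = poly (map_poly to_ac r) x"
    have "map_poly to_ac (r * C.omega) = map_poly to_ac ([:\<eta>:] * C.psi ^ 3 + h * s)" by (simp only: ro s_def)
    hence "map_poly to_ac r * A.omega = [:to_ac \<eta>:] * A.psi ^ 3 + map_poly to_ac h * map_poly to_ac s"
      unfolding polys_map by (simp only: ac.map_poly_simps ac.map_pCons)
    hence "poly (map_poly to_ac r * A.omega) x = poly ([:to_ac \<eta>:] * A.psi ^ 3 + map_poly to_ac h * map_poly to_ac s) x"
      by (simp only:)
    hence yo: "y * poly A.omega x = to_ac \<eta> * poly A.psi x ^ 3" using x by (simp add: y_def poly_power poly_mult)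
    obtain q where "r\<^sup>2 - C.f = h * q" using dv by auto
    hence "map_poly to_ac (r\<^sup>2 - C.f) = map_poly to_ac (h * q)" by (simp only:)
    hence "(map_poly to_ac r)\<^sup>2 - A.f = map_poly to_ac h * map_poly to_ac q"
      unfolding polys_map by (simp only: ac.map_poly_simps)
    hence "poly ((map_poly to_ac r)\<^sup>2 - A.f) x = 0" using x by simp
    hence "y\<^sup>2 = poly A.f x" by (simp add: y_def poly_power)
    thus on: "on_curve A.E (Affine x (poly (map_poly to_ac r) x))"
      unfolding y_def[symmetric] by (simp add: A.f_def algebra_simps power2_eq_square power3_eq_cube)
    have "y * poly A.omega x / poly A.psi x ^ 3 = to_ac \<eta>" using yo rt by simp
    thus "ec_mult A.E 3 (Affine x (poly (map_poly to_ac r) x)) = PA"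
      using A.triple_point[OF on] rt unfolding y_def by (simp add: PA_def)
  qed (use h dv in auto)
  thus ?thesis by (rule that)
qed

end

section \<open>Thirds of P from multiples of P\<close>

context cubic_curve
begin

lemma mult_3: "ec_mult E 3 P = ec_add E P (ec_add E P P)"
  by (simp add: eval_nat_numeral)

lemma add_neg_cancel:
  assumes "on_curve E P" "on_curve E Q" shows "ec_add E (ec_add E P Q) (ec_neg Q) = P"
  using add_assoc[OF assms, of "ec_neg Q"] assms by simp

lemma eq_neg_if_zero_sum:
  assumes "on_curve E P" "on_curve E Q" "ec_add E P Q = Infinity" shows "Q = ec_neg P"
  using assms neg_add_cancel[of P Q] by (metis ec_add.simps(1) ec_neg.simps(1) ec_neg_neg)

lemma add_left_cancel:
  assumes "on_curve E P" "on_curve E Q" "on_curve E R" "ec_add E P Q = ec_add E P R" shows "Q = R"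
  using G.l_cancel[of P Q R] assms by simp

text \<open>Used with \<open>S\<close> the negative of the sum of two fibre points.\<close>

lemma triple_add:
  assumes "on_curve E P" "on_curve E S" "ec_mult E 3 S = ec_neg (ec_add E P P)"
  shows "ec_mult E 3 (ec_add E P S) = P"
  using mult_add[OF assms(1,2), of 3] add_neg_cancel[of P "ec_add E P P"] assms(1,3)
  by (simp add: mult_3[of P] on_curve_add)

text \<open>Used with \<open>S\<close> the sum of four fibre points.\<close>

lemma triple_sub:
  assumes "on_curve E P" "on_curve E S" "ec_mult E 3 S = ec_add E (ec_add E P P) (ec_add E P P)"
  shows "ec_mult E 3 (ec_add E S (ec_neg P)) = P"
proof -
  have "ec_mult E 3 (ec_add E S (ec_neg P)) = ec_add E (ec_add E (ec_add E P P) (ec_add E P P)) (ec_neg (ec_add E P (ec_add E P P)))"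
    using mult_add[OF assms(2), of "ec_neg P" 3] assms by (simp add: mult_neg mult_3[of P])
  also have "ec_add E (ec_add E P P) (ec_add E P P) = ec_add E P (ec_add E P (ec_add E P P))"
    using add_assoc assms(1) on_curve_add by metis
  finally show ?thesis using add_neg_cancel[of P "ec_add E P (ec_add E P P)"] assms(1) by (simp add: on_curve_add)
qed

text \<open>Covers four fibre points with sum zero: then \<open>4 P = 0\<close>, and
  \<open>- 3 P\<close> is \<open>P\<close> again.\<close>

lemma triple_neg:
  assumes "on_curve E P" "ec_add E (ec_add E P P) (ec_add E P P) = Infinity"
  shows "ec_mult E 3 (ec_neg P) = P"
  using triple_sub[OF assms(1), of Infinity] assms by (simp add: eval_nat_numeral)

end

section \<open>Fibre factors of degree 1, 2 and 4\<close>

context triple_fibre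
begin

lemma fibre_map:
  assumes "r\<^sup>2 - C.f = h * q"
  shows "(map_poly to_ac r)\<^sup>2 - A.f = map_poly to_ac h * map_poly to_ac q"
proof -
  have "map_poly to_ac (r\<^sup>2 - C.f) = map_poly to_ac (h * q)" using assms by (simp only:)
  thus ?thesis unfolding polys_map by (simp only: ac.map_poly_simps)
qed

lemma fibre_point:
  assumes "fibre_factor h r" "poly (map_poly to_ac h) x = 0"
  shows "on_curve A.E (Affine x (poly (map_poly to_ac r) x))"
    "ec_mult A.E 3 (Affine x (poly (map_poly to_ac r) x)) = PA"
  using assms by (auto simp: fibre_factor_def)

lemma magnified_if_rational_root:
  assumes "fibre_factor h r" "poly h x = 0"
  shows "K_magnified E (Affine xP yP)"
proof (rule magnified_if_third[of "Affine x (poly r x)"])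
  have "poly (map_poly to_ac h) (to_ac x) = 0" using assms(2) by (simp add: ac.poly_map)
  note p = fibre_point[OF assms(1) this, unfolded ac.poly_map]
  show "ec_mult A.E 3 (map_ec_point to_ac (Affine x (poly r x))) = PA" using p(2) by simp
  have "on_curve A.E (map_ec_point to_ac (Affine x (poly r x)))" using p(1) by simp
  thus "on_curve C.E (Affine x (poly r x))" unfolding on_curve_A .
qed

lemma degree_1_case:
  assumes "fibre_factor h r" "degree h = 1" shows "K_magnified E (Affine xP yP)"
proof -
  obtain c where "h = [:c, 1:]" using assms poly_explicit(2)[of h] by (simp add: fibre_factor_def)
  hence "poly h (- c) = 0" by simp
  thus ?thesis by (rule magnified_if_rational_root[OF assms(1)])
qed

text \<open>\<open>r\<close> is a line through the two fibre points. The cofactor of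
  \<open>h\<close> in \<open>r\<^sup>2 - f\<close> is linear over \<open>K\<close>, so the third
  point \<open>S\<close> of the line is rational, and \<open>3 S = - 2 P\<close>.\<close>

lemma degree_2_case:
  assumes ff: "fibre_factor h r" and d: "degree h = 2" shows "K_magnified E (Affine xP yP)"
proof -
  have h1: "lead_coeff h = 1" and dr: "degree r < 2" and "h dvd r\<^sup>2 - C.f" using ff d by (auto simp: fibre_factor_def)
  then obtain q where q: "r\<^sup>2 - C.f = h * q" by auto
  define l m where "l = coeff r 1" and "m = coeff r 0"
  have r: "r = [:m, l:]" unfolding l_def m_def by (rule poly_explicit(2)[OF dr])
  have "has_lead (r\<^sup>2) 3 0" using has_lead_Suc[of "r\<^sup>2" 2] has_lead_power[of r 1 l 2] by (simp add: r has_lead_def eval_nat_numeral)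
  hence "has_lead (h * q) 3 (- 1)" using has_lead_diff[OF _ C.has_lead_polys(1)] unfolding q[symmetric] by force
  note co = cofactor_lead[OF this _ h1]
  have dq: "degree q = 1" "coeff q 1 = - 1" using co d by auto
  define s where "s = coeff q 0"
  have q': "q = - [:-s, 1:]" using poly_explicit(2)[of q] dq by (simp add: s_def)
  obtain x1 x2 where x: "map_poly to_ac h = [:-x1, 1:] * [:-x2, 1:]"
    using monic_split(1)[of "map_poly to_ac h"] h1 d by (auto simp: ac.degree_map ac.coeff_map)
  have qA: "map_poly to_ac q = - [:- to_ac s, 1:]"
    unfolding q' by (simp only: ac.map_poly_simps ac.map_pCons ac.hom_simps)
  have rA: "map_poly to_ac r = [:to_ac m, to_ac l:]"
    unfolding r by (simp only: ac.map_poly_simps ac.map_pCons)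
  define R1 R2 where "R1 = Affine x1 (poly (map_poly to_ac r) x1)" and "R2 = Affine x2 (poly (map_poly to_ac r) x2)"
  define S where "S = Affine s (poly r s)"
  have SA: "map_ec_point to_ac S = Affine (to_ac s) (poly (map_poly to_ac r) (to_ac s))"
    by (simp add: S_def ac.poly_map)
  have "A.on_line (to_ac l) (to_ac m) x1 (poly (map_poly to_ac r) x1) x2 (poly (map_poly to_ac r) x2)
      (to_ac s) (poly (map_poly to_ac r) (to_ac s))"
    unfolding A.on_line_poly_iff rA[symmetric] fibre_map[OF q] x qA by (simp only: mult_minus_right simp_thms)
  hence col: "A.collinear R1 R2 (map_ec_point to_ac S)" unfolding SA R1_def R2_def by auto
  have roots: "poly (map_poly to_ac h) x1 = 0" "poly (map_poly to_ac h) x2 = 0" unfolding x poly_mult by simp_all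
  note p1 = fibre_point[OF ff roots(1), folded R1_def] and p2 = fibre_point[OF ff roots(2), folded R2_def]
  have onS: "on_curve A.E (map_ec_point to_ac S)" using A.collinear_on_curve(3)[OF col] .
  have "map_ec_point to_ac S = ec_neg (ec_add A.E R1 R2)" using A.collinear_add[OF col] by simp
  hence "ec_mult A.E 3 (map_ec_point to_ac S) = ec_neg (ec_add A.E PA PA)"
    using A.mult_neg[OF A.on_curve_add[OF p1(1) p2(1)], of 3] A.mult_add[OF p1(1) p2(1), of 3] p1(2) p2(2) by simp
  from A.triple_add[OF on_curve_PA onS this]
  have "ec_mult A.E 3 (map_ec_point to_ac (ec_add C.E PK S)) = PA" unfolding map_add_A PA_map .
  moreover have "on_curve C.E (ec_add C.E PK S)" using onS on_curve_PK C.on_curve_add unfolding on_curve_A by blast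
  ultimately show ?thesis by (intro magnified_if_third)
qed

text \<open>For \<open>r\<close> of degree 3 the six intersections leave two points over the zeros
  of a rational quadratic \<open>q3\<close>. The remainder \<open>k\<close> of \<open>r\<close>
  modulo \<open>q3\<close> is a line through these two; its third point \<open>S\<close> is rational
  and equals the sum of the four fibre points. For \<open>r\<close> of degree 2 no further points
  exist and the four have sum zero.\<close>

lemma degree_4_case:
  assumes ff: "fibre_factor h r" and d: "degree h = 4" shows "K_magnified E (Affine xP yP)"
proof -
  have h1: "lead_coeff h = 1" and dr: "degree r < 4" and "h dvd r\<^sup>2 - C.f" using ff d by (auto simp: fibre_factor_def)
  then obtain q where q: "r\<^sup>2 - C.f = h * q" by auto
  define e a b c where "e = coeff r 0" and "a = coeff r 1" and "b = coeff r 2" and "c = coeff r 3"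
  have r: "r = [:e, a, b, c:]" unfolding e_def a_def b_def c_def by (rule poly_explicit(4)[OF dr])
  define rA where "rA = map_poly to_ac r"
  have rA: "rA = [:to_ac e, to_ac a, to_ac b, to_ac c:]"
    unfolding rA_def r by (simp only: ac.map_poly_simps ac.map_pCons)
  obtain x1 x2 x3 x4 where x: "map_poly to_ac h = [:-x1, 1:] * [:-x2, 1:] * [:-x3, 1:] * [:-x4, 1:]"
    using monic_split(3)[of "map_poly to_ac h"] h1 d by (auto simp: ac.degree_map ac.coeff_map)
  define R where "R x = Affine x (poly rA x)" for x
  have roots: "poly (map_poly to_ac h) x1 = 0" "poly (map_poly to_ac h) x2 = 0" "poly (map_poly to_ac h) x3 = 0"
    "poly (map_poly to_ac h) x4 = 0" unfolding x poly_mult by simp_all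
  have R: "on_curve A.E (R x1)" "on_curve A.E (R x2)" "on_curve A.E (R x3)" "on_curve A.E (R x4)"
    "ec_mult A.E 3 (R x1) = PA" "ec_mult A.E 3 (R x2) = PA" "ec_mult A.E 3 (R x3) = PA" "ec_mult A.E 3 (R x4) = PA"
    using fibre_point[OF ff] roots unfolding R_def rA_def by blast+
  have eqA: "rA\<^sup>2 - A.f = ([:-x1, 1:] * [:-x2, 1:] * [:-x3, 1:] * [:-x4, 1:]) * map_poly to_ac q"
    using fibre_map[OF q] unfolding rA_def x .
  show ?thesis
  proof (cases "c = 0")
    case False
    have "has_lead (r\<^sup>2) 6 (c\<^sup>2)" using has_lead_power[of r 3 c 2] by (simp add: r has_lead_def eval_nat_numeral)
    moreover have "has_lead C.f 6 0" using C.has_lead_polys(1) by (simp add: has_lead_def coeff_eq_0)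
    ultimately have "has_lead (h * q) 6 (c\<^sup>2)" using has_lead_diff unfolding q[symmetric] by force
    note co = cofactor_lead[OF this _ h1]
    have dq: "degree q = 2" "lead_coeff q = c\<^sup>2" using co d False by auto
    define q3 where "q3 = smult (inverse (c\<^sup>2)) q"
    have q3: "q = smult (c\<^sup>2) q3" "degree q3 = 2" "lead_coeff q3 = 1" using False dq by (simp_all add: q3_def)
    obtain x5 x6 where x56: "map_poly to_ac q3 = [:-x5, 1:] * [:-x6, 1:]"
      using monic_split(1)[of "map_poly to_ac q3"] q3(2,3) by (auto simp: ac.degree_map ac.coeff_map)
    have q3d: "q3 dvd r\<^sup>2 - C.f" unfolding q q3(1) by (simp add: dvd_smult)
    define k where "k = r mod q3"
    have q30: "q3 \<noteq> 0" using q3 by auto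
    have dk: "degree k < 2" unfolding k_def using degree_mod_less[OF q30, of r] q3(2) by auto
    have rk: "r = r div q3 * q3 + k" by (simp add: k_def)
    \<comment> \<open>\<open>r\<close> and \<open>k\<close> agree modulo \<open>q3\<close>, so
      \<open>q3\<close> divides \<open>k\<^sup>2 - f\<close> as well.\<close>
    have "r\<^sup>2 - C.f = k\<^sup>2 - C.f + q3 * (r div q3 * (r + k))" using rk by Groebner_Basis.algebra
    hence "q3 dvd k\<^sup>2 - C.f" using q3d by (metis dvd_add_left_iff dvd_triv_left)
    then obtain q' where q': "k\<^sup>2 - C.f = q3 * q'" by auto
    define l m where "l = coeff k 1" and "m = coeff k 0"
    have k: "k = [:m, l:]" unfolding l_def m_def by (rule poly_explicit(2)[OF dk])
    have "has_lead (k\<^sup>2) 3 0" using has_lead_Suc[of "k\<^sup>2" 2] has_lead_power[of k 1 l 2] by (simp add: k has_lead_def eval_nat_numeral)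
    hence "has_lead (q3 * q') 3 (- 1)" using has_lead_diff[OF _ C.has_lead_polys(1)] unfolding q'[symmetric] by force
    note co' = cofactor_lead[OF this _ q3(3)]
    have dq': "degree q' = 1" "coeff q' 1 = - 1" using co' q3(2) by auto
    define s where "s = coeff q' 0"
    have q's: "q' = - [:-s, 1:]" using poly_explicit(2)[of q'] dq' by (simp add: s_def)
    have q'A: "map_poly to_ac q' = - [:- to_ac s, 1:]"
      unfolding q's by (simp only: ac.map_poly_simps ac.map_pCons ac.hom_simps)
    define kA where "kA = map_poly to_ac k"
    have kA: "kA = [:to_ac m, to_ac l:]" unfolding kA_def k by (simp only: ac.map_poly_simps ac.map_pCons)
    have krA: "poly kA z = poly rA z" if "poly (map_poly to_ac q3) z = 0" for z
    proof -
      have "map_poly to_ac r = map_poly to_ac (r div q3 * q3 + k)" by (simp only: rk[symmetric])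
      hence "rA = map_poly to_ac (r div q3) * map_poly to_ac q3 + kA"
        unfolding rA_def kA_def by (simp only: ac.map_poly_simps)
      thus ?thesis using that by simp
    qed
    have roots': "poly (map_poly to_ac q3) x5 = 0" "poly (map_poly to_ac q3) x6 = 0" unfolding x56 poly_mult by simp_all
    define S where "S = Affine s (poly k s)"
    have SA: "map_ec_point to_ac S = Affine (to_ac s) (poly kA (to_ac s))" by (simp add: S_def ac.poly_map kA_def)
    have "A.on_line (to_ac l) (to_ac m) x5 (poly kA x5) x6 (poly kA x6) (to_ac s) (poly kA (to_ac s))"
      unfolding A.on_line_poly_iff kA[symmetric] fibre_map[OF q', folded kA_def] x56 q'A by (simp only: mult_minus_right simp_thms)
    hence col: "A.collinear (R x5) (R x6) (map_ec_point to_ac S)"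
      unfolding SA R_def krA[OF roots'(1), symmetric] krA[OF roots'(2), symmetric] by auto
    note on = A.collinear_on_curve[OF col]
    have "map_poly to_ac q = smult (to_ac (c\<^sup>2)) (map_poly to_ac q3)" unfolding q3(1) by (rule ac.map_smult)
    hence "rA\<^sup>2 - A.f = smult ((to_ac c)\<^sup>2) (([:-x1, 1:] * [:-x2, 1:] * [:-x3, 1:]) * ([:-x4, 1:] * [:-x5, 1:] * [:-x6, 1:]))"
      unfolding eqA x56 by (simp only: mult_smult_right to_ac_power mult.assoc)
    from A.cubic_zero_sum[OF this[unfolded rA] _ refl refl refl refl refl refl] False
    have "ec_add A.E (ec_add A.E (ec_add A.E (R x1) (R x2)) (R x3)) (ec_add A.E (ec_add A.E (R x4) (R x5)) (R x6)) = Infinity"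
      unfolding R_def rA by simp
    moreover have "ec_add A.E (ec_add A.E (R x4) (R x5)) (R x6) = ec_add A.E (R x4) (ec_neg (map_ec_point to_ac S))"
      using A.add_assoc[OF R(4) on(1,2)] A.collinear_add[OF col] by simp
    ultimately have z: "ec_add A.E (ec_add A.E (ec_add A.E (ec_add A.E (R x1) (R x2)) (R x3)) (R x4)) (ec_neg (map_ec_point to_ac S)) = Infinity"
      using A.add_assoc[of "ec_add A.E (ec_add A.E (R x1) (R x2)) (R x3)" "R x4" "ec_neg (map_ec_point to_ac S)"] R on
      by (simp add: A.on_curve_add)
    have onR: "on_curve A.E (ec_add A.E (R x1) (R x2))" "on_curve A.E (ec_add A.E (ec_add A.E (R x1) (R x2)) (R x3))"
      "on_curve A.E (ec_add A.E (ec_add A.E (ec_add A.E (R x1) (R x2)) (R x3)) (R x4))"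
      using R A.on_curve_add by blast+
    have "ec_neg (map_ec_point to_ac S) = ec_neg (ec_add A.E (ec_add A.E (ec_add A.E (R x1) (R x2)) (R x3)) (R x4))"
      using A.eq_neg_if_zero_sum[OF onR(3) _ z] on(3) by simp
    hence S: "map_ec_point to_ac S = ec_add A.E (ec_add A.E (ec_add A.E (R x1) (R x2)) (R x3)) (R x4)"
      by (metis ec_neg_neg)
    have "ec_mult A.E 3 (map_ec_point to_ac S) = ec_add A.E (ec_add A.E (ec_add A.E PA PA) PA) PA"
      unfolding S using A.mult_add R onR by simp
    also have "\<dots> = ec_add A.E (ec_add A.E PA PA) (ec_add A.E PA PA)"
      using A.add_assoc on_curve_PA A.on_curve_add by metis
    finally have "ec_mult A.E 3 (ec_add A.E (map_ec_point to_ac S) (ec_neg PA)) = PA"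
      by (rule A.triple_sub[OF on_curve_PA on(3)])
    hence "ec_mult A.E 3 (map_ec_point to_ac (ec_add C.E S (ec_neg PK))) = PA"
      unfolding map_add_A map_neg PA_map .
    moreover have "on_curve C.E (ec_add C.E S (ec_neg PK))"
      using on(3) on_curve_PK C.on_curve_add C.on_curve_neg unfolding on_curve_A by blast
    ultimately show ?thesis by (intro magnified_if_third)
  next
    case True
    \<comment> \<open>A line would make \<open>r\<^sup>2 - f\<close> cubic, too small for the factor
      \<open>h\<close> of degree 4.\<close>
    have b0: "b \<noteq> 0"
    proof
      assume "b = 0"
      hence "has_lead (r\<^sup>2) 3 0" using True has_lead_Suc[of "r\<^sup>2" 2] has_lead_power[of r 1 a 2] by (simp add: r has_lead_def eval_nat_numeral)
      hence "has_lead (h * q) 3 (- 1)" using has_lead_diff[OF _ C.has_lead_polys(1)] unfolding q[symmetric] by force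
      from cofactor_lead(1)[OF this _ h1] show False using d by simp
    qed
    have "has_lead (r\<^sup>2) 4 (b\<^sup>2)" using True has_lead_power[of r 2 b 2] by (simp add: r has_lead_def eval_nat_numeral)
    moreover have "has_lead C.f 4 0" using C.has_lead_polys(1) by (simp add: has_lead_def coeff_eq_0)
    ultimately have "has_lead (h * q) 4 (b\<^sup>2)" using has_lead_diff unfolding q[symmetric] by force
    note co = cofactor_lead[OF this _ h1]
    have "degree q = 0" "coeff q 0 = b\<^sup>2" using co d b0 by auto
    hence q': "q = [:b\<^sup>2:]" using poly_explicit(1)[of q] by simp
    have "map_poly to_ac q = [:(to_ac b)\<^sup>2:]" unfolding q' by (simp only: ac.map_poly_simps ac.map_pCons to_ac_power)
    hence "[:to_ac e, to_ac a, to_ac b:]\<^sup>2 - A.f = smult ((to_ac b)\<^sup>2) ([:-x1, 1:] * [:-x2, 1:] * [:-x3, 1:] * [:-x4, 1:])"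
      using eqA True unfolding rA by (simp add: mult.commute del: mult_pCons_left)
    moreover have rA': "rA = [:to_ac e, to_ac a, to_ac b:]" using rA True by simp
    ultimately obtain t s where ts: "A.collinear (R x1) (R x2) (Affine t s)" "A.collinear (R x3) (R x4) (Affine t (- s))"
      using A.parabola_zero_sum[OF _ _ refl refl refl refl, of "to_ac e" "to_ac a" "to_ac b" x1 x2 x3 x4] b0
      unfolding R_def rA' by auto
    have "ec_add A.E (ec_add A.E (R x1) (R x2)) (ec_add A.E (R x3) (R x4)) = Infinity"
      using A.collinear_add[OF ts(1)] A.collinear_add[OF ts(2)] A.add_neg[of "Affine t (- s)"] by simp
    hence "ec_mult A.E 3 (ec_add A.E (ec_add A.E (R x1) (R x2)) (ec_add A.E (R x3) (R x4))) = Infinity"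
      by (simp add: eval_nat_numeral)
    hence "ec_add A.E (ec_add A.E PA PA) (ec_add A.E PA PA) = Infinity"
      using A.mult_add R A.on_curve_add by simp
    hence "ec_mult A.E 3 (map_ec_point to_ac (ec_neg PK)) = PA"
      unfolding map_neg PA_map by (rule A.triple_neg[OF on_curve_PA])
    thus ?thesis using on_curve_PK by (intro magnified_if_third[of "ec_neg PK"]) auto
  qed
qed

end

text \<open>Reducing modulo the quadratic separates the two roots over the ground field.\<close>

lemma (in field_hom) root_descends:
  fixes g :: "'a poly"
  assumes two: "(2::'a) \<noteq> 0" and g: "degree g = 2" "poly (map_poly h g) x = 0"
    and uniq: "\<And>y. poly (map_poly h g) y = 0 \<Longrightarrow> y \<noteq> x \<Longrightarrow>
      \<exists>p. poly (map_poly h p) x = 0 \<and> poly (map_poly h p) y \<noteq> 0"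
  shows "x \<in> range h"
proof -
  define c b a where "c = coeff g 2" and "b = coeff g 1" and "a = coeff g 0"
  have c0: "c \<noteq> 0" using g(1) unfolding c_def by (metis leading_coeff_0_iff degree_0 zero_neq_numeral)
  have g': "g = [:a, b, c:]" unfolding a_def b_def c_def by (rule poly_explicit(3)) (simp add: g)
  \<comment> \<open>The other root, from the sum of the roots.\<close>
  define y where "y = h (- b / c) - x"
  have hc: "h c \<noteq> 0" using c0 by (simp add: hom_eq_0_iff)
  have hb: "h b = - (h c * (x + y))" using hc by (simp add: y_def hom_simps)
  have gx: "h a + h b * x + h c * x\<^sup>2 = 0"
    using g(2) unfolding g' map_pCons by (simp add: algebra_simps power2_eq_square map_poly_simps)
  have "h a + h b * y + h c * y\<^sup>2 = 0" using gx unfolding hb by Groebner_Basis.algebra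
  hence gy: "poly (map_poly h g) y = 0"
    unfolding g' map_pCons by (simp add: algebra_simps power2_eq_square map_poly_simps)
  show ?thesis
  proof (cases "y = x")
    case True
    have "h 2 * x = h (- b / c)" using True by (simp add: y_def hom_numeral algebra_simps)
    hence "x = h (- b / c) / h 2" using two hom_eq_0_iff[of 2] by (metis nonzero_mult_div_cancel_left)
    hence "x = h (- b / c / 2)" by (simp only: hom_divide)
    thus ?thesis by blast
  next
    case False
    obtain p where p: "poly (map_poly h p) x = 0" "poly (map_poly h p) y \<noteq> 0" using uniq[OF gy False] by blast
    \<comment> \<open>The linear remainder of \<open>p\<close> vanishes at \<open>x\<close> but not
      at \<open>y\<close>, so it is not constant and its zero is rational.\<close>
    define k where "k = p mod g"
    have g0: "g \<noteq> 0" using g by auto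
    have "degree k < 2" unfolding k_def using degree_mod_less[OF g0, of p] g(1) by auto
    hence k: "k = [:coeff k 0, coeff k 1:]" by (rule poly_explicit(2))
    have "p = p div g * g + k" by (simp add: k_def)
    hence "map_poly h p = map_poly h (p div g) * map_poly h g + map_poly h k" by (metis map_poly_simps(3,4))
    hence kx: "poly (map_poly h k) x = 0" "poly (map_poly h k) y \<noteq> 0" using p g(2) gy by auto
    have ev: "poly (map_poly h k) z = h (coeff k 0) + h (coeff k 1) * z" for z
      by (subst k) (simp add: map_pCons map_poly_simps)
    have "coeff k 1 \<noteq> 0" using kx unfolding ev by (auto simp: hom_zero)
    hence "h (coeff k 1) \<noteq> 0" by (simp add: hom_eq_0_iff)
    hence "x = - h (coeff k 0) / h (coeff k 1)" using kx(1) unfolding ev by (simp add: field_simps add_eq_0_iff)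
    hence "x = h (- coeff k 0 / coeff k 1)" by (simp add: hom_simps)
    thus ?thesis by blast
  qed
qed

section \<open>Fibre factors of degree 3\<close>

context triple_fibre
begin

lemma triple_same_abscissa:
  assumes "on_curve A.E R" "on_curve A.E R'" "ec_mult A.E 3 R = PA" "ec_mult A.E 3 R' = PA"
    "R = Affine x y" "R' = Affine x y'"
  shows "R = R'"
  using A.triple_inj_on_fibre[of x y y' "to_ac \<eta>" "to_ac xP"] assms eta(2) by (auto simp: PA_def)

text \<open>The abscissa \<open>x0\<close> of the difference of two points of a line in the fibre is the only common
  root of \<open>psi\<close>, \<open>4 f - h\<close> and \<open>2 f' - h'\<close>: a second one would give a second subgroup
  of order 3 with the same coset.\<close>

lemma line_case:
  assumes ff: "fibre_factor h r" and d: "degree h = 3"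
    and x: "map_poly to_ac h = [:-x1, 1:] * [:-x2, 1:] * [:-x3, 1:]"
  defines "R \<equiv> \<lambda>x. Affine x (poly (map_poly to_ac r) x)"
  assumes sum: "ec_add A.E (ec_add A.E (R x1) (R x2)) (R x3) = PA"
  shows "K_magnified E (Affine xP yP)"
proof -
  have roots: "poly (map_poly to_ac h) x1 = 0" "poly (map_poly to_ac h) x2 = 0" "poly (map_poly to_ac h) x3 = 0"
    unfolding x poly_mult by simp_all
  have R: "on_curve A.E (R x1)" "on_curve A.E (R x2)" "on_curve A.E (R x3)"
    "ec_mult A.E 3 (R x1) = PA" "ec_mult A.E 3 (R x2) = PA" "ec_mult A.E 3 (R x3) = PA"
    using fibre_point[OF ff] roots unfolding R_def by blast+
  have h1: "lead_coeff h = 1" using ff by (simp add: fibre_factor_def)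
  define T where "T = ec_add A.E (R x2) (ec_neg (R x1))"
  have onT: "on_curve A.E T" unfolding T_def using R A.on_curve_add by simp
  have T3: "ec_mult A.E 3 T = Infinity"
    unfolding T_def using A.mult_add[OF R(2), of "ec_neg (R x1)" 3] A.mult_neg[OF R(1), of 3] R A.add_neg[of PA] by simp
  have R2: "R x2 = ec_add A.E (R x1) T"
    using A.add_assoc[OF R(2), of "ec_neg (R x1)" "R x1"] A.add_commute[OF R(1) onT] R A.add_neg[of "ec_neg (R x1)"]
    by (simp add: T_def)
  have R3: "R x3 = ec_add A.E (R x1) (ec_neg T)"
  proof -
    \<comment> \<open>Both \<open>sum\<close> and the choice of \<open>R x1\<close> express
      \<open>P\<close>; cancelling in \<open>R x1 + R x2 + R x3 = 3 (R x1)\<close> leaves the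
      claim.\<close>
    have "ec_add A.E (ec_add A.E (R x1) (R x2)) (R x3) = ec_add A.E (R x1) (ec_add A.E (R x1) (R x1))"
      unfolding sum using R(4) by (simp add: A.mult_3)
    also have "\<dots> = ec_add A.E (ec_add A.E (R x1) (R x2)) (ec_add A.E (R x1) (ec_neg T))"
    proof -
      have "ec_add A.E (R x2) (ec_neg T) = R x1"
        unfolding R2 using A.add_neg_cancel[OF R(1) onT] .
      hence "ec_add A.E (R x2) (ec_add A.E (R x1) (ec_neg T)) = ec_add A.E (R x1) (R x1)"
        using A.add_assoc A.add_commute R onT A.on_curve_neg by metis
      thus ?thesis using A.add_assoc[OF R(1,2), of "ec_add A.E (R x1) (ec_neg T)"] R onT A.on_curve_add by simp
    qed
    finally show ?thesis
      by (rule A.add_left_cancel[rotated 3]) (use R onT A.on_curve_add in simp_all)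
  qed
  show ?thesis
  proof (cases T)
    case Infinity
    \<comment> \<open>If \<open>T\<close> is zero, the three points coincide and \<open>h\<close> is
      a cube, whose root is rational because 3 is invertible.\<close>
    have "R x2 = R x1" "R x3 = R x1" using R2 R3 Infinity by simp_all
    hence xx: "x2 = x1" "x3 = x1" by (simp_all add: R_def)
    have "coeff (map_poly to_ac h) 2 = - (3 * x1)" unfolding x xx by (simp add: eval_nat_numeral)
    hence "to_ac (coeff h 2) = - (3 * x1)" by (simp add: ac.coeff_map)
    moreover have "to_ac 3 \<noteq> (0 :: 'k alg_closure)" using three ac.hom_eq_0_iff[of 3] by blast
    ultimately have "x1 = to_ac (- coeff h 2 / 3)" by (simp add: field_simps)
    hence "poly h (- coeff h 2 / 3) = 0" using roots(1) by (simp only: ac.poly_map ac.hom_eq_0_iff)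
    thus ?thesis by (rule magnified_if_rational_root[OF ff])
  next
    case (Affine x0 y0)
    \<comment> \<open>Stated for any point over a zero of \<open>psi\<close>, since it is applied to
      \<open>T\<close> and again to a hypothetical second common root.\<close>
    have key: "x1 \<noteq> x0' \<and> (\<exists>z2 z3 v2 v3. ec_add A.E (R x1) (Affine x0' y0') = Affine z2 v2 \<and>
        ec_add A.E (R x1) (ec_neg (Affine x0' y0')) = Affine z3 v3 \<and>
        ec_mult A.E 3 (Affine z2 v2) = PA \<and> ec_mult A.E 3 (Affine z3 v3) = PA \<and>
        on_curve A.E (Affine z2 v2) \<and> on_curve A.E (Affine z3 v3) \<and>
        (x1 - x0') * (z2 - x0') + (x1 - x0') * (z3 - x0') + (z2 - x0') * (z3 - x0') = 2 * poly A.df x0' \<and>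
        (x1 - x0') * (z2 - x0') * (z3 - x0') = - 4 * poly A.f x0')"
      if on: "on_curve A.E (Affine x0' y0')" and psi: "poly A.psi x0' = 0" for x0' y0'
    proof -
      have t0: "ec_mult A.E 3 (Affine x0' y0') = Infinity" using A.triple_point[OF on] psi by simp
      have ne: "x1 \<noteq> x0'" using ff roots(1) psi by (auto simp: fibre_factor_def)
      obtain z2 v2 z3 v3 where z: "ec_add A.E (Affine x1 (poly (map_poly to_ac r) x1)) (Affine x0' y0') = Affine z2 v2"
        "ec_add A.E (Affine x1 (poly (map_poly to_ac r) x1)) (Affine x0' (- y0')) = Affine z3 v3"
        "(x1 - x0') * (z2 - x0') + (x1 - x0') * (z3 - x0') + (z2 - x0') * (z3 - x0') = 2 * poly A.df x0'"
        "(x1 - x0') * (z2 - x0') * (z3 - x0') = - 4 * poly A.f x0'"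
        using A.three_torsion_translates[OF R(1)[unfolded R_def] on psi ne] by blast
      have e: "ec_neg (Affine x0' y0') = Affine x0' (- y0')" by simp
      have z2: "ec_add A.E (R x1) (Affine x0' y0') = Affine z2 v2" and z3: "ec_add A.E (R x1) (ec_neg (Affine x0' y0')) = Affine z3 v3"
        unfolding e R_def using z by auto
      have on': "on_curve A.E (ec_neg (Affine x0' y0'))" using on unfolding A.on_curve_neg .
      have "ec_mult A.E 3 (Affine z2 v2) = PA" "ec_mult A.E 3 (Affine z3 v3) = PA"
        unfolding z2[symmetric] z3[symmetric] A.mult_add[OF R(1) on] A.mult_add[OF R(1) on'] A.mult_neg[OF on] t0 R(4)
        by simp_all
      moreover have "on_curve A.E (Affine z2 v2)" "on_curve A.E (Affine z3 v3)"
        unfolding z2[symmetric] z3[symmetric] using A.on_curve_add R on on' by blast+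
      ultimately show ?thesis using ne z2 z3 z(3,4) by blast
    qed
    have psi0: "poly A.psi x0 = 0"
      using T3 A.triple_point[OF onT[unfolded Affine]] unfolding Affine by (auto split: if_splits)
    note k = key[OF onT[unfolded Affine] psi0]
    have R2': "ec_add A.E (R x1) (Affine x0 y0) = Affine x2 (poly (map_poly to_ac r) x2)"
      and R3': "ec_add A.E (R x1) (ec_neg (Affine x0 y0)) = Affine x3 (poly (map_poly to_ac r) x3)"
      using R2 R3 unfolding Affine by (simp_all only: R_def)
    have e2: "(x1 - x0) * (x2 - x0) + (x1 - x0) * (x3 - x0) + (x2 - x0) * (x3 - x0) = 2 * poly A.df x0"
      and e3: "(x1 - x0) * (x2 - x0) * (x3 - x0) = - 4 * poly A.f x0"
      using k unfolding R2' R3' by auto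
    \<comment> \<open>A common zero \<open>z\<close> of these satisfies, for the abscissae of the
      three given points, the two relations that \<open>key\<close> gives for a coset of a point
      over \<open>z\<close>; \<open>x0\<close> is one such zero.\<close>
    define g1 g2 where "g1 = smult 4 C.f - h" and "g2 = smult 2 C.df - pderiv h"
    have hA: "poly (map_poly to_ac h) z = (z - x1) * (z - x2) * (z - x3)" for z unfolding x poly_mult by simp
    have dhA: "poly (map_poly to_ac (pderiv h)) z = (z - x1) * (z - x2) + (z - x1) * (z - x3) + (z - x2) * (z - x3)" for z
    proof -
      have "map_poly to_ac (pderiv h) = pderiv (map_poly to_ac h)"
        by (rule poly_eqI) (simp add: coeff_pderiv ac.coeff_map)
      thus ?thesis unfolding x pderiv_mult by (simp only: poly_add poly_mult) (simp add: pderiv_pCons algebra_simps)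
    qed
    have g1A: "poly (map_poly to_ac g1) z = 4 * poly A.f z - (z - x1) * (z - x2) * (z - x3)" for z
      unfolding g1_def hA[symmetric] polys_map by (simp add: ac.map_poly_simps ac.map_smult)
    have g2A: "poly (map_poly to_ac g2) z = 2 * poly A.df z - ((z - x1) * (z - x2) + (z - x1) * (z - x3) + (z - x2) * (z - x3))" for z
      unfolding g2_def dhA[symmetric] polys_map by (simp add: ac.map_poly_simps ac.map_smult)
    have g10: "poly (map_poly to_ac g1) x0 = 0" using e3 unfolding g1A by (simp add: algebra_simps)
    have g20: "poly (map_poly to_ac g2) x0 = 0" using e2 unfolding g2A by (simp add: algebra_simps)
    have dg2: "degree g2 = 2"
    proof (rule has_lead_degree)
      have "has_lead (pderiv h) 2 3"
        using d h1 by (auto simp: has_lead_def coeff_pderiv eval_nat_numeral coeff_eq_0 intro!: degree_le)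
      moreover have "has_lead (smult 2 C.df) 2 6" by (simp add: has_lead_def C.df_def eval_nat_numeral)
      ultimately have "has_lead g2 2 (6 - 3)" unfolding g2_def by (intro has_lead_diff)
      thus "has_lead g2 2 3" by simp
    qed (rule three)
    have "x0 \<in> range to_ac"
    proof (rule ac.root_descends[OF two dg2 g20])
      fix y assume y: "poly (map_poly to_ac g2) y = 0" "y \<noteq> x0"
      show "\<exists>p. poly (map_poly to_ac p) x0 = 0 \<and> poly (map_poly to_ac p) y \<noteq> 0"
      proof (rule ccontr)
        \<comment> \<open>If every rational polynomial vanishing at \<open>x0\<close> vanished at
          \<open>y\<close>, then \<open>y\<close> would be a zero of \<open>psi\<close> and of
          \<open>g1\<close>.\<close>
        assume no: "\<not> ?thesis"
        have psiy: "poly A.psi y = 0" using no psi0 unfolding polys_map by blast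
        have g1y: "poly (map_poly to_ac g1) y = 0" using no g10 by blast
        obtain v where v: "v\<^sup>2 = poly A.f y"
          using alg_closed_imp_poly_has_root[of "[:- poly A.f y, 0, 1:]"]
          by (auto simp: power2_eq_square)
        have on: "on_curve A.E (Affine y v)" using v by (simp add: A.f_def algebra_simps power2_eq_square power3_eq_cube)
        from key[OF on psiy] obtain z2 z3 v2 v3 where z: "x1 \<noteq> y"
          "ec_add A.E (R x1) (Affine y v) = Affine z2 v2" "ec_add A.E (R x1) (ec_neg (Affine y v)) = Affine z3 v3"
          "ec_mult A.E 3 (Affine z2 v2) = PA" "ec_mult A.E 3 (Affine z3 v3) = PA"
          "on_curve A.E (Affine z2 v2)" "on_curve A.E (Affine z3 v3)"
          "(x1 - y) * (z2 - y) + (x1 - y) * (z3 - y) + (z2 - y) * (z3 - y) = 2 * poly A.df y"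
          "(x1 - y) * (z2 - y) * (z3 - y) = - 4 * poly A.f y" by blast
        \<comment> \<open>The zeros of \<open>g1\<close> and \<open>g2\<close> at \<open>y\<close>
          give the coset of \<open>R x1\<close> by the point over \<open>y\<close> the same two
          symmetric functions as the given coset; cancelling \<open>x1 - y\<close> identifies the
          other two abscissae.\<close>
        have s3: "(x1 - y) * ((z2 - y) * (z3 - y)) = (x1 - y) * ((x2 - y) * (x3 - y))"
          using g1y z(9) unfolding g1A by Groebner_Basis.algebra
        hence p: "(z2 - y) * (z3 - y) = (x2 - y) * (x3 - y)" using z(1) by simp
        have "(x1 - y) * ((z2 - y) + (z3 - y)) = (x1 - y) * ((x2 - y) + (x3 - y))"
        proof -
          have "(x1 - y) * (z2 - y) + (x1 - y) * (z3 - y) + (z2 - y) * (z3 - y) =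
             (x1 - y) * (x2 - y) + (x1 - y) * (x3 - y) + (x2 - y) * (x3 - y)"
            using y(1) z(8) unfolding g2A by Groebner_Basis.algebra
          thus ?thesis unfolding p by (simp add: algebra_simps)
        qed
        hence s: "(z2 - y) + (z3 - y) = (x2 - y) + (x3 - y)" using z(1) by simp
        have "(z2 - x2) * (z2 - x3) = 0" using p s by Groebner_Basis.algebra
        hence "z2 = x2 \<or> z2 = x3" by simp
        hence "Affine z2 v2 = R x2 \<or> Affine z2 v2 = R x3"
          using triple_same_abscissa[OF z(6) R(2) z(4) R(5) refl] triple_same_abscissa[OF z(6) R(3) z(4) R(6) refl]
          unfolding R_def by blast
        hence "ec_add A.E (R x1) (Affine y v) = ec_add A.E (R x1) T \<or> ec_add A.E (R x1) (Affine y v) = ec_add A.E (R x1) (ec_neg T)"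
          using z(2) R2 R3 by metis
        hence "Affine y v = T \<or> Affine y v = ec_neg T"
          using A.add_left_cancel[OF R(1) on] onT A.on_curve_neg by blast
        thus False using y(2) unfolding Affine by simp
      qed
    qed
    then obtain x0' where x0': "x0 = to_ac x0'" by blast
    define u where "u = x1 - x0"
    \<comment> \<open>The sum of the abscissae relative to \<open>x0\<close> is the one symmetric
      function that the torsion point does not fix; it is rational by a coefficient of
      \<open>h\<close>.\<close>
    define e where "e = x1 + x2 + x3 - 3 * x0"
    have eK: "e = to_ac (- coeff h 2 - 3 * x0')"
    proof -
      have "coeff (map_poly to_ac h) 2 = - (x1 + x2 + x3)" unfolding x by (simp add: eval_nat_numeral)
      thus ?thesis by (simp add: ac.coeff_map e_def x0')
    qed
    have "(u - (x1 - x0)) * (u - (x2 - x0)) * (u - (x3 - x0)) = u ^ 3 - e * u\<^sup>2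
       + ((x1 - x0) * (x2 - x0) + (x1 - x0) * (x3 - x0) + (x2 - x0) * (x3 - x0)) * u - (x1 - x0) * (x2 - x0) * (x3 - x0)"
      unfolding e_def by Groebner_Basis.algebra
    hence "u ^ 3 - e * u\<^sup>2 + 2 * poly A.df x0 * u + 4 * poly A.f x0 = 0" unfolding e2 e3 by (simp add: u_def)
    hence u: "u ^ 3 - to_ac (- coeff h 2 - 3 * x0') * u\<^sup>2 + 2 * to_ac (poly C.df x0') * u + 4 * to_ac (poly C.f x0') = 0"
      unfolding eK x0' polys_map ac.poly_map .
    have psi: "poly C.psi x0' = 0" using psi0 unfolding x0' polys_map ac.poly_map by simp
    have x1: "x1 = to_ac x0' + u" by (simp add: u_def x0')
    have "poly A.phi x1 = to_ac xP * (poly A.psi x1)\<^sup>2" "poly A.psi x1 \<noteq> 0"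
      using ff roots(1) unfolding fibre_factor_def by blast+
    thus ?thesis unfolding x1
      by (rule three_isogeny_magnified[OF two three ell sq C.cubic_curve_axioms A.cubic_curve_axioms P
            eta(2)[unfolded eta(1)] psi _ _ u])
  qed
qed

text \<open>If \<open>r\<close> is a line, the three fibre points sum to zero, so
  \<open>3 P = 0\<close> and \<open>P\<close> itself is the torsion point. Otherwise the fourth
  point \<open>S\<close> of the parabola is rational and is the negative of \<open>sum\<close>, and
  \<open>T = S + P\<close> is killed by 3; it is zero only if \<open>sum\<close> is
  \<open>P\<close>, which is \<open>line_case\<close>.\<close>

lemma degree_3_case:
  assumes ff: "fibre_factor h r" and d: "degree h = 3"
  shows "K_magnified E (Affine xP yP) \<or> (\<exists>T\<in>points E. T \<noteq> Infinity \<and> ec_mult E 3 T = Infinity)"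
proof -
  have h1: "lead_coeff h = 1" and dr: "degree r < 3" and "h dvd r\<^sup>2 - C.f" using ff d by (auto simp: fibre_factor_def)
  then obtain q where q: "r\<^sup>2 - C.f = h * q" by auto
  define a b c where "a = coeff r 0" and "b = coeff r 1" and "c = coeff r 2"
  have r: "r = [:a, b, c:]" unfolding a_def b_def c_def by (rule poly_explicit(3)[OF dr])
  define rA where "rA = map_poly to_ac r"
  have rA: "rA = [:to_ac a, to_ac b, to_ac c:]"
    unfolding rA_def r by (simp only: ac.map_poly_simps ac.map_pCons)
  obtain x1 x2 x3 where x: "map_poly to_ac h = [:-x1, 1:] * [:-x2, 1:] * [:-x3, 1:]"
    using monic_split(2)[of "map_poly to_ac h"] h1 d by (auto simp: ac.degree_map ac.coeff_map)
  define R where "R x = Affine x (poly rA x)" for x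
  have roots: "poly (map_poly to_ac h) x1 = 0" "poly (map_poly to_ac h) x2 = 0" "poly (map_poly to_ac h) x3 = 0"
    unfolding x poly_mult by simp_all
  have R: "on_curve A.E (R x1)" "on_curve A.E (R x2)" "on_curve A.E (R x3)"
    "ec_mult A.E 3 (R x1) = PA" "ec_mult A.E 3 (R x2) = PA" "ec_mult A.E 3 (R x3) = PA"
    using fibre_point[OF ff] roots unfolding R_def rA_def by blast+
  have eqA: "rA\<^sup>2 - A.f = [:-x1, 1:] * [:-x2, 1:] * [:-x3, 1:] * map_poly to_ac q"
    using fibre_map[OF q] unfolding rA_def x .
  define sum where "sum = ec_add A.E (ec_add A.E (R x1) (R x2)) (R x3)"
  have sum3: "ec_mult A.E 3 sum = ec_mult A.E 3 PA"
  proof -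
    have "ec_mult A.E 3 sum = ec_add A.E (ec_add A.E PA PA) PA"
      unfolding sum_def using A.mult_add R A.on_curve_add by simp
    thus ?thesis using A.add_assoc[OF on_curve_PA on_curve_PA on_curve_PA] by (simp add: A.mult_3)
  qed
  have onsum: "on_curve A.E sum" unfolding sum_def using R A.on_curve_add by blast
  show ?thesis
  proof (cases "c = 0")
    case True
    have "has_lead (r\<^sup>2) 3 0" using True has_lead_Suc[of "r\<^sup>2" 2] has_lead_power[of r 1 b 2] by (simp add: r has_lead_def eval_nat_numeral)
    hence "has_lead (h * q) 3 (- 1)" using has_lead_diff[OF _ C.has_lead_polys(1)] unfolding q[symmetric] by force
    note co = cofactor_lead[OF this _ h1]
    have "degree q = 0" "coeff q 0 = - 1" using co d by auto
    hence q': "q = - 1" using poly_explicit(1)[of q] by (simp add: one_pCons)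
    have qA: "map_poly to_ac q = - 1" unfolding q' by (simp only: ac.map_poly_simps)
    have rA': "rA = [:to_ac a, to_ac b:]" using rA True by simp
    have "A.on_line (to_ac b) (to_ac a) x1 (poly rA x1) x2 (poly rA x2) x3 (poly rA x3)"
      unfolding A.on_line_poly_iff rA'[symmetric] eqA qA by (simp only: mult_minus_right mult_1_right simp_thms)
    hence col: "A.collinear (R x1) (R x2) (R x3)" unfolding R_def by auto
    have "sum = Infinity" unfolding sum_def A.collinear_add[OF col] using A.add_neg[of "ec_neg (R x3)"] by simp
    hence "ec_mult A.E 3 (map_ec_point to_ac PK) = Infinity" using sum3 unfolding PA_map by (simp add: eval_nat_numeral)
    thus ?thesis using torsion_if_torsion[OF on_curve_PK] by (auto simp: PK_def)
  next
    case False
    have "has_lead (r\<^sup>2) 4 (c\<^sup>2)" using has_lead_power[of r 2 c 2] by (simp add: r has_lead_def eval_nat_numeral)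
    moreover have "has_lead C.f 4 0" using C.has_lead_polys(1) by (simp add: has_lead_def coeff_eq_0)
    ultimately have "has_lead (h * q) 4 (c\<^sup>2)" using has_lead_diff unfolding q[symmetric] by force
    note co = cofactor_lead[OF this _ h1]
    have dq: "degree q = 1" "coeff q 1 = c\<^sup>2" using co d False by auto
    define s where "s = - coeff q 0 / c\<^sup>2"
    have q': "q = smult (c\<^sup>2) [:-s, 1:]" using poly_explicit(2)[of q] dq False by (simp add: s_def)
    have qA: "map_poly to_ac q = smult ((to_ac c)\<^sup>2) [:- to_ac s, 1:]"
      unfolding q' by (simp only: ac.map_smult ac.map_poly_simps ac.map_pCons ac.hom_simps)
    define S where "S = Affine s (poly r s)"
    have SA: "map_ec_point to_ac S = R (to_ac s)" by (simp add: S_def R_def rA_def ac.poly_map)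
    have "rA\<^sup>2 - A.f = smult ((to_ac c)\<^sup>2) ([:-x1, 1:] * [:-x2, 1:] * [:-x3, 1:] * [:- to_ac s, 1:])"
      unfolding eqA qA by (simp only: mult_smult_right)
    from A.parabola_zero_sum[OF this[unfolded rA] _ refl refl refl refl] False
    obtain t v where tv: "A.collinear (R x1) (R x2) (Affine t v)" "A.collinear (R x3) (R (to_ac s)) (Affine t (- v))"
      unfolding R_def rA by auto
    have onS: "on_curve A.E (R (to_ac s))" using A.collinear_on_curve(2)[OF tv(2)] .
    have "ec_add A.E (R x1) (R x2) = ec_neg (ec_add A.E (R x3) (R (to_ac s)))"
      using A.collinear_add[OF tv(1)] A.collinear_add[OF tv(2)] by simp
    hence S: "sum = ec_neg (R (to_ac s))" unfolding sum_def using A.neg_add_cancel[OF R(3) onS] by simp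
    define T where "T = ec_add C.E S PK"
    have TA: "map_ec_point to_ac T = ec_add A.E (ec_neg sum) PA"
      unfolding T_def map_add_A SA PA_map S by simp
    have onT: "on_curve C.E T"
      unfolding T_def using onS on_curve_PK C.on_curve_add unfolding SA[symmetric] on_curve_A by blast
    have "ec_mult A.E 3 (map_ec_point to_ac T) = Infinity"
    proof -
      have "ec_mult A.E 3 (map_ec_point to_ac T) = ec_add A.E (ec_neg (ec_mult A.E 3 PA)) (ec_neg (ec_neg (ec_mult A.E 3 PA)))"
        unfolding TA using A.mult_add[of "ec_neg sum" PA 3] onsum on_curve_PA A.mult_neg[OF onsum, of 3] sum3 by simp
      thus ?thesis by (simp only: A.add_neg)
    qed
    show ?thesis
    proof (cases "T = Infinity")
      case True
      hence "ec_add A.E (ec_neg sum) PA = Infinity" using TA by simp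
      hence "PA = ec_neg (ec_neg sum)" using A.eq_neg_if_zero_sum[of "ec_neg sum" PA] onsum on_curve_PA by simp
      hence "sum = PA" by simp
      thus ?thesis using line_case[OF ff d x] unfolding sum_def R_def rA_def by blast
    next
      case False
      thus ?thesis using torsion_if_torsion[OF onT] \<open>ec_mult A.E 3 (map_ec_point to_ac T) = Infinity\<close> by blast
    qed
  qed
qed

end

theorem theorem1p3:
  fixes E :: "'k::field weierstrass"
    and P :: "'k ec_point"
    and \<iota> :: "'k \<Rightarrow> 'l::field"
    and R :: "'l ec_point"
  assumes "CHAR('k) \<noteq> 2" and "CHAR('k) \<noteq> 3"
    and "elliptic_curve E"
    and "P \<in> points E"
    and "\<not> torsion_point E P"
    and "finite_extension \<iota>"
    and "extension_degree \<iota> < 9"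
    and "R \<in> points (map_weierstrass \<iota> E)"
    and "ec_mult (map_weierstrass \<iota> E) 3 R = map_ec_point \<iota> P"
  shows "K_magnified E P \<or>
    (\<exists>T \<in> points E. T \<noteq> Infinity \<and> ec_mult E 3 T = Infinity)"
proof -
  have two: "(2::'k) \<noteq> 0" and three: "(3::'k) \<noteq> 0"
  proof -
    \<comment> \<open>If \<open>p\<close> is zero in the field, the characteristic divides
      \<open>p\<close>; it is not 1, so it is \<open>p\<close>.\<close>
    have "of_nat p \<noteq> (0::'k)" if p: "p = 2 \<or> p = 3" for p :: nat
    proof
      assume "of_nat p = (0::'k)"
      hence dvd: "CHAR('k) dvd p" by (simp only: of_nat_eq_0_iff_char_dvd)
      hence "CHAR('k) \<le> p" using p by (intro dvd_imp_le) auto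
      hence "CHAR('k) = 0 \<or> CHAR('k) = Suc 0 \<or> CHAR('k) = 2 \<or> CHAR('k) = 3" using p by linarith
      thus False using dvd p assms(1,2) CHAR_not_1'[where 'a = 'k] by auto
    qed
    from this[of 2] this[of 3] show "(2::'k) \<noteq> 0" "(3::'k) \<noteq> 0" by auto
  qed
  have not_torsion: "ec_mult E n P \<noteq> Infinity" if "n > 0" for n
    using assms(5) that unfolding torsion_point_def by blast
  have "P \<noteq> Infinity" using not_torsion[of 1] by auto
  then obtain xP yP where P: "P = Affine xP yP" by (cases P) auto
  define \<eta> where "\<eta> = yP + wa1 E / 2 * xP + wa3 E / 2"
  have on: "on_curve E (Affine xP yP)" using assms(4) by (simp add: P points_def)
  \<comment> \<open>Ordinate 0 would make \<open>P\<close> a point of order 2.\<close>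
  have eta: "\<eta> \<noteq> 0"
  proof
    assume "\<eta> = 0"
    hence "sq_point E P = Affine xP 0" by (simp only: P sq_point.simps \<eta>_def)
    hence "ec_mult (sq_curve E) 2 (sq_point E P) = Infinity"
      by (simp add: eval_nat_numeral sq_curve_def)
    hence "sq_point E (ec_mult E 2 P) = Infinity" using sq_point_mult[OF two assms(3), of P 2] on P by simp
    thus False using not_torsion[of 2] by simp
  qed
  define a2 a4 a6 where "a2 = wa2 E + (wa1 E / 2)\<^sup>2" and "a4 = wa4 E + 2 * (wa1 E / 2) * (wa3 E / 2)"
    and "a6 = wa6 E + (wa3 E / 2)\<^sup>2"
  have sq: "sq_curve E = Weierstrass 0 a2 0 a4 a6" by (simp add: sq_curve_def a2_def a4_def a6_def)
  interpret F: triple_fibre E xP yP a2 a4 a6 \<eta>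
    by unfold_locales (fact two three assms(3) on sq \<eta>_def eta)+
  interpret h: field_hom \<iota> using assms(6) by (auto simp: finite_extension_def intro: field_hom_if_field_embedding)
  interpret L: cubic_curve "\<iota> a2" "\<iota> a4" "\<iota> a6"
    by (rule h.cubic_curve_map[OF F.C.cubic_curve_axioms F.ell_sq])
  note map = h.cubic_polys_map[OF F.C.cubic_curve_axioms L.cubic_curve_axioms]
  have two': "(2::'l) \<noteq> 0" using L.two .
  define R' where "R' = sq_point (map_weierstrass \<iota> E) R"
  have sqL: "sq_curve (map_weierstrass \<iota> E) = L.E" unfolding h.map_sq_curve[symmetric] sq by (simp add: h.hom_zero)
  have onR: "on_curve (map_weierstrass \<iota> E) R" using assms(8) by (simp add: points_def)
  have ellL: "elliptic_curve (map_weierstrass \<iota> E)"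
    using assms(3) by (simp add: elliptic_curve_def h.wdisc_map h.hom_eq_0_iff)
  have onR': "on_curve L.E R'" unfolding R'_def sqL[symmetric] on_curve_sq[OF two'] by (rule onR)
  have "ec_mult L.E 3 R' = sq_point (map_weierstrass \<iota> E) (map_ec_point \<iota> P)"
    using sq_point_mult[OF two' ellL onR, of 3] assms(9) unfolding sqL R'_def by simp
  hence R3: "ec_mult L.E 3 R' = Affine (\<iota> xP) (\<iota> \<eta>)"
    unfolding h.map_sq_point[symmetric] P by (simp add: \<eta>_def)
  obtain x y where R': "R' = Affine x y" using R3 by (cases R') (auto simp: eval_nat_numeral)
  have psi: "poly L.psi x \<noteq> 0" "poly L.phi x / (poly L.psi x)\<^sup>2 = \<iota> xP"
    using L.triple_point[of x y] onR' R3 unfolding R' by (auto split: if_splits)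
  \<comment> \<open>\<open>phi\<close> is monic of degree 9 and \<open>psi\<^sup>2\<close> has
    degree at most 8, so no characteristic lowers the degree of \<open>\<Phi>\<close>.\<close>
  define \<Phi> where "\<Phi> = F.C.phi - [:xP:] * F.C.psi\<^sup>2"
  have "has_lead (F.C.psi\<^sup>2) 9 0" using has_lead_Suc[of "F.C.psi\<^sup>2" 8] has_lead_power[OF F.C.has_lead_polys(4), of 2] by simp
  hence "has_lead ([:xP:] * F.C.psi\<^sup>2) 9 0" using has_lead_mult[of "[:xP:]" 0 xP "F.C.psi\<^sup>2" 9 0] by (simp add: has_lead_def)
  hence "has_lead \<Phi> 9 1" unfolding \<Phi>_def using has_lead_diff[OF F.C.has_lead_polys(7)] by force
  hence dPhi: "degree \<Phi> = 9" by (rule has_lead_degree) simp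
  have "map_poly \<iota> \<Phi> = L.phi - [:\<iota> xP:] * L.psi\<^sup>2"
    unfolding \<Phi>_def map by (simp only: h.map_poly_simps h.map_pCons)
  moreover have "poly L.phi x = \<iota> xP * (poly L.psi x)\<^sup>2" using psi by (auto simp: field_simps)
  ultimately have "poly (map_poly \<iota> \<Phi>) x = 0" by simp
  from proper_factor[OF assms(6,7) dPhi this]
  obtain h where h: "h dvd \<Phi>" "lead_coeff h = 1" "0 < degree h" "2 * degree h \<le> 9" by blast
  obtain r where r: "F.fibre_factor h r" using F.fibre_factor_exists[OF h(2,3)] h(1) unfolding \<Phi>_def by blast
  have "degree h = 1 \<or> degree h = 2 \<or> degree h = 3 \<or> degree h = 4" using h(3,4) by linarith
  thus ?thesis using F.degree_1_case[OF r] F.degree_2_case[OF r] F.degree_3_case[OF r] F.degree_4_case[OF r]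
    unfolding P by blast
qed

end
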